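(* There is an algorithm which takes any finite biordered set $\mathcal{E}$ (with underlying set $E$) and computes finite presentations of each of the maximal subgroups $H_e$ $(e\in E)$ of the free idempotent generated semigroup $\mathsf{IG}(\mathcal{E})$. If each of these finitely presented groups $H_e$ has solvable word problem, then there is an algorithm which, given any two words $u,v\in E^*$, decides whether both $u$ and $v$ represent regular elements of $\mathsf{IG}(\mathcal{E})$ and, if they do, decides whether $u=v$ in $\mathsf{IG}(\mathcal{E})$.
   Context: For a semigroup $S$ with set of idempotents $E=E(S)$, a pair $(e,f)\in E\times E$ is a basic pair if $\{e,f\}\cap\{ef,fe\}\neq\varnothing$ (products in $S$); then $ef$ is again an idempotent. The biordered set of $S$ is the partial algebra $\mathcal{E}=(E,* )$ in which $e*f=ef$ if $(e,f)$ is a basic pair, and $e*f$ is undefined otherwise. A biordered set is a partial algebra arising in this way from some semigroup; a finite biordered set is given to an algorithm by its partial multiplication table. The free idempotent generated semigroup over $\mathcal{E}$ is the semigroup given by the presentation $\mathsf{IG}(\mathcal{E})=\langle E\mid ef=e*f\ ((e,f)\text{ a basic pair})\rangle$, where $ef$ is the word of length 2 and $e*f$ is a single letter. The idempotents of $\mathsf{IG}(\mathcal{E})$ are exactly the elements represented by the letters $e\in E$, and distinct letters represent distinct elements. $E^*$ is the set of all words over $E$ (the empty word represents no element of the semigroup). For $e\in E$, $H_e$ is the $\mathscr{H}$-class of $e$ in $\mathsf{IG}(\mathcal{E})$; it is a group with identity $e$, and these are the maximal subgroups. An element $a$ of a semigroup is regular if $aa'a=a$ for some $a'$. *)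

theory Defs
  imports
    "HOL-Library.Nat_Bijection"
    "HOL-Library.Countable_Set"
    "HOL-Algebra.Group"
begin

section \<open>Semigroups, idempotents and biordered sets\<close>

definition semigroup_on :: "'a set \<Rightarrow> ('a \<Rightarrow> 'a \<Rightarrow> 'a) \<Rightarrow> bool" where
  "semigroup_on S m \<longleftrightarrow>
     (\<forall>x\<in>S. \<forall>y\<in>S. m x y \<in> S) \<and>
     (\<forall>x\<in>S. \<forall>y\<in>S. \<forall>z\<in>S. m (m x y) z = m x (m y z))"

definition idempotents :: "'a set \<Rightarrow> ('a \<Rightarrow> 'a \<Rightarrow> 'a) \<Rightarrow> 'a set" where
  "idempotents S m = {e \<in> S. m e e = e}"

definition basic_pair :: "('a \<Rightarrow> 'a \<Rightarrow> 'a) \<Rightarrow> 'a \<Rightarrow> 'a \<Rightarrow> bool" where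
  "basic_pair m e f \<longleftrightarrow> {e, f} \<inter> {m e f, m f e} \<noteq> {}"

text \<open>Partial operations are option-valued, with None for undefined products.\<close>

definition biorder_op :: "'a set \<Rightarrow> ('a \<Rightarrow> 'a \<Rightarrow> 'a) \<Rightarrow> 'a \<Rightarrow> 'a \<Rightarrow> 'a option" where
  "biorder_op S m e f =
     (if e \<in> idempotents S m \<and> f \<in> idempotents S m \<and> basic_pair m e f
      then Some (m e f) else None)"

text \<open>
  The semigroup is taken on the same type as the partial algebra. On an infinite type this loses
  nothing for finite biordered sets: by the lemma biordered_set_transport below, a finite biordered
  set of a semigroup of any type, relabelled by natural numbers, is a biordered set in this sense.
\<close>

definition biordered_set :: "'a set \<Rightarrow> ('a \<Rightarrow> 'a \<Rightarrow> 'a option) \<Rightarrow> bool" where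
  "biordered_set E p \<longleftrightarrow>
     (\<exists>S m. semigroup_on S m \<and> E = idempotents S m \<and> p = biorder_op S m)"

inductive_set generated :: "('a \<Rightarrow> 'a \<Rightarrow> 'a) \<Rightarrow> 'a set \<Rightarrow> 'a set"
  for m :: "'a \<Rightarrow> 'a \<Rightarrow> 'a" and X :: "'a set" where
  base: "x \<in> X \<Longrightarrow> x \<in> generated m X"
| step: "x \<in> X \<Longrightarrow> y \<in> generated m X \<Longrightarrow> m x y \<in> generated m X"

lemma biordered_set_transport:
  fixes S :: "'b set" and \<phi> :: "nat \<Rightarrow> 'b"
  assumes sg: "semigroup_on S m" and bij: "bij_betw \<phi> {..<n} (idempotents S m)"
  shows "biordered_set {..<n} (\<lambda>i j. if i < n \<and> j < n
           then map_option (inv_into {..<n} \<phi>) (biorder_op S m (\<phi> i) (\<phi> j)) else None)"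
proof -
  define E where "E = idempotents S m"
  define T where "T = generated m E"
  have clos: "\<And>x y. x \<in> S \<Longrightarrow> y \<in> S \<Longrightarrow> m x y \<in> S"
    and assoc: "\<And>x y z. x \<in> S \<Longrightarrow> y \<in> S \<Longrightarrow> z \<in> S \<Longrightarrow> m (m x y) z = m x (m y z)"
    using sg by (auto simp: semigroup_on_def)
  have ES: "E \<subseteq> S" by (auto simp: E_def idempotents_def)
  have ET: "E \<subseteq> T" by (auto simp: T_def intro: generated.base)
  have TS: "T \<subseteq> S"
  proof
    fix x assume "x \<in> T"
    then show "x \<in> S" unfolding T_def by induction (use ES clos in auto)
  qed
  have Tclos: "m x y \<in> T" if "x \<in> T" "y \<in> T" for x y
    using that unfolding T_def
  proof induction
    case (base x)
    then show ?case by (rule generated.step)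
  next
    case (step x y')
    have "m (m x y') y = m x (m y' y)"
      using step TS ES unfolding T_def by (intro assoc) auto
    then show ?case using step by (auto intro: generated.step)
  qed
  have idT: "e \<in> E \<longleftrightarrow> e \<in> T \<and> m e e = e" for e
    using ET TS by (auto simp: E_def idempotents_def)
  have bijE: "bij_betw \<phi> {..<n} E" using bij by (simp add: E_def)
  then have finE: "finite E" using bij_betw_finite by blast
  have cT: "countable T"
  proof -
    have "T \<subseteq> (\<lambda>xs. foldr m (butlast xs) (last xs)) ` lists E"
    proof
      fix x assume "x \<in> T"
      then have "\<exists>xs. xs \<noteq> [] \<and> xs \<in> lists E \<and> x = foldr m (butlast xs) (last xs)"
        unfolding T_def
      proof induction
        case (base x)
        then show ?case by (intro exI[of _ "[x]"]) auto
      next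
        case (step x y)
        then obtain ys where "ys \<noteq> []" "ys \<in> lists E" "y = foldr m (butlast ys) (last ys)" by blast
        with step(1) show ?case by (intro exI[of _ "x # ys"]) auto
      qed
      then show "x \<in> (\<lambda>xs. foldr m (butlast xs) (last xs)) ` lists E" by blast
    qed
    moreover have "countable (lists E)" using finE by (simp add: countable_finite)
    ultimately show ?thesis by (meson countable_image countable_subset)
  qed
  define \<psi> where "\<psi> = inv_into {..<n} \<phi>"
  have \<psi>\<phi>: "\<psi> (\<phi> i) = i" if "i < n" for i
    using that bijE by (simp add: \<psi>_def bij_betw_def inv_into_f_f)
  have \<phi>E: "\<phi> i \<in> E" if "i < n" for i using that bijE by (auto simp: bij_betw_def)
  have \<phi>\<psi>: "\<phi> (\<psi> e) = e" "\<psi> e < n" if "e \<in> E" for e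
    using that bijE \<psi>\<phi> unfolding bij_betw_def by auto
  define g where "g x = (if x \<in> E then \<psi> x else n + to_nat_on T x)" for x
  have gE: "g x < n \<longleftrightarrow> x \<in> E" for x using \<phi>\<psi>(2) by (auto simp: g_def)
  have inj: "inj_on g T"
  proof (rule inj_onI)
    fix x y assume xy: "x \<in> T" "y \<in> T" "g x = g y"
    then have "x \<in> E \<longleftrightarrow> y \<in> E" using gE by metis
    show "x = y"
    proof (cases "x \<in> E")
      case True
      then have "\<psi> x = \<psi> y" using xy(3) \<open>x \<in> E \<longleftrightarrow> y \<in> E\<close> by (simp add: g_def)
      then show ?thesis using \<phi>\<psi>(1) True \<open>x \<in> E \<longleftrightarrow> y \<in> E\<close> by metis
    next
      case False
      then have "to_nat_on T x = to_nat_on T y"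
        using xy(3) \<open>x \<in> E \<longleftrightarrow> y \<in> E\<close> by (simp add: g_def)
      then show ?thesis using cT xy(1,2) by simp
    qed
  qed
  define h where "h = inv_into T g"
  have hg: "h (g x) = x" if "x \<in> T" for x using that inj by (simp add: h_def)
  define m' where "m' x y = g (m (h x) (h y))" for x y
  have m'g: "m' (g x) (g y) = g (m x y)" if "x \<in> T" "y \<in> T" for x y
    using that by (simp add: m'_def hg)
  have geq: "g x = g y \<longleftrightarrow> x = y" if "x \<in> T" "y \<in> T" for x y
    using that inj by (auto dest: inj_onD)
  have sg': "semigroup_on (g ` T) m'"
    using TS by (auto simp: semigroup_on_def m'g Tclos intro!: arg_cong[of _ _ g] assoc)
  have id': "idempotents (g ` T) m' = {..<n}"
  proof -
    have "idempotents (g ` T) m' = g ` E"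
      by (auto simp: idempotents_def m'g geq Tclos idT)
    also have "\<dots> = {..<n}"
    proof -
      have "i \<in> g ` E" if "i < n" for i
        using that \<phi>E \<psi>\<phi> by (intro image_eqI[of _ _ "\<phi> i"]) (auto simp: g_def)
      then show ?thesis using gE by auto
    qed
    finally show ?thesis .
  qed
  have g\<phi>: "g (\<phi> i) = i" if "i < n" for i using that by (simp add: g_def \<phi>E \<psi>\<phi>)
  have basicE: "m x y \<in> E" if "x \<in> E" "y \<in> E" "basic_pair m x y" for x y
  proof -
    have xyS: "x \<in> S" "y \<in> S" and idem: "m x x = x" "m y y = y"
      using that by (auto simp: E_def idempotents_def)
    have "m (m x y) (m x y) = m x y"
    proof -
      have expand: "m (m x y) (m x y) = m x (m (m y x) y)"
        using xyS by (simp add: clos assoc)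
      have "m x y = x \<or> m x y = y \<or> m y x = x \<or> m y x = y"
        using that(3) by (auto simp: basic_pair_def)
      then consider "m x y = x" | "m x y = y" | "m y x = x" | "m y x = y" by blast
      then show ?thesis
      proof cases
        case 3
        then have "m (m x y) (m x y) = m x (m x y)" using expand by simp
        also have "\<dots> = m (m x x) y" using assoc[OF xyS(1,1,2)] by simp
        finally show ?thesis by (simp add: idem)
      next
        case 4
        then show ?thesis using expand idem by simp
      qed (use idem in simp_all)
    qed
    then show ?thesis using xyS clos by (simp add: E_def idempotents_def)
  qed
  have "(if i < n \<and> j < n then map_option \<psi> (biorder_op S m (\<phi> i) (\<phi> j)) else None)
        = biorder_op (g ` T) m' i j" for i j
  proof (cases "i < n \<and> j < n")
    case False
    then show ?thesis by (auto simp: biorder_op_def id')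
  next
    case True
    then have ij: "\<phi> i \<in> E" "\<phi> j \<in> E" "\<phi> i \<in> T" "\<phi> j \<in> T" using \<phi>E ET by auto
    have m1: "m' i j = g (m (\<phi> i) (\<phi> j))" "m' j i = g (m (\<phi> j) (\<phi> i))"
      using m'g[OF ij(3,4)] m'g[OF ij(4,3)] True by (simp_all add: g\<phi>)
    have eqs: "(i = g x \<longleftrightarrow> \<phi> i = x) \<and> (j = g x \<longleftrightarrow> \<phi> j = x)" if "x \<in> T" for x
      using geq[OF ij(3) that] geq[OF ij(4) that] True by (simp add: g\<phi>)
    have b: "basic_pair m' i j \<longleftrightarrow> basic_pair m (\<phi> i) (\<phi> j)"
    proof -
      have bp: "basic_pair k x y \<longleftrightarrow> x = k x y \<or> x = k y x \<or> y = k x y \<or> y = k y x"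
        for k :: "'c \<Rightarrow> 'c \<Rightarrow> 'c" and x y
        unfolding basic_pair_def by blast
      show ?thesis
        unfolding bp m1 using eqs[OF Tclos[OF ij(3,4)]] eqs[OF Tclos[OF ij(4,3)]] by metis
    qed
    have "g (m (\<phi> i) (\<phi> j)) = \<psi> (m (\<phi> i) (\<phi> j))" if "basic_pair m (\<phi> i) (\<phi> j)"
      using basicE[OF ij(1,2) that] by (simp add: g_def)
    then show ?thesis using True ij b m1 by (auto simp: biorder_op_def id' E_def)
  qed
  then show ?thesis unfolding biordered_set_def \<psi>_def[symmetric]
    using sg' id' by (intro exI[of _ "g ` T"] exI[of _ m']) auto
qed


section \<open>Green's relation H and regular elements\<close>

definition right_ideal :: "'a set \<Rightarrow> ('a \<Rightarrow> 'a \<Rightarrow> 'a) \<Rightarrow> 'a \<Rightarrow> 'a set" where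
  "right_ideal S m a = insert a {m a s | s. s \<in> S}"

definition left_ideal :: "'a set \<Rightarrow> ('a \<Rightarrow> 'a \<Rightarrow> 'a) \<Rightarrow> 'a \<Rightarrow> 'a set" where
  "left_ideal S m a = insert a {m s a | s. s \<in> S}"

definition H_class :: "'a set \<Rightarrow> ('a \<Rightarrow> 'a \<Rightarrow> 'a) \<Rightarrow> 'a \<Rightarrow> 'a set" where
  "H_class S m a = {b \<in> S. right_ideal S m b = right_ideal S m a \<and>
                           left_ideal S m b = left_ideal S m a}"

definition regular_in :: "'a set \<Rightarrow> ('a \<Rightarrow> 'a \<Rightarrow> 'a) \<Rightarrow> 'a \<Rightarrow> bool" where
  "regular_in S m a \<longleftrightarrow> (\<exists>a'\<in>S. m (m a a') a = a)"


section \<open>Presentations\<close>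

text \<open>The congruence on the free monoid generated by a set of pairs of words.\<close>

inductive presentation_eq :: "('a list \<times> 'a list) set \<Rightarrow> 'a list \<Rightarrow> 'a list \<Rightarrow> bool"
  for R :: "('a list \<times> 'a list) set" where
  rel: "(u, v) \<in> R \<Longrightarrow> presentation_eq R (p @ u @ q) (p @ v @ q)"
| refl: "presentation_eq R u u"
| sym: "presentation_eq R u v \<Longrightarrow> presentation_eq R v u"
| trans: "presentation_eq R u v \<Longrightarrow> presentation_eq R v w \<Longrightarrow> presentation_eq R u w"

definition word_cong :: "'a list set \<Rightarrow> ('a list \<times> 'a list) set \<Rightarrow> ('a list \<times> 'a list) set" where
  "word_cong W R = {(u, v). u \<in> W \<and> v \<in> W \<and> presentation_eq R u v}"

definition class_mult :: "('a list \<times> 'a list) set \<Rightarrow> 'a list set \<Rightarrow> 'a list set \<Rightarrow> 'a list set" where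
  "class_mult r A B = r `` {u @ v | u v. u \<in> A \<and> v \<in> B}"


section \<open>The free idempotent generated semigroup over a biordered set\<close>

definition IG_cong :: "'a set \<Rightarrow> ('a \<Rightarrow> 'a \<Rightarrow> 'a option) \<Rightarrow> ('a list \<times> 'a list) set" where
  "IG_cong E p = word_cong (lists E - {[]}) {([e, f], [g]) | e f g. p e f = Some g}"

definition IG_carrier :: "'a set \<Rightarrow> ('a \<Rightarrow> 'a \<Rightarrow> 'a option) \<Rightarrow> 'a list set set" where
  "IG_carrier E p = (lists E - {[]}) // IG_cong E p"

abbreviation IG_mult ::
  "'a set \<Rightarrow> ('a \<Rightarrow> 'a \<Rightarrow> 'a option) \<Rightarrow> 'a list set \<Rightarrow> 'a list set \<Rightarrow> 'a list set" where
  "IG_mult E p \<equiv> class_mult (IG_cong E p)"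

definition IG_class :: "'a set \<Rightarrow> ('a \<Rightarrow> 'a \<Rightarrow> 'a option) \<Rightarrow> 'a list \<Rightarrow> 'a list set" where
  "IG_class E p u = IG_cong E p `` {u}"

definition IG_max_subgroup :: "'a set \<Rightarrow> ('a \<Rightarrow> 'a \<Rightarrow> 'a option) \<Rightarrow> 'a \<Rightarrow> 'a list set monoid" where
  "IG_max_subgroup E p e =
     \<lparr>carrier = H_class (IG_carrier E p) (IG_mult E p) (IG_class E p [e]),
      mult = IG_mult E p,
      one = IG_class E p [e]\<rparr>"

text \<open>The empty word represents no element of the semigroup, hence no regular element.\<close>

definition represents_regular ::
  "'a set \<Rightarrow> ('a \<Rightarrow> 'a \<Rightarrow> 'a option) \<Rightarrow> 'a list \<Rightarrow> bool" where
  "represents_regular E p u \<longleftrightarrow>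
     u \<noteq> [] \<and> regular_in (IG_carrier E p) (IG_mult E p) (IG_class E p u)"


section \<open>Finite group presentations\<close>

text \<open>
  A pair (k, rs) stands for the group with generators 0, ..., k - 1 and relators rs; the letter
  (i, True) is the i-th generator and (i, False) its formal inverse.
\<close>

type_synonym group_word = "(nat \<times> bool) list"
type_synonym group_presentation = "nat \<times> group_word list"

definition group_words :: "nat \<Rightarrow> group_word set" where
  "group_words k = lists ({..<k} \<times> UNIV)"

definition valid_presentation :: "group_presentation \<Rightarrow> bool" where
  "valid_presentation P \<longleftrightarrow> set (snd P) \<subseteq> group_words (fst P)"

definition group_cong :: "group_presentation \<Rightarrow> (group_word \<times> group_word) set" where
  "group_cong P = word_cong (group_words (fst P))
     ({([(i, b), (i, \<not> b)], []) | i b. i < fst P} \<union> {(r, []) | r. r \<in> set (snd P)})"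

definition presented_group :: "group_presentation \<Rightarrow> group_word set monoid" where
  "presented_group P =
     \<lparr>carrier = group_words (fst P) // group_cong P,
      mult = class_mult (group_cong P),
      one = group_cong P `` {[]}\<rparr>"


section \<open>Algorithms\<close>

text \<open>
  Algorithms are programs for partial recursive functions: rec_eval f xs y says that f halts on the
  arguments xs with value y. Recursion (on the first argument) and unbounded search are as in
  Kleene's schemes; the number of arguments of a program is left implicit.
\<close>

datatype recf =
    Zero
  | Succ
  | Proj nat
  | Comp recf "recf list"
  | Prec recf recf
  | Mu recf

inductive rec_eval :: "recf \<Rightarrow> nat list \<Rightarrow> nat \<Rightarrow> bool" where
  zero: "rec_eval Zero xs 0"
| succ: "rec_eval Succ (x # xs) (Suc x)"
| proj: "i < length xs \<Longrightarrow> rec_eval (Proj i) xs (xs ! i)"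
| comp: "list_all2 (\<lambda>g y. rec_eval g xs y) gs ys \<Longrightarrow> rec_eval f ys z \<Longrightarrow> rec_eval (Comp f gs) xs z"
| prec_0: "rec_eval g xs y \<Longrightarrow> rec_eval (Prec g h) (0 # xs) y"
| prec_Suc: "rec_eval (Prec g h) (n # xs) y \<Longrightarrow> rec_eval h (n # y # xs) z \<Longrightarrow>
             rec_eval (Prec g h) (Suc n # xs) z"
| mu: "rec_eval f (n # xs) 0 \<Longrightarrow> (\<forall>k<n. \<exists>y>0. rec_eval f (k # xs) y) \<Longrightarrow> rec_eval (Mu f) xs n"

lemma rec_eval_deterministic: "rec_eval f xs y \<Longrightarrow> rec_eval f xs z \<Longrightarrow> y = z"
proof (induction arbitrary: z rule: rec_eval.induct)
  case (comp xs gs ys f w)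
  from comp.prems obtain ys' where
    ys': "list_all2 (\<lambda>g y. rec_eval g xs y) gs ys'" "rec_eval f ys' z"
    by cases auto
  have "ys = ys'"
    using comp.IH(1) ys'(1) by (auto simp: list_all2_conv_all_nth intro!: nth_equalityI)
  then show ?case using comp.IH(2) ys'(2) by blast
next
  case (prec_Suc g h n xs y w)
  from prec_Suc.prems show ?case by cases (use prec_Suc.IH in blast)
next
  case (mu f n xs)
  from mu.prems obtain
    z: "rec_eval f (z # xs) 0" "\<forall>k<z. \<exists>y>0. rec_eval f (k # xs) y" by cases auto
  have "\<not> n < z" using z(2) mu.IH(1) by fastforce
  moreover have "\<not> z < n" using z(1) mu.IH(2) by fastforce
  ultimately show ?case by simp
next
  case (zero xs)
  then show ?case by cases simp
next
  case (succ x xs)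
  then show ?case by cases auto
next
  case (proj i xs)
  from proj.prems show ?case by cases auto
next
  case (prec_0 g xs y h)
  from prec_0.prems show ?case by cases (use prec_0.IH in blast)
qed

text \<open>
  The partial multiplication table on {0, ..., n - 1} is coded as the list of its n rows, with 0
  for an undefined product and k + 1 for the product k.
\<close>

definition table_code :: "nat \<Rightarrow> (nat \<Rightarrow> nat \<Rightarrow> nat option) \<Rightarrow> nat" where
  "table_code n p = list_encode (map (\<lambda>i. list_encode (map (\<lambda>j.
     case p i j of None \<Rightarrow> 0 | Some k \<Rightarrow> Suc k) [0..<n])) [0..<n])"

definition group_word_code :: "group_word \<Rightarrow> nat" where
  "group_word_code w = list_encode (map (\<lambda>(i, b). 2 * i + of_bool b) w)"

definition presentation_code :: "group_presentation \<Rightarrow> nat" where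
  "presentation_code P = prod_encode (fst P, list_encode (map group_word_code (snd P)))"

definition solvable_word_problem :: "group_presentation \<Rightarrow> bool" where
  "solvable_word_problem P \<longleftrightarrow>
     (\<exists>f. \<forall>w \<in> group_words (fst P).
        rec_eval f [group_word_code w] (if (w, []) \<in> group_cong P then 1 else 0))"

end

theory Submission
  imports Defs
begin

text \<open>
  For a letter e, the partial right action of the letters on the L-classes of idempotents is
  compatible with the relations of the free idempotent generated semigroup, and each of its steps is
  invertible there. Hence the R-class of e consists of the elements e w with w acting on the L-class
  of e, and the group of e is the fundamental group of the 2-complex whose vertices are
  the L-classes reachable from that of e, whose edges are the pairs (L-class, letter), and whose
  2-cells come from the basic pairs. Everything here is finite and computable from the table; setting
  the edge paths to one chosen representative of each vertex equal to 1 gives a finite presentation.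

  A seed of a word is an occurrence of a letter on whose L-class the rest of the word acts from the
  right and on whose R-class the beginning of the word acts from the left. Having a seed is invariant under
  the relations, and so is the least number of factors with a seed into which the word can be cut.
  The second invariant, applied to the words (w v)^k w, shows that regular words have seeds,
  because E is finite. So regularity is decided by finite automata, and two regular elements
  with the same R-class and L-class are compared by the word problem of a maximal subgroup.
\<close>

section \<open>The action of idempotents on L-classes\<close>

text \<open>An equation w v w = w says nothing about the letters of w, so a seed in w has to be
  forced indirectly. Since all the words (w v)^k w represent one element, they split into at most as
  many blocks as w has letters; for large k some block exceeds two periods, and its seed acts along
  a whole period on at least one side. Running once round that period maps the finitely many
  L-classes below the seed injectively into themselves, hence onto, so the loop cannot descend and
  closes at the seed. A closed loop can be repeated and run backwards, which supplies the action on
  the other side. The block number survives the contraction of a basic pair because the product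
  keeps the R-class of the left factor or the L-class of the right one; this lets seeds be passed
  on, also across a cut between the two factors. The comparison program is assembled separately for
  each table, since solvability of the word problems supplies only the existence of one program per
  letter.\<close>

lemma presentation_eq_append:
  "presentation_eq R u v \<Longrightarrow> presentation_eq R (a @ u @ b) (a @ v @ b)"
proof (induction rule: presentation_eq.induct)
  case (rel u v p q)
  then show ?case using presentation_eq.rel[of u v R "a @ p" "q @ b"] by simp
qed (auto intro: presentation_eq.intros)

lemma presentation_eq_appendL: "presentation_eq R u v \<Longrightarrow> presentation_eq R (a @ u) (a @ v)"
  using presentation_eq_append[of R u v a "[]"] by simp

lemma presentation_eq_appendR: "presentation_eq R u v \<Longrightarrow> presentation_eq R (u @ b) (v @ b)"
  using presentation_eq_append[of R u v "[]" b] by simp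

lemma presentation_eq_append2:
  "presentation_eq R u v \<Longrightarrow> presentation_eq R u' v' \<Longrightarrow> presentation_eq R (u @ u') (v @ v')"
  by (meson presentation_eq.trans presentation_eq_appendL presentation_eq_appendR)

lemma presentation_eq_base: "(u, v) \<in> R \<Longrightarrow> presentation_eq R u v"
  using presentation_eq.rel[of u v R "[]" "[]"] by simp

declare presentation_eq.trans[trans]

type_synonym 'a pop = "'a \<Rightarrow> 'a \<Rightarrow> 'a option"

definition opp :: "'a pop \<Rightarrow> 'a pop" where "opp p = (\<lambda>x y. p y x)"

lemma opp_opp [simp]: "opp (opp p) = p" by (simp add: opp_def)

text \<open>Green's relation L between idempotents, read off the partial table; over
  \<open>opp p\<close> it is Green's relation R.\<close>

definition Lr :: "'a pop \<Rightarrow> 'a \<Rightarrow> 'a \<Rightarrow> bool" where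
  "Lr p e f \<longleftrightarrow> p e f = Some e \<and> p f e = Some f"

text \<open>The letter \<^term>\<open>f\<close> acts on the L-class of \<^term>\<open>e\<close> from the right if this class contains some \<^term>\<open>k\<close>
  with f k = k, and then leads to the L-class of k f. Over \<^term>\<open>opp p\<close> this is the
  left action on R-classes.\<close>

definition stp :: "'a pop \<Rightarrow> 'a \<Rightarrow> 'a \<Rightarrow> 'a \<Rightarrow> bool" where
  "stp p e f g \<longleftrightarrow> (\<exists>k. Lr p e k \<and> p f k = Some k \<and> p k f = Some g)"

fun reach :: "'a pop \<Rightarrow> 'a \<Rightarrow> 'a list \<Rightarrow> 'a \<Rightarrow> bool" where
  "reach p e [] g \<longleftrightarrow> Lr p e g"
| "reach p e (f # w) g \<longleftrightarrow> (\<exists>h. stp p e f h \<and> reach p h w g)"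

definition live :: "'a pop \<Rightarrow> 'a \<Rightarrow> 'a list \<Rightarrow> bool" where
  "live p e w \<longleftrightarrow> (\<exists>g. reach p e w g)"

definition IG_rels :: "'a pop \<Rightarrow> ('a list \<times> 'a list) set" where
  "IG_rels p = {([e, f], [g]) | e f g. p e f = Some g}"

locale biord =
  fixes S :: "'a set" and m :: "'a \<Rightarrow> 'a \<Rightarrow> 'a" (infixl "\<cdot>" 70) and p :: "'a pop"
  assumes sg: "semigroup_on S m" and p_def: "p = biorder_op S m"
begin

abbreviation "E \<equiv> idempotents S m"

lemma clos [simp, intro]: "x \<in> S \<Longrightarrow> y \<in> S \<Longrightarrow> x \<cdot> y \<in> S"
  and assoc: "x \<in> S \<Longrightarrow> y \<in> S \<Longrightarrow> z \<in> S \<Longrightarrow> x \<cdot> y \<cdot> z = x \<cdot> (y \<cdot> z)"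
  using sg by (auto simp: semigroup_on_def)

lemma E_I: "e \<in> S \<Longrightarrow> e \<cdot> e = e \<Longrightarrow> e \<in> E"
  by (auto simp: idempotents_def)

lemma ES [simp]: "e \<in> E \<Longrightarrow> e \<in> S" and idem [simp]: "e \<in> E \<Longrightarrow> e \<cdot> e = e"
  by (auto simp: idempotents_def)

text \<open>Products are normalized to right-nested form by \<open>assoc\<close>, where a rule for
  \<open>x \<cdot> y\<close> matches only at the right end. This variant makes the rule apply inside
  a longer product.\<close>

lemma mult_eq_extend: "x \<cdot> y = z \<Longrightarrow> x \<in> S \<Longrightarrow> y \<in> S \<Longrightarrow> t \<in> S \<Longrightarrow> x \<cdot> (y \<cdot> t) = z \<cdot> t"
  using assoc[of x y t] by simp

lemma idem2 [simp]: "e \<in> E \<Longrightarrow> t \<in> S \<Longrightarrow> e \<cdot> (e \<cdot> t) = e \<cdot> t"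
  by (simp add: mult_eq_extend[OF idem])

lemma p_iff: "p e f = Some g \<longleftrightarrow> e \<in> E \<and> f \<in> E \<and> g = e \<cdot> f \<and>
   (e \<cdot> f = e \<or> e \<cdot> f = f \<or> f \<cdot> e = e \<or> f \<cdot> e = f)"
  unfolding p_def biorder_op_def basic_pair_def by auto

text \<open>Interpreting the locale once more through this fact turns every result on the right
  action on L-classes into one on the left action on R-classes.\<close>

lemma dual: "biord S (\<lambda>x y. y \<cdot> x) (opp p)"
proof
  show "semigroup_on S (\<lambda>x y. y \<cdot> x)" using sg by (auto simp: semigroup_on_def)
  have 1: "idempotents S (\<lambda>x y. y \<cdot> x) = E" unfolding idempotents_def ..
  have "basic_pair (\<lambda>x y. y \<cdot> x) e f = basic_pair m f e" for e f
    by (simp add: basic_pair_def insert_commute[of "e \<cdot> f"] insert_commute[of e])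
  then have "opp p e f = biorder_op S (\<lambda>x y. y \<cdot> x) e f" for e f
    using 1 by (auto simp: p_def opp_def biorder_op_def)
  then show "opp p = biorder_op S (\<lambda>x y. y \<cdot> x)" by blast
qed

lemma Lr_iff: "Lr p e f \<longleftrightarrow> e \<in> E \<and> f \<in> E \<and> e \<cdot> f = e \<and> f \<cdot> e = f"
  unfolding Lr_def p_iff by metis

lemma Rr_iff: "Lr (opp p) e f \<longleftrightarrow> e \<in> E \<and> f \<in> E \<and> e \<cdot> f = f \<and> f \<cdot> e = e"
  unfolding Lr_def opp_def p_iff by metis

lemma stp_iff: "stp p e f g \<longleftrightarrow> e \<in> E \<and> f \<in> E \<and>
   (\<exists>k\<in>E. e \<cdot> k = e \<and> k \<cdot> e = k \<and> f \<cdot> k = k \<and> g = k \<cdot> f)"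
proof -
  have "Lr p e k \<and> p f k = Some k \<and> p k f = Some g \<longleftrightarrow> e \<in> E \<and> f \<in> E \<and>
      k \<in> E \<and> e \<cdot> k = e \<and> k \<cdot> e = k \<and> f \<cdot> k = k \<and> g = k \<cdot> f" for k
    unfolding Lr_iff p_iff by metis
  then show ?thesis unfolding stp_def by blast
qed

lemma stpI: "e \<in> E \<Longrightarrow> f \<in> E \<Longrightarrow> k \<in> S \<Longrightarrow> e \<cdot> k = e \<Longrightarrow> k \<cdot> e = k \<Longrightarrow> f \<cdot> k = k \<Longrightarrow> stp p e f (k \<cdot> f)"
  unfolding stp_iff using E_I[of k] mult_eq_extend[of k e k k] by (intro conjI bexI[of _ k]) auto

lemma stpE:
  assumes "stp p e f g"
  obtains k where "e \<in> E" "f \<in> E" "k \<in> E" "e \<cdot> k = e" "k \<cdot> e = k" "f \<cdot> k = k" "g = k \<cdot> f" "g \<in> E"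
proof -
  from assms obtain k where k: "e \<in> E" "f \<in> E" "k \<in> E" "e \<cdot> k = e" "k \<cdot> e = k" "f \<cdot> k = k" "g = k \<cdot> f"
    unfolding stp_iff by blast
  have "g \<in> E" by (rule E_I) (use k in \<open>simp_all add: assoc mult_eq_extend[OF k(6)]\<close>)
  with k that show ?thesis by blast
qed

lemma stp_E: "stp p e f g \<Longrightarrow> g \<in> E" by (rule stpE)

lemma Lr_refl: "e \<in> E \<Longrightarrow> Lr p e e" by (simp add: Lr_iff)
lemma Lr_sym: "Lr p e f \<Longrightarrow> Lr p f e" by (simp add: Lr_iff)
lemma Lr_trans: "Lr p e f \<Longrightarrow> Lr p f g \<Longrightarrow> Lr p e g"
  unfolding Lr_iff using assoc[of e f g] assoc[of g f e] by auto

lemma stp_L: "Lr p e e' \<Longrightarrow> stp p e f g \<Longrightarrow> stp p e' f g"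
  unfolding stp_def using Lr_trans Lr_sym by blast

lemma stp_det:
  assumes "stp p e f g" "stp p e f g'" shows "Lr p g g'"
proof -
  obtain k where k: "e \<in> E" "f \<in> E" "k \<in> E" "e \<cdot> k = e" "k \<cdot> e = k" "f \<cdot> k = k" "g = k \<cdot> f" "g \<in> E"
    using stpE[OF assms(1)] by blast
  obtain l where l: "l \<in> E" "e \<cdot> l = e" "l \<cdot> e = l" "f \<cdot> l = l" "g' = l \<cdot> f" "g' \<in> E"
    using stpE[OF assms(2)] by blast
  have "k \<cdot> l = k" using k l assoc[of k e l] by simp
  moreover have "l \<cdot> k = l" using k l assoc[of l e k] by simp
  ultimately show ?thesis unfolding Lr_iff using k l
    by (simp add: assoc mult_eq_extend[OF k(6)] mult_eq_extend[OF l(4)] mult_eq_extend[of k l k] mult_eq_extend[of l k l])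
qed

section \<open>Basic pairs and two successive steps of the action\<close>

lemma mult3_eq_extend: "x \<cdot> (y \<cdot> z) = v \<Longrightarrow> x \<in> S \<Longrightarrow> y \<in> S \<Longrightarrow> z \<in> S \<Longrightarrow> t \<in> S \<Longrightarrow> x \<cdot> (y \<cdot> (z \<cdot> t)) = v \<cdot> t"
  using assoc[of x "y \<cdot> z" t] assoc[of y z t] by simp

lemma pE:
  assumes "p f g = Some c"
  obtains "f \<in> E" "g \<in> E" "c = f \<cdot> g" "f \<cdot> g = f" | "f \<in> E" "g \<in> E" "c = f \<cdot> g" "f \<cdot> g = g"
    | "f \<in> E" "g \<in> E" "c = f \<cdot> g" "g \<cdot> f = f" | "f \<in> E" "g \<in> E" "c = f \<cdot> g" "g \<cdot> f = g"
  using assms unfolding p_iff by blast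

lemma p_E: "p f g = Some c \<Longrightarrow> c \<in> E"
  by (erule pE; rule E_I; simp add: assoc; metis ES assoc clos idem idem2)

text \<open>In each of the four kinds of basic pair the L-class of \<open>e\<close> has to contain
  an idempotent fixed by \<open>c\<close> on the left. The witness \<open>k\<close> of the first
  step serves if \<open>f \<cdot> g = f\<close> or \<open>g \<cdot> f = f\<close>; in the other two
  cases the witness \<open>l\<close> of the second step is brought into that class.\<close>

lemma stp_pair1:
  assumes fg: "p f g = Some c" and s1: "stp p e f h" and s2: "stp p h g x"
  shows "\<exists>y. stp p e c y \<and> Lr p x y"
proof -
  obtain k where k: "e \<in> E" "f \<in> E" "k \<in> E" "e \<cdot> k = e" "k \<cdot> e = k" "f \<cdot> k = k" "h = k \<cdot> f" "h \<in> E"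
    using stpE[OF s1] by blast
  obtain l where l: "g \<in> E" "l \<in> E" "h \<cdot> l = h" "l \<cdot> h = l" "g \<cdot> l = l" "x = l \<cdot> g" "x \<in> E"
    using stpE[OF s2] by blast
  have c: "c \<in> E" using fg by (rule p_E)
  have S: "e \<in> S" "f \<in> S" "k \<in> S" "g \<in> S" "l \<in> S" using k l by auto
  have kfl: "k \<cdot> (f \<cdot> l) = k \<cdot> f" and lkf: "l \<cdot> (k \<cdot> f) = l" using k l by (simp_all add: assoc)
  note R = k(4) mult_eq_extend[OF k(4)] k(5) mult_eq_extend[OF k(5)] k(6) mult_eq_extend[OF k(6)] l(5) mult_eq_extend[OF l(5)] kfl mult3_eq_extend[OF kfl] lkf mult3_eq_extend[OF lkf]
  from fg show ?thesis
  proof (cases rule: pE)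
    case 1
    note R' = R 1(4) mult_eq_extend[OF 1(4)]
    have "l \<cdot> g = l" using mult3_eq_extend[OF lkf, of g] S lkf 1 by simp
    then have "x = l" using l by simp
    moreover have "stp p e c (k \<cdot> f)" using 1 k by (auto intro!: stpI)
    moreover have "Lr p l (k \<cdot> f)" unfolding Lr_iff using k l by simp
    ultimately show ?thesis by blast
  next
    case 2
    note R' = R 2(4) mult_eq_extend[OF 2(4)]
    have fl: "f \<cdot> l = l" using mult_eq_extend[of f g g l] S l 2 by simp
    then have kl: "k \<cdot> l = k \<cdot> f" using kfl by simp
    have "e \<cdot> l = e \<cdot> (k \<cdot> l)" using S by (simp add: R)
    also have "\<dots> = e \<cdot> f" using S by (simp add: kl R)
    finally have "e \<cdot> (l \<cdot> k) = e" using S mult_eq_extend[of e l "e \<cdot> f" k] by (simp add: assoc R)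
    \<comment> \<open>Here \<open>c\<close> is \<open>g\<close>, which fixes \<open>l\<close>; the
      factor \<open>k\<close> moves \<open>l\<close> into the L-class of \<open>e\<close>.\<close>
    then have "stp p e c (l \<cdot> k \<cdot> c)" using S 2 k by (intro stpI) (auto simp: assoc R)
    moreover have "l \<cdot> k \<cdot> c = x"
    proof -
      have "l \<cdot> k \<cdot> c = l \<cdot> (k \<cdot> f) \<cdot> g" using S 2 by (simp add: assoc)
      then show ?thesis using l lkf by simp
    qed
    ultimately show ?thesis using Lr_refl l(7) by auto
  next
    case 3
    have gk: "g \<cdot> k = k" using mult_eq_extend[of g f f k] S k 3 by simp
    have "stp p e c (k \<cdot> c)" using S 3 k c by (intro stpI) (auto simp: assoc R gk)
    moreover have "Lr p x (k \<cdot> c)"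
      unfolding Lr_iff using S l k 3 stp_E[OF calculation]
      by (simp add: assoc R gk mult_eq_extend[OF gk])
    ultimately show ?thesis by blast
  next
    case 4
    note R' = R 4(4) mult_eq_extend[OF 4(4)]
    \<comment> \<open>The witness is \<open>f \<cdot> (l \<cdot> k)\<close>: from
      \<open>g \<cdot> f = g\<close> it follows that c f l = f g f l = f g l = f l.\<close>
    have kk: "k \<cdot> (f \<cdot> (l \<cdot> k)) = k" using S k by (simp add: assoc R')
    have "e \<cdot> (f \<cdot> (l \<cdot> k)) = e \<cdot> (k \<cdot> (f \<cdot> (l \<cdot> k)))"
      by (rule mult_eq_extend[OF k(4), symmetric]) (use S in auto)
    also have "\<dots> = e" by (simp only: kk k(4))
    finally have "stp p e c (f \<cdot> (l \<cdot> k) \<cdot> c)" using S 4 k c by (intro stpI) (auto simp: assoc R')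
    moreover have "f \<cdot> (l \<cdot> k) \<cdot> c = f \<cdot> (l \<cdot> g)" using S 4 by (simp add: assoc R')
    moreover have "Lr p x (f \<cdot> (l \<cdot> g))"
      unfolding Lr_iff using S l k 4 stp_E[OF calculation(1)] calculation(2)
      by (simp add: assoc R')
    ultimately show ?thesis by auto
  qed
qed

lemma stp_pair2:
  assumes fg: "p f g = Some c" and s: "stp p e c y"
  shows "\<exists>h x. stp p e f h \<and> stp p h g x \<and> Lr p x y"
proof -
  obtain k where k: "e \<in> E" "c \<in> E" "k \<in> E" "e \<cdot> k = e" "k \<cdot> e = k" "c \<cdot> k = k" "y = k \<cdot> c" "y \<in> E"
    using stpE[OF s] by blast
  have S: "e \<in> S" "c \<in> S" "k \<in> S" using k by auto
  \<comment> \<open>\<open>l\<close> is the witness of the second step: L-related to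
    \<open>k \<cdot> f\<close> and fixed by \<open>g\<close> on the left. It is
    \<open>k \<cdot> f\<close> itself in the two cases where \<open>g\<close> fixes
    \<open>k\<close>, and \<open>g \<cdot> (k \<cdot> f)\<close> in the other two.\<close>
  have main: ?thesis if a: "f \<in> E" "g \<in> E" "f \<cdot> k = k" "l \<in> S" "k \<cdot> (f \<cdot> l) = k \<cdot> f" "l \<cdot> (k \<cdot> f) = l" "g \<cdot> l = l"
    "l \<cdot> g \<cdot> y = l \<cdot> g" "y \<cdot> (l \<cdot> g) = y" for l
  proof -
    have 1: "stp p e f (k \<cdot> f)" using a k S by (intro stpI)
    then have "k \<cdot> f \<in> E" by (rule stpE)
    then have 2: "stp p (k \<cdot> f) g (l \<cdot> g)" using a k S by (intro stpI) (auto simp: assoc)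
    then have "l \<cdot> g \<in> E" by (rule stpE)
    then show ?thesis using 1 2 k a by (metis Lr_iff)
  qed
  note R = k(4) mult_eq_extend[OF k(4)] k(5) mult_eq_extend[OF k(5)]
  from fg show ?thesis
  proof (cases rule: pE)
    case 1
    have fk: "f \<cdot> k = k" using 1 k by simp
    show ?thesis by (rule main[of "g \<cdot> (k \<cdot> f)"])
      (use 1 S k fk in \<open>simp_all add: assoc R mult_eq_extend[OF fk] mult_eq_extend[OF 1(4)]\<close>)
  next
    case 2
    have gk: "g \<cdot> k = k" using 2 k by simp
    have fk: "f \<cdot> k = k" using mult_eq_extend[OF 2(4), of k] 2 S gk by simp
    show ?thesis by (rule main[of "k \<cdot> f"])
      (use 2 S k fk gk in \<open>simp_all add: assoc R mult_eq_extend[OF fk] mult_eq_extend[OF gk] mult_eq_extend[OF 2(4)]\<close>)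
  next
    case 3
    have fgk: "f \<cdot> (g \<cdot> k) = k" using 3 k S by (simp add: assoc)
    have fk: "f \<cdot> k = k" using idem2[of f "g \<cdot> k"] fgk 3 S by simp
    have gk: "g \<cdot> k = k" using mult_eq_extend[OF 3(4), of "g \<cdot> k"] fgk 3 S by simp
    show ?thesis by (rule main[of "k \<cdot> f"])
      (use 3 S k fk gk fgk in \<open>simp_all add: assoc R mult_eq_extend[OF fk] mult_eq_extend[OF gk] mult3_eq_extend[OF fgk]\<close>)
  next
    case 4
    have fgk: "f \<cdot> (g \<cdot> k) = k" using 4 k S by (simp add: assoc)
    have fk: "f \<cdot> k = k" using idem2[of f "g \<cdot> k"] fgk 4 S by simp
    show ?thesis by (rule main[of "g \<cdot> (k \<cdot> f)"])
      (use 4 S k fk fgk in \<open>simp_all add: assoc R mult_eq_extend[OF fk] mult3_eq_extend[OF fgk] mult_eq_extend[OF 4(4)]\<close>)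
  qed
qed

section \<open>Order and injectivity of single steps, carriers of basic pairs\<close>

lemma idem_dual: "idempotents S (\<lambda>x y. y \<cdot> x) = E"
  unfolding idempotents_def ..

lemma Le_L: "x \<in> E \<Longrightarrow> e \<in> E \<Longrightarrow> x \<cdot> e = x \<Longrightarrow> Lr p e k \<Longrightarrow> x \<cdot> k = x"
  unfolding Lr_iff using assoc[of x e k] by simp

lemma Le_trans: "x \<in> E \<Longrightarrow> y \<in> E \<Longrightarrow> z \<in> E \<Longrightarrow> x \<cdot> y = x \<Longrightarrow> y \<cdot> z = y \<Longrightarrow> x \<cdot> z = x"
  using assoc[of x y z] by simp

text \<open>\<open>x \<cdot> e = x\<close> is the order of L-classes. Since
  \<open>x \<cdot> k = x\<close>, the idempotent \<open>k \<cdot> x\<close> is L-related to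
  \<open>x\<close> and still fixed by \<open>v\<close> on the left, so a letter acts on every class
  below one on which it acts.\<close>

lemma stp_mono:
  assumes x: "x \<in> E" "x \<cdot> e = x" and s: "stp p e v g"
  shows "\<exists>g'. stp p x v g' \<and> g' \<cdot> g = g'"
proof -
  obtain k where k: "e \<in> E" "v \<in> E" "k \<in> E" "e \<cdot> k = e" "k \<cdot> e = k" "v \<cdot> k = k" "g = k \<cdot> v" "g \<in> E"
    using stpE[OF s] by blast
  have xk: "x \<cdot> k = x" using Le_L[of x e k] x k by (simp add: Lr_iff)
  have "stp p x v (k \<cdot> x \<cdot> v)"
    using x k by (intro stpI) (simp_all add: assoc mult_eq_extend[OF xk] mult_eq_extend[OF k(6)])
  moreover have "k \<cdot> x \<cdot> v \<cdot> g = k \<cdot> x \<cdot> v"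
    using x k by (simp add: assoc mult_eq_extend[OF xk] mult_eq_extend[OF k(6)])
  ultimately show ?thesis by blast
qed

lemma stp_mono_det:
  assumes "x \<in> E" "x \<cdot> e = x" "stp p e v g" "stp p x v a"
  shows "a \<cdot> g = a"
proof -
  obtain b where b: "stp p x v b" "b \<cdot> g = b" using stp_mono[OF assms(1-3)] by blast
  have "Lr p a b" using stp_det assms(4) b(1) by blast
  then show ?thesis using Le_trans[of a b g] b(2) stp_E[OF assms(3)] by (simp add: Lr_iff)
qed

text \<open>Right multiplication by \<open>k\<close> undoes the step:
  \<open>f \<cdot> k = k\<close>, while \<open>u\<close> and \<open>v\<close> lie below
  \<open>e\<close> and are therefore fixed by \<open>k\<close> on the right. Cancelling
  \<open>f\<close> in this way turns \<open>a \<cdot> b = a\<close> into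
  \<open>u \<cdot> v = u\<close>.\<close>

lemma stp_inj_le:
  assumes x: "x \<in> E" "x \<cdot> e = x" and y: "y \<in> E" "y \<cdot> e = y"
    and s: "stp p e f g" "stp p x f a" "stp p y f b" and ab: "a \<cdot> b = a"
  shows "x \<cdot> y = x"
proof -
  obtain k where k: "e \<in> E" "f \<in> E" "k \<in> E" "e \<cdot> k = e" "k \<cdot> e = k" "f \<cdot> k = k" "g = k \<cdot> f"
    using stpE[OF s(1)] by blast
  obtain u where u: "u \<in> E" "x \<cdot> u = x" "u \<cdot> x = u" "f \<cdot> u = u" "a = u \<cdot> f"
    using stpE[OF s(2)] by blast
  obtain v where v: "v \<in> E" "y \<cdot> v = y" "v \<cdot> y = v" "f \<cdot> v = v" "b = v \<cdot> f"
    using stpE[OF s(3)] by blast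
  have S: "e \<in> S" "f \<in> S" "k \<in> S" "x \<in> S" "y \<in> S" "u \<in> S" "v \<in> S" using k u v x y by auto
  have "u \<cdot> e = u" "v \<cdot> e = v" using mult_eq_extend[of u x u e] mult_eq_extend[of v y v e] assoc[of u x e] assoc[of v y e] S x y u v by auto
  then have uk: "u \<cdot> k = u" and vk: "v \<cdot> k = v" using assoc[of u e k] assoc[of v e k] S k by auto
  have "u \<cdot> v \<cdot> f = u \<cdot> f" using ab u v S by (simp add: assoc mult_eq_extend[OF v(4)])
  then have "u \<cdot> v \<cdot> f \<cdot> k = u \<cdot> f \<cdot> k" by simp
  then have uv: "u \<cdot> v = u" using S k(6) uk vk by (simp add: assoc)
  have xv: "x \<cdot> v = x" using assoc[of x u v] S u uv by simp
  then show ?thesis using assoc[of x v y] S v by simp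
qed

text \<open>By \<open>f \<cdot> k = k\<close> the letter \<open>k\<close> acts on the L-class of
  \<open>f\<close> and leads to its own class. \<open>stp_pair2\<close> splits this step into one by
  \<open>f\<close>, which does not move the class, and one by \<open>g\<close>.\<close>

lemma stp_carrier:
  assumes "p f g = Some k" "Lr (opp p) f k"
  shows "\<exists>x. stp p f g x \<and> Lr p x k"
proof -
  have E: "f \<in> E" "k \<in> E" "f \<cdot> k = k" "k \<cdot> f = f" using assms(2) by (auto simp: Rr_iff)
  have "stp p f k (f \<cdot> k)" using E by (intro stpI) auto
  then obtain h x where hx: "stp p f f h" "stp p h g x" "Lr p x k" using stp_pair2[OF assms(1)] E(3) by metis
  have "stp p f f (f \<cdot> f)" using E by (intro stpI) auto
  then have "Lr p h f" using hx(1) stp_det E(1) by fastforce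
  then show ?thesis using hx stp_L by blast
qed

text \<open>Determines which factor exchanges roles with the product as a seed when the pair is
  contracted or expanded. This factor is called the carrier.\<close>

lemma carrier_cases:
  assumes "p f g = Some k"
  shows "Lr (opp p) f k \<or> Lr p g k"
  using assms
proof (cases rule: pE)
  case 1 then show ?thesis by (intro disjI1) (simp add: Rr_iff)
next
  case 2 then show ?thesis by (intro disjI2) (simp add: Lr_iff)
next
  case 3 then show ?thesis using p_E[OF assms] by (intro disjI1) (simp add: Rr_iff assoc)
next
  case 4 then show ?thesis using p_E[OF assms] mult_eq_extend[OF 4(4), of g] by (intro disjI2) (simp add: Lr_iff assoc)
qed

lemma stp_R:
  assumes "Lr (opp p) f k" "stp p h f x"
  shows "\<exists>y. stp p h k y"
proof -
  obtain l where l: "h \<in> E" "f \<in> E" "l \<in> E" "h \<cdot> l = h" "l \<cdot> h = l" "f \<cdot> l = l"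
    using stpE[OF assms(2)] by metis
  have "k \<in> E" "k \<cdot> f = f" using assms(1) by (auto simp: Rr_iff)
  then have "k \<cdot> l = l" using mult_eq_extend[of k f f l] l by simp
  then show ?thesis using l \<open>k \<in> E\<close> stpI[of h k l] by auto
qed

section \<open>The action of words: invariance, injectivity, reversal\<close>

lemma stp_le: "stp p e f g \<Longrightarrow> g \<cdot> f = g"
  by (erule stpE) (simp add: assoc)

lemma reach_E: "reach p e w g \<Longrightarrow> e \<in> E \<and> g \<in> E \<and> set w \<subseteq> E"
proof (induction w arbitrary: e)
  case Nil then show ?case by (simp add: Lr_iff)
next
  case (Cons f w) then show ?case by (auto elim: stpE)
qed

lemma reach_L1: "Lr p e e' \<Longrightarrow> reach p e w g \<Longrightarrow> reach p e' w g"
  by (cases w) (auto intro: Lr_trans Lr_sym stp_L)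

lemma reach_L2: "Lr p g g' \<Longrightarrow> reach p e w g \<Longrightarrow> reach p e w g'"
  by (induction w arbitrary: e) (auto intro: Lr_trans)

lemma reach_det: "reach p e w g \<Longrightarrow> reach p e w g' \<Longrightarrow> Lr p g g'"
proof (induction w arbitrary: e)
  case Nil then show ?case by (auto intro: Lr_trans Lr_sym)
next
  case (Cons f w)
  then obtain h h' where "stp p e f h" "reach p h w g" "stp p e f h'" "reach p h' w g'" by auto
  then show ?case using Cons.IH stp_det reach_L1 by blast
qed

lemma reach_append: "reach p e (u @ v) g \<longleftrightarrow> (\<exists>h. reach p e u h \<and> reach p h v g)"
proof (induction u arbitrary: e)
  case Nil
  then show ?case using reach_L1 Lr_sym Lr_refl reach_E by (metis append_Nil reach.simps(1))
qed auto

lemma reach_pair: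
  assumes "p f g = Some c" shows "reach p e [f, g] h \<longleftrightarrow> reach p e [c] h"
proof
  assume "reach p e [f, g] h"
  then obtain a x where "stp p e f a" "stp p a g x" "Lr p x h" by auto
  then obtain y where "stp p e c y" "Lr p x y" using stp_pair1[OF assms] by blast
  moreover have "Lr p y h" using Lr_trans[OF Lr_sym[OF \<open>Lr p x y\<close>] \<open>Lr p x h\<close>] .
  ultimately show "reach p e [c] h" by auto
next
  assume "reach p e [c] h"
  then obtain y where "stp p e c y" "Lr p y h" by auto
  then obtain a x where "stp p e f a" "stp p a g x" "Lr p x y" using stp_pair2[OF assms] by blast
  moreover have "Lr p x h" using Lr_trans[OF \<open>Lr p x y\<close> \<open>Lr p y h\<close>] .
  ultimately show "reach p e [f, g] h" by auto
qed

lemma reach_rel: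
  "presentation_eq (IG_rels p) u v \<Longrightarrow> reach p e u g \<longleftrightarrow> reach p e v g"
proof (induction arbitrary: e g rule: presentation_eq.induct)
  case (rel u v a b)
  then obtain f h c where "u = [f, h]" "v = [c]" "p f h = Some c" unfolding IG_rels_def by blast
  then have "reach p x u y \<longleftrightarrow> reach p x v y" for x y using reach_pair by blast
  then show ?case by (simp only: reach_append)
qed auto

lemma reach_mono:
  "x \<in> E \<Longrightarrow> x \<cdot> e = x \<Longrightarrow> reach p e w g \<Longrightarrow> \<exists>g'. reach p x w g' \<and> g' \<cdot> g = g'"
proof (induction w arbitrary: x e)
  case Nil
  then show ?case using Lr_refl[of x] Le_L[of x e g] by (intro exI[of _ x]) (simp add: Lr_iff)
next
  case (Cons f w)
  then obtain h where h: "stp p e f h" "reach p h w g" by auto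
  obtain h' where h': "stp p x f h'" "h' \<cdot> h = h'" using stp_mono[OF Cons.prems(1,2) h(1)] by blast
  obtain g' where "reach p h' w g'" "g' \<cdot> g = g'" using Cons.IH[OF stp_E[OF h'(1)] h'(2) h(2)] by blast
  then show ?case using h'(1) by (intro exI[of _ g']) auto
qed

text \<open>The common upper bound \<open>e\<close> is carried along the induction: by
  \<open>stp_mono_det\<close> the images stay below the image of \<open>e\<close>, so
  \<open>stp_inj_le\<close> applies at each letter, once in each direction.\<close>

lemma reach_inj:
  "x \<in> E \<Longrightarrow> x \<cdot> e = x \<Longrightarrow> y \<in> E \<Longrightarrow> y \<cdot> e = y \<Longrightarrow> reach p e w g \<Longrightarrow> reach p x w a \<Longrightarrow> reach p y w b \<Longrightarrow>
    Lr p a b \<Longrightarrow> Lr p x y"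
proof (induction w arbitrary: x y e)
  case Nil
  then show ?case by (auto intro: Lr_trans Lr_sym)
next
  case (Cons f w)
  obtain h where h: "stp p e f h" "reach p h w g" using Cons.prems by auto
  obtain hx where hx: "stp p x f hx" "reach p hx w a" using Cons.prems by auto
  obtain hy where hy: "stp p y f hy" "reach p hy w b" using Cons.prems by auto
  have "hx \<cdot> h = hx"
    using stp_mono_det[OF Cons.prems(1,2) h(1) hx(1)] .
  moreover have "hy \<cdot> h = hy"
    using stp_mono_det[OF Cons.prems(3,4) h(1) hy(1)] .
  ultimately have "Lr p hx hy"
    using Cons.IH[OF stp_E[OF hx(1)] _ stp_E[OF hy(1)] _ h(2) hx(2) hy(2) Cons.prems(8)] by blast
  then show ?case unfolding Lr_iff
    using Cons.prems stp_inj_le[OF _ _ _ _ h(1) hx(1) hy(1)] stp_inj_le[OF _ _ _ _ h(1) hy(1) hx(1)] by blast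
qed

text \<open>A path of L-classes becomes a path of R-classes running backwards. If the reversed rest
  ends at \<open>j\<close>, the letter \<open>f\<close> leads on to the R-class of
  \<open>f \<cdot> j\<close>, and right multiplication by \<open>k\<close> brings
  \<open>f \<cdot> j\<close> into the L-class of \<open>e\<close> without leaving its
  R-class.\<close>

lemma reach_turn:
  "reach p e w g \<Longrightarrow> \<exists>j. Lr p j e \<and> reach (opp p) g (rev w) j"
proof (induction w arbitrary: e)
  case Nil
  then show ?case using Lr_sym by (auto simp: Lr_iff Rr_iff)
next
  case (Cons f w)
  interpret d: biord S "\<lambda>x y. y \<cdot> x" "opp p" by (rule dual)
  obtain h where h: "stp p e f h" "reach p h w g" using Cons.prems by auto
  obtain k where k: "e \<in> E" "f \<in> E" "k \<in> E" "e \<cdot> k = e" "k \<cdot> e = k" "f \<cdot> k = k" "h = k \<cdot> f" "h \<in> E"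
    using stpE[OF h(1)] by blast
  obtain j where j: "Lr p j h" "reach (opp p) g (rev w) j" using Cons.IH[OF h(2)] by blast
  have jE: "j \<in> E" and jh: "j \<cdot> (k \<cdot> f) = j" "k \<cdot> (f \<cdot> j) = k \<cdot> f" using j(1) k by (auto simp: Lr_iff assoc)
  have S: "f \<in> S" "k \<in> S" "j \<in> S" "e \<in> S" using jE k by auto
  note R = mult3_eq_extend[OF jh(1)] mult3_eq_extend[OF jh(2)] jh mult_eq_extend[OF k(6)] k(6)
  have jf: "j \<cdot> f = j" using mult3_eq_extend[OF jh(1), of f] S k jh by simp
  have "stp (opp p) j f (f \<cdot> j)"
    using d.stpI[of j f j, unfolded idem_dual] jE k jf by simp
  moreover have "Lr (opp p) (f \<cdot> j) (f \<cdot> (j \<cdot> k))"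
  proof -
    have "f \<cdot> j \<in> E" by (rule E_I) (use S k jE in \<open>simp_all add: assoc mult_eq_extend[OF jf]\<close>)
    moreover have "f \<cdot> (j \<cdot> k) \<in> E" by (rule E_I) (use S k jE in \<open>simp_all add: assoc R\<close>)
    ultimately show ?thesis unfolding Rr_iff using S k jE by (simp add: assoc mult_eq_extend[OF jf] R)
  qed
  moreover have "Lr p (f \<cdot> (j \<cdot> k)) e"
  proof -
    have "f \<cdot> (j \<cdot> k) \<in> E" by (rule E_I) (use S k jE in \<open>simp_all add: assoc R\<close>)
    moreover have "e \<cdot> (f \<cdot> (j \<cdot> k)) = e"
    proof -
      have kk: "k \<cdot> (f \<cdot> (j \<cdot> k)) = k" using S k by (simp add: assoc R)
      have "e \<cdot> (f \<cdot> (j \<cdot> k)) = e \<cdot> (k \<cdot> (f \<cdot> (j \<cdot> k)))"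
        by (rule mult_eq_extend[OF k(4), symmetric]) (use S in auto)
      also have "\<dots> = e" by (simp only: kk k(4))
      finally show ?thesis .
    qed
    ultimately show ?thesis unfolding Lr_iff using S k by (simp add: assoc)
  qed
  ultimately show ?case using j(2) by (auto simp: d.reach_append)
qed

text \<open>\<open>w\<close> maps the finitely many L-classes below \<open>s\<close> injectively
  into themselves, hence onto. Every image lies below \<open>c\<close>, so \<open>s\<close> does
  too, which gives \<open>s \<cdot> c = s\<close> next to \<open>s \<cdot> c = c\<close>.\<close>

lemma reach_no_descent:
  assumes fin: "finite E" and r: "reach p s w c" and c: "c \<cdot> s = c" "s \<cdot> c = c"
  shows "c = s"
proof -
  have cs: "s \<in> E" "c \<in> E" using reach_E[OF r] by auto
  define D where "D = {x \<in> E. x \<cdot> s = x}"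
  define cls where "cls x = {y. Lr p x y}" for x
  have cls_eq: "cls x = cls y \<longleftrightarrow> Lr p x y" if "x \<in> E" for x y
    unfolding cls_def using Lr_refl[OF that] Lr_sym Lr_trans by blast
  \<comment> \<open>\<open>F\<close> picks an idempotent in the image class; \<open>G\<close> below
    is the induced map on classes, which does not depend on the choices.\<close>
  define F where "F x = (SOME g. reach p x w g)" for x
  have F: "reach p x w (F x)" "F x \<in> E" "F x \<cdot> c = F x" if xD: "x \<in> D" for x
  proof -
    obtain g where g: "reach p x w g" "g \<cdot> c = g" using reach_mono[OF _ _ r, of x] xD unfolding D_def by blast
    then show 1: "reach p x w (F x)" unfolding F_def by (metis someI)
    then show "F x \<in> E" using reach_E by blast
    show "F x \<cdot> c = F x"
      using reach_det[OF 1 g(1)] g(2) cs Le_trans[of "F x" g c] by (simp add: Lr_iff)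
  qed
  have FD: "F x \<in> D" if "x \<in> D" for x
    using F[OF that] Le_trans[of "F x" c s] cs c by (simp add: D_def)
  define G where "G A = cls (F (SOME x. x \<in> D \<and> cls x = A))" for A
  have G: "G (cls x) = cls (F x)" if "x \<in> D" for x
  proof -
    define y where "y = (SOME y. y \<in> D \<and> cls y = cls x)"
    have y: "y \<in> D" "cls y = cls x" unfolding y_def using that by (metis (mono_tags, lifting) someI)+
    then have "Lr p y x" using cls_eq D_def by auto
    then have "Lr p (F y) (F x)" using F(1)[OF y(1)] F(1)[OF that] reach_L1 reach_det by blast
    then show ?thesis unfolding G_def y_def[symmetric] using cls_eq F(2)[OF y(1)] by blast
  qed
  have "inj_on G (cls ` D)"
  proof (rule inj_onI)
    fix A B assume "A \<in> cls ` D" "B \<in> cls ` D" and GG: "G A = G B"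
    then obtain x y where xy: "x \<in> D" "A = cls x" "y \<in> D" "B = cls y" by blast
    then have "Lr p (F x) (F y)" using GG G cls_eq F(2) by metis
    then have "Lr p x y" using reach_inj[OF _ _ _ _ r F(1)[OF xy(1)] F(1)[OF xy(3)]] xy by (auto simp: D_def)
    then show "A = B" using xy cls_eq by (auto simp: D_def)
  qed
  moreover have "G ` cls ` D \<subseteq> cls ` D" using G FD by auto
  moreover have "finite (cls ` D)" using fin by (simp add: D_def)
  ultimately have GD: "G ` cls ` D = cls ` D" by (simp add: endo_inj_surj)
  have "s \<in> D" using cs by (simp add: D_def)
  then have "cls s \<in> G ` cls ` D" unfolding GD by blast
  then obtain x where x: "x \<in> D" "cls s = G (cls x)" by blast
  then have "cls s = cls (F x)" using G by simp
  then have "Lr p s (F x)" using cls_eq cs by blast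
  then have "s \<cdot> c = s" using F(2,3)[OF x(1)] cs Le_trans[of s "F x" c] by (simp add: Lr_iff)
  then show ?thesis using c by simp
qed

end

section \<open>Seeds and regular words\<close>

lemma append_eq_append_Cons_cases:
  assumes "a @ x @ b = u @ s # v"
  obtains a2 where "a = u @ s # a2" "v = a2 @ x @ b"
  | x1 x2 where "x = x1 @ s # x2" "u = a @ x1" "v = x2 @ b"
  | b1 where "b = b1 @ s # v" "u = a @ x @ b1"
proof -
  from assms consider (1) c where "a = u @ c" "c @ x @ b = s # v" | (2) c where "a @ c = u" "x @ b = c @ s # v"
    by (auto simp: append_eq_append_conv2)
  then show ?thesis
  proof cases
    case (1 c)
    show ?thesis
    proof (cases c)
      case Nil
      show ?thesis
      proof (cases x)
        case (Cons y ys) then show ?thesis using 1 Nil that(2)[of "[]" ys] by auto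
      qed (use 1 Nil that(3)[of "[]"] in auto)
    next
      case (Cons y c') then show ?thesis using 1 that(1)[of c'] by auto
    qed
  next
    case (2 c)
    from 2(2) consider (3) d where "x = c @ d" "d @ b = s # v" | (4) d where "x @ d = c" "b = d @ s # v"
      by (auto simp: append_eq_append_conv2)
    then show ?thesis
    proof cases
      case (3 d)
      then show ?thesis
      proof (cases d)
        case Nil then show ?thesis using 2 3 that(3)[of "[]"] by auto
      next
        case (Cons y d') then show ?thesis using 2 3 that(2)[of c d'] by auto
      qed
    next
      case (4 d) then show ?thesis using 2 that(3)[of d] by auto
    qed
  qed
qed

lemma concat_eq_append_Cons:
  "concat ws = a @ k # b \<Longrightarrow>
    \<exists>xs a' b' ys. ws = xs @ (a' @ k # b') # ys \<and> a = concat xs @ a' \<and> b = b' @ concat ys"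
proof (induction ws arbitrary: a)
  case (Cons w ws)
  then have "[] @ w @ concat ws = a @ k # b" by simp
  then show ?case
  proof (cases rule: append_eq_append_Cons_cases)
    case (2 x1 x2)
    then show ?thesis by (intro exI[of _ "[]"] exI[of _ x1] exI[of _ x2] exI[of _ ws]) simp
  next
    case (3 b1)
    obtain xs a' b' ys where "ws = xs @ (a' @ k # b') # ys" "b1 = concat xs @ a'" "b = b' @ concat ys"
      using Cons.IH[OF 3(1)] by blast
    then show ?thesis using 3 by (intro exI[of _ "w # xs"] exI[of _ a'] exI[of _ b'] exI[of _ ys]) simp
  qed simp
qed simp

definition seeded :: "'a pop \<Rightarrow> 'a list \<Rightarrow> bool" where
  "seeded p w \<longleftrightarrow> (\<exists>u s v. w = u @ s # v \<and> live p s v \<and> live (opp p) s (rev u))"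

lemma seeded_opp: "seeded (opp p) (rev w) \<longleftrightarrow> seeded p w"
proof -
  have 1: "seeded p w \<Longrightarrow> seeded (opp p) (rev w)" for p :: "'a pop" and w
    unfolding seeded_def by (metis opp_opp rev.simps(2) rev_append rev_rev_ident append.assoc append_Cons append_Nil)
  show ?thesis using 1[of p w] 1[of "opp p" "rev w"] by auto
qed

definition blocks :: "'a pop \<Rightarrow> nat \<Rightarrow> 'a list \<Rightarrow> bool" where
  "blocks p n w \<longleftrightarrow> (\<exists>ws. concat ws = w \<and> length ws \<le> n \<and> (\<forall>x\<in>set ws. seeded p x))"

text \<open>Such a word represents an element of the R-class of \<open>e\<close>: by
  \<open>heads_props\<close> it absorbs \<open>e\<close> on the left, and it acts on the L-class of
  \<open>e\<close>.\<close>

definition heads :: "'a pop \<Rightarrow> 'a \<Rightarrow> 'a list \<Rightarrow> bool" where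
  "heads p e w \<longleftrightarrow> (\<exists>u s v. w = u @ s # v \<and> live p s v \<and> reach (opp p) s (rev u) e)"

lemma seeded_heads: "seeded p w \<longleftrightarrow> (\<exists>e. heads p e w)"
  unfolding seeded_def heads_def live_def by blast

lemma presentation_eq_opp:
  "presentation_eq (IG_rels p) u v \<Longrightarrow> presentation_eq (IG_rels (opp p)) (rev u) (rev v)"
proof (induction rule: presentation_eq.induct)
  case (rel u v a b)
  then have "(rev u, rev v) \<in> IG_rels (opp p)" by (auto simp: IG_rels_def opp_def)
  then show ?case using presentation_eq.rel[of "rev u" "rev v" _ "rev b" "rev a"] by simp
qed (auto intro: presentation_eq.intros)

abbreviation ig_eq :: "'a pop \<Rightarrow> 'a list \<Rightarrow> 'a list \<Rightarrow> bool" where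
  "ig_eq p \<equiv> presentation_eq (IG_rels p)"

lemma ig_eq_opp: "ig_eq (opp p) u v \<longleftrightarrow> ig_eq p (rev u) (rev v)"
  using presentation_eq_opp[of p "rev u" "rev v"] presentation_eq_opp[of "opp p" u v] by auto

lemma ig_eq_pair: "p e f = Some g \<Longrightarrow> ig_eq p (a @ e # f # b) (a @ g # b)"
  using presentation_eq.rel[of "[e, f]" "[g]" "IG_rels p" a b] by (auto simp: IG_rels_def)

context biord
begin

section \<open>Seeds and blocks under the defining relations\<close>

lemma live_rel: "ig_eq p u v \<Longrightarrow> live p e u \<longleftrightarrow> live p e v"
  unfolding live_def using reach_rel by blast

lemma live_appendD: "live p e (u @ v) \<Longrightarrow> live p e u"
  unfolding live_def reach_append by blast

lemma live_L: "Lr p e e' \<Longrightarrow> live p e w \<Longrightarrow> live p e' w"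
  unfolding live_def using reach_L1 by blast

lemma live_mono: "x \<in> E \<Longrightarrow> x \<cdot> e = x \<Longrightarrow> live p e w \<Longrightarrow> live p x w"
  unfolding live_def using reach_mono by blast

lemma live_single: "e \<in> E \<Longrightarrow> live p e []"
  unfolding live_def by (rule exI[of _ e]) (simp add: Lr_refl)

lemma live_Cons: "live p e (f # w) \<longleftrightarrow> (\<exists>h. stp p e f h \<and> live p h w)"
  unfolding live_def reach.simps by blast

text \<open>The witness \<open>l\<close> of the step recovers \<open>f\<close> from the product: k l
  = f g l = f l = f. So a seed that acts along its neighbour is the carrier of the pair.\<close>

lemma carrier_if_stp:
  assumes fg: "p f g = Some k" and s: "stp p f g x"
  shows "Lr (opp p) f k"
proof -
  have k: "k = f \<cdot> g" "k \<in> E" "f \<in> E" "g \<in> E" using fg p_E[OF fg] by (auto simp: p_iff)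
  obtain l where l: "l \<in> E" "f \<cdot> l = f" "g \<cdot> l = l"
    using stpE[OF s] by metis
  have kl: "k \<cdot> l = f" using k l by (simp add: assoc)
  have "k \<cdot> f = f" using mult_eq_extend[OF kl, of l] idem2[of k l] kl k l by simp
  moreover have "f \<cdot> k = k" using k by simp
  ultimately show ?thesis unfolding Rr_iff using k by blast
qed

lemma seeded_left:
  assumes fg: "p f g = Some k" and l: "live p f (g # b)" "live (opp p) f (rev a)"
  shows "seeded p (a @ k # b)"
proof -
  interpret d: biord S "\<lambda>x y. y \<cdot> x" "opp p" by (rule dual)
  obtain x where x: "stp p f g x" "live p x b" using l live_Cons by blast
  have R: "Lr (opp p) f k" using carrier_if_stp[OF fg x(1)] .
  then have "live (opp p) k (rev a)" using d.live_L l by blast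
  moreover obtain y where "stp p f g y" "Lr p y k" using stp_carrier[OF fg R] by blast
  then have "live p k b" using x stp_det live_L Lr_trans by blast
  ultimately show ?thesis unfolding seeded_def by blast
qed

lemma seeded_expand:
  assumes fg: "p f g = Some k" and R: "Lr (opp p) f k" and l: "live p k b" "live (opp p) k (rev a)"
  shows "seeded p (a @ f # g # b)"
proof -
  interpret d: biord S "\<lambda>x y. y \<cdot> x" "opp p" by (rule dual)
  obtain x where x: "stp p f g x" "Lr p x k" using stp_carrier[OF fg R] by blast
  have "live p f (g # b)" unfolding live_Cons using x live_L Lr_sym l(1) by blast
  moreover have "live (opp p) f (rev a)" using d.live_L d.Lr_sym R l(2) by blast
  ultimately show ?thesis unfolding seeded_def by blast
qed

text \<open>A seed outside the pair notices it only through the action, which respects the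
  relations. A seed inside it changes places with the product; the case of the right factor is the
  mirror image over \<open>opp p\<close>.\<close>

lemma seeded_step:
  assumes fg: "p f g = Some k"
  shows "seeded p (a @ [f, g] @ b) \<longleftrightarrow> seeded p (a @ [k] @ b)"
proof -
  interpret d: biord S "\<lambda>x y. y \<cdot> x" "opp p" by (rule dual)
  have gf: "opp p g f = Some k" using fg by (simp add: opp_def)
  have eq: "ig_eq p (c @ [f, g] @ e) (c @ [k] @ e)" for c e using ig_eq_pair[of p f g k c e] fg by simp
  have lr: "live p s (c @ [f, g] @ e) \<longleftrightarrow> live p s (c @ [k] @ e)" for s c e using live_rel[OF eq] .
  have "ig_eq (opp p) (rev (c @ [f, g] @ e)) (rev (c @ [k] @ e))" for c e
    using presentation_eq_opp[OF eq] .
  then have ll: "live (opp p) s (rev (c @ [f, g] @ e)) \<longleftrightarrow> live (opp p) s (rev (c @ [k] @ e))" for s c e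
    using d.live_rel by blast
  show ?thesis
  proof
    assume "seeded p (a @ [f, g] @ b)"
    then obtain u s v where uv: "a @ [f, g] @ b = u @ s # v" and l: "live p s v" "live (opp p) s (rev u)"
      unfolding seeded_def by blast
    from uv show "seeded p (a @ [k] @ b)"
    proof (cases rule: append_eq_append_Cons_cases)
      case (1 a2)
      then have "live p s (a2 @ [k] @ b)" using l lr by simp
      then show ?thesis using l 1 unfolding seeded_def by (metis append.assoc append_Cons)
    next
      case (2 x1 x2)
      then consider "x1 = []" "s = f" "x2 = [g]" | "x1 = [f]" "s = g" "x2 = []"
        by (cases x1) (auto simp: Cons_eq_append_conv)
      then show ?thesis
      proof cases
        case 1
        then show ?thesis using seeded_left[OF fg, of b a] 2 l by simp
      next
        case c2: 2
        then have "seeded (opp p) (rev b @ k # rev a)"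
          using d.seeded_left[OF gf, of "rev a" "rev b"] 2 l by simp
        then show ?thesis using seeded_opp[of p "a @ [k] @ b"] by simp
      qed
    next
      case (3 b1)
      then have "live (opp p) s (rev (a @ [k] @ b1))" using l ll by simp
      then show ?thesis using l 3 unfolding seeded_def by (metis append.assoc)
    qed
  next
    assume "seeded p (a @ [k] @ b)"
    then obtain u s v where uv: "a @ [k] @ b = u @ s # v" and l: "live p s v" "live (opp p) s (rev u)"
      unfolding seeded_def by blast
    from uv show "seeded p (a @ [f, g] @ b)"
    proof (cases rule: append_eq_append_Cons_cases)
      case (1 a2)
      then have "live p s (a2 @ [f, g] @ b)" using l lr by simp
      then show ?thesis using l 1 unfolding seeded_def by (metis append.assoc append_Cons)
    next
      case (2 x1 x2)
      then have 2: "s = k" "u = a" "v = b" by (auto simp: Cons_eq_append_conv)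
      from carrier_cases[OF fg] show ?thesis
      proof
        assume "Lr (opp p) f k"
        then show ?thesis using seeded_expand[OF fg] 2 l by simp
      next
        assume "Lr p g k"
        then have "seeded (opp p) (rev b @ g # f # rev a)"
          using d.seeded_expand[OF gf] 2 l by simp
        then show ?thesis using seeded_opp[of p "a @ [f, g] @ b"] by simp
      qed
    next
      case (3 b1)
      then have "live (opp p) s (rev (a @ [f, g] @ b1))" using l ll by simp
      then show ?thesis using l 3 unfolding seeded_def by (metis append.assoc)
    qed
  qed
qed

lemma seeded_rel: "ig_eq p u v \<Longrightarrow> seeded p u \<longleftrightarrow> seeded p v"
proof (induction rule: presentation_eq.induct)
  case (rel u v a b)
  then obtain f h c where "u = [f, h]" "v = [c]" "p f h = Some c" unfolding IG_rels_def by blast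
  then show ?case using seeded_step[of f h c a b] by simp
qed auto

text \<open>Treats a cut between the two factors when \<open>f\<close> is the carrier. The seed of
  the second block is \<open>g\<close> or lies in \<open>b\<close>. In the first case everything
  below \<open>g\<close> acts along \<open>b\<close>, in particular \<open>k\<close> and what a step
  by \<open>k\<close> leads to, so the first block extends over all of \<open>b\<close>; in the
  second case \<open>b\<close> is a block by itself.\<close>

lemma seeded_merge:
  assumes fg: "p f g = Some k" and R: "Lr (opp p) f k"
    and s1: "seeded p (a @ [f])" and s2: "seeded p (g # b)"
  shows "seeded p (a @ k # b) \<or> seeded p (a @ [k]) \<and> seeded p b"
proof -
  interpret d: biord S "\<lambda>x y. y \<cdot> x" "opp p" by (rule dual)
  have E: "k \<in> E" "g \<in> E" "k \<cdot> g = k" using fg p_E[OF fg] by (auto simp: p_iff assoc)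
  obtain u2 t v2 where t: "g # b = u2 @ t # v2" "live p t v2" "live (opp p) t (rev u2)"
    using s2 unfolding seeded_def by blast
  have g: "t = g \<and> live p g b \<or> seeded p b"
  proof (cases u2)
    case Nil then show ?thesis using t by simp
  next
    case (Cons y u3)
    then have "live (opp p) t (rev u3)" using t d.live_appendD by simp
    then show ?thesis using t Cons unfolding seeded_def by auto
  qed
  obtain u s v where s: "a @ [f] = u @ s # v" "live p s v" "live (opp p) s (rev u)"
    using s1 unfolding seeded_def by blast
  from s(1) have "a @ [f] @ [] = u @ s # v" by simp
  then show ?thesis
  proof (cases rule: append_eq_append_Cons_cases)
    case (1 a2)
    then have "live p s (a2 @ [f])" using s by simp
    then obtain h x where h: "reach p s a2 h" "stp p h f x"
      unfolding live_def reach_append by auto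
    then obtain y where y: "stp p h k y" using stp_R[OF R] by blast
    then have yE: "y \<in> E" "y \<cdot> k = y" using stp_E stp_le by auto
    have sb: "live p s (a2 @ k # c)" if "live p y c" for c
      using that h(1) y unfolding live_def reach_append by auto
    have "seeded p (a @ k # c)" if "live p y c" for c
      unfolding seeded_def using 1 s(3) sb[OF that] by (metis append.assoc append_Cons)
    moreover have "live p y b" if "live p g b"
      using live_mono[OF yE(1) _ that] Le_trans[OF yE(1) E(1,2) yE(2) E(3)] by blast
    ultimately show ?thesis using g live_single[OF yE(1)] by blast
  next
    case (2 x1 x2)
    then have "u = a" "s = f" by (auto simp: Cons_eq_append_conv)
    then have ka: "live (opp p) k (rev a)" using d.live_L R s(3) by blast
    have "seeded p (a @ k # c)" if "live p k c" for c
      unfolding seeded_def using ka that by blast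
    then show ?thesis using g live_mono[OF E(1,3)] live_single[OF E(1)] by blast
  qed simp
qed

lemma seeded_ne: "\<not> seeded p []" by (simp add: seeded_def)

text \<open>Expansion takes place inside one block, and so does a contraction unless a cut separates
  the pair. In that case \<open>seeded_merge\<close> or its mirror image redistributes the two
  blocks into at most two.\<close>

lemma blocks_step:
  assumes fg: "p f g = Some k"
  shows "blocks p n (a @ [f, g] @ b) \<longleftrightarrow> blocks p n (a @ [k] @ b)"
proof
  assume "blocks p n (a @ [k] @ b)"
  then obtain ws where ws: "concat ws = a @ k # b" "length ws \<le> n" "\<forall>x\<in>set ws. seeded p x"
    unfolding blocks_def by auto
  obtain xs a' b' ys where 1: "ws = xs @ (a' @ k # b') # ys" "a = concat xs @ a'" "b = b' @ concat ys"
    using concat_eq_append_Cons[OF ws(1)] by blast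
  have "seeded p (a' @ [f, g] @ b')" using seeded_step[OF fg] ws 1 by simp
  then show "blocks p n (a @ [f, g] @ b)"
    unfolding blocks_def using ws 1 by (intro exI[of _ "xs @ (a' @ [f, g] @ b') # ys"]) simp
next
  interpret d: biord S "\<lambda>x y. y \<cdot> x" "opp p" by (rule dual)
  have gf: "opp p g f = Some k" using fg by (simp add: opp_def)
  assume "blocks p n (a @ [f, g] @ b)"
  then obtain ws where ws: "concat ws = a @ f # g # b" "length ws \<le> n" "\<forall>x\<in>set ws. seeded p x"
    unfolding blocks_def by auto
  obtain xs a' b' ys where 1: "ws = xs @ (a' @ f # b') # ys" "a = concat xs @ a'" "g # b = b' @ concat ys"
    using concat_eq_append_Cons[OF ws(1)] by blast
  show "blocks p n (a @ [k] @ b)"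
  proof (cases b')
    case (Cons y b2)
    then have b: "y = g" "b = b2 @ concat ys" using 1 by auto
    have "seeded p (a' @ [k] @ b2)" using seeded_step[OF fg, of a' b2] ws 1 Cons b by simp
    then show ?thesis
      unfolding blocks_def using ws 1 b by (intro exI[of _ "xs @ (a' @ [k] @ b2) # ys"]) simp
  next
    case Nil
    \<comment> \<open>The cut runs between \<open>f\<close> and \<open>g\<close>. As seeded blocks
      are nonempty, \<open>g\<close> opens the very next block.\<close>
    then have "concat ys = [] @ g # b" using 1 by simp
    then obtain xs2 a2 b2 ys2 where 2: "ys = xs2 @ (a2 @ g # b2) # ys2" "[] = concat xs2 @ a2" "b = b2 @ concat ys2"
      using concat_eq_append_Cons by metis
    have "\<forall>x\<in>set xs2. x = [] \<and> seeded p x" using 2 1 ws by auto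
    then have "xs2 = []" using seeded_ne by (cases xs2) auto
    then have ws2: "ws = xs @ (a' @ [f]) # (g # b2) # ys2" using 1 2 Nil by simp
    have s: "seeded p (a' @ [f])" "seeded p (g # b2)" using ws ws2 by auto
    have "seeded p (a' @ k # b2) \<or> (\<exists>c d. seeded p c \<and> seeded p d \<and> c @ d = a' @ k # b2)"
      using carrier_cases[OF fg]
    proof
      assume "Lr (opp p) f k"
      then show ?thesis using seeded_merge[OF fg _ s] by fastforce
    next
      assume L: "Lr p g k"
      have "seeded (opp p) (rev b2 @ [g])" "seeded (opp p) (f # rev a')"
        using s seeded_opp[of p "g # b2"] seeded_opp[of p "a' @ [f]"] by auto
      then have "seeded (opp p) (rev b2 @ k # rev a') \<or> seeded (opp p) (rev b2 @ [k]) \<and> seeded (opp p) (rev a')"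
        using d.seeded_merge[OF gf] L by simp
      then have "seeded p (a' @ k # b2) \<or> seeded p (k # b2) \<and> seeded p a'"
        using seeded_opp[of p "a' @ k # b2"] seeded_opp[of p "k # b2"] seeded_opp[of p a'] by simp
      then show ?thesis by blast
    qed
    then show ?thesis
    proof (elim disjE exE conjE)
      assume "seeded p (a' @ k # b2)"
      then show ?thesis unfolding blocks_def using ws ws2 1 2
        by (intro exI[of _ "xs @ (a' @ k # b2) # ys2"]) simp
    next
      fix c d assume "seeded p c" "seeded p d" and cd: "c @ d = a' @ k # b2"
      then show ?thesis unfolding blocks_def using ws ws2 1 2
          arg_cong[OF cd, of "\<lambda>z. z @ concat ys2"]
        by (intro exI[of _ "xs @ c # d # ys2"]) simp
    qed
  qed
qed

lemma blocks_rel: "ig_eq p u v \<Longrightarrow> blocks p n u \<longleftrightarrow> blocks p n v"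
proof (induction rule: presentation_eq.induct)
  case (rel u v a b)
  then obtain f h c where "u = [f, h]" "v = [c]" "p f h = Some c" unfolding IG_rels_def by blast
  then show ?case using blocks_step[of f h c n a b] by simp
qed auto

lemma seeded_letter: "e \<in> E \<Longrightarrow> seeded p [e]"
proof -
  interpret d: biord S "\<lambda>x y. y \<cdot> x" "opp p" by (rule dual)
  assume "e \<in> E"
  then show ?thesis unfolding seeded_def
    using live_single d.live_single[unfolded idem_dual]
    by (intro exI[of _ "[]"] exI[of _ e]) simp
qed

text \<open>Supplies the bound on the number of blocks that does not grow when the word is
  pumped.\<close>

lemma blocks_letters: "set w \<subseteq> E \<Longrightarrow> blocks p (length w) w"
  unfolding blocks_def by (intro exI[of _ "map (\<lambda>e. [e]) w"]) (auto intro: seeded_letter)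

text \<open>The end \<open>c\<close> of the loop satisfies \<open>c \<cdot> s = c\<close> and
  \<open>s \<cdot> c = c\<close>, so \<open>reach_no_descent\<close> gives \<open>c = s\<close>. The
  closed loop is then reversed by \<open>reach_turn\<close>, and a last step by \<open>s\<close>
  leads from the L-related \<open>j\<close> exactly to \<open>s\<close>.\<close>

lemma loop_turn:
  assumes fin: "finite E" and l: "live p s (b @ [s])"
  shows "reach p s (b @ [s]) s \<and> reach (opp p) s (rev b @ [s]) s"
proof -
  interpret d: biord S "\<lambda>x y. y \<cdot> x" "opp p" by (rule dual)
  obtain h c where h: "reach p s b h" "stp p h s c" using l unfolding live_def reach_append by auto
  obtain k where k: "h \<in> E" "s \<in> E" "k \<in> E" "h \<cdot> k = h" "k \<cdot> h = k" "s \<cdot> k = k" "c = k \<cdot> s"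
    using stpE[OF h(2)] by metis
  have rc: "reach p s (b @ [s]) c" using h Lr_refl[OF stp_E[OF h(2)]] unfolding reach_append by auto
  have "c = s" using reach_no_descent[OF fin rc] k by (simp add: assoc mult_eq_extend[OF k(6)])
  have ks: "Lr (opp p) k s" unfolding Rr_iff using k \<open>c = s\<close> by simp
  have "reach p s b k" using reach_L2[OF _ h(1)] k by (simp add: Lr_iff)
  then obtain j where j: "Lr p j s" "reach (opp p) k (rev b) j" using reach_turn by blast
  have "stp (opp p) j s s"
    using d.stpI[of j s j, unfolded idem_dual] j(1) k(2) by (simp add: Lr_iff)
  then have "reach (opp p) s (rev b @ [s]) s"
    unfolding d.reach_append using d.reach_L1[OF ks j(2)] d.Lr_refl[unfolded idem_dual, OF k(2)] by auto
  then show ?thesis using rc \<open>c = s\<close> by simp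
qed

end

section \<open>Segments of periodic sequences\<close>

lemma map_upt_shift:
  fixes q :: "nat \<Rightarrow> 'a"
  assumes "\<And>i. q (i + N) = q i"
  shows "map q [a + N..<b + N] = map q [a..<b]"
  by (rule nth_equalityI) (use assms in \<open>auto simp: add.assoc add.left_commute add.commute\<close>, metis assms add.commute add.left_commute)

lemma map_upt_split: "i \<le> j \<Longrightarrow> j \<le> k \<Longrightarrow> map q [i..<k] = map q [i..<j] @ map q [j..<k]"
  by (metis le_Suc_ex map_append upt_add_eq_append)

lemma map_upt_shift_mult:
  fixes q :: "nat \<Rightarrow> 'a"
  assumes "\<And>i. q (i + N) = q i"
  shows "map q [a + t * N..<b + t * N] = map q [a..<b]"
proof (induction t)
  case (Suc t)
  have "map q [a + Suc t * N..<b + Suc t * N] = map q [(a + t * N) + N..<(b + t * N) + N]"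
    by (simp add: algebra_simps)
  then show ?case using map_upt_shift[of q N, OF assms] Suc by simp
qed simp

context biord
begin

text \<open>If \<^term>\<open>w @ v @ w\<close> equals \<^term>\<open>w\<close>, the arbitrarily long words obtained by pumping \<^term>\<open>w @ v\<close> split into
  a bounded number of seeded blocks, so some seed acts along a whole period; it then acts along the periodic word in both directions.\<close>

lemma regular_seeded:
  assumes fin: "finite E" and w: "set w \<subseteq> E" "w \<noteq> []" and eq: "ig_eq p (w @ v @ w) w"
  shows "seeded p w"
proof -
  interpret d: biord S "\<lambda>x y. y \<cdot> x" "opp p" by (rule dual)
  define N where "N = length (w @ v)"
  define q where "q i = (w @ v) ! (i mod N)" for i
  \<comment> \<open>\<open>W k\<close> is the word (w v)^k w, cut out of the periodic sequence
    \<open>q\<close>.\<close>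
  define W where "W k = map q [0..<k * N + length w]" for k
  have N: "N > 0" "length w \<le> N" using w by (auto simp: N_def)
  have per: "q (i + N) = q i" for i by (simp add: q_def)
  have qw: "map q [0..<length w] = w"
    by (rule nth_equalityI) (use N in \<open>auto simp: q_def nth_append\<close>)
  have qwv: "map q [0..<N] = w @ v"
    by (rule nth_equalityI) (auto simp: q_def N_def)
  have WS: "W (Suc k) = (w @ v) @ W k" for k
  proof -
    have "W (Suc k) = map q [0..<N] @ map q [0 + N..<(k * N + length w) + N]"
      unfolding W_def by (subst map_upt_split[of 0 N]) (auto simp: algebra_simps)
    then show ?thesis using map_upt_shift[of q N 0 "k * N + length w", OF per] qwv by (simp add: W_def)
  qed
  have Weq: "ig_eq p (W k) w" for k
  proof (induction k)
    case 0 then show ?case using qw by (simp add: W_def presentation_eq.refl)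
  next
    case (Suc k)
    then have "ig_eq p (W (Suc k)) ((w @ v) @ w)" unfolding WS by (rule presentation_eq_appendL)
    also have "ig_eq p \<dots> w" using eq by simp
    finally show ?case .
  qed
  \<comment> \<open>Chosen so that \<open>W K\<close>, whose length is at least
    \<open>K * N\<close>, is longer than \<open>length w\<close> blocks of length
    \<open>2 * N\<close> each.\<close>
  define K where "K = length w * (2 * N) + 1"
  have "blocks p (length w) (W K)" using blocks_letters[OF w(1)] blocks_rel[OF Weq] by blast
  then obtain ws where ws: "concat ws = W K" "length ws \<le> length w" "\<forall>x\<in>set ws. seeded p x"
    unfolding blocks_def by blast
  have "\<exists>B\<in>set ws. length B > 2 * N"
  proof (rule ccontr)
    assume "\<not> ?thesis"
    then have "\<forall>B\<in>set ws. length B \<le> 2 * N" by auto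
    then have "length (concat ws) \<le> length ws * (2 * N)" by (induction ws) auto
    also have "\<dots> \<le> length w * (2 * N)" using ws by simp
    also have "\<dots> < K" by (simp add: K_def)
    also have "\<dots> \<le> K * N" using N by simp
    also have "\<dots> \<le> length (W K)" by (simp add: W_def)
    finally show False using ws by simp
  qed
  then obtain B where B: "B \<in> set ws" "length B > 2 * N" by blast
  obtain xs ys where "ws = xs @ B # ys" using B split_list by metis
  then have WB: "W K = concat xs @ B @ concat ys" using ws by simp
  obtain u s c where usc: "B = u @ s # c" "live p s c" "live (opp p) s (rev u)"
    using ws B unfolding seeded_def by blast
  define P where "P = length (concat xs)"
  define i where "i = P + length u"
  have len: "length (W K) = P + length B + length (concat ys)" using WB by (simp add: P_def)
  have nth: "B ! t = q (P + t)" if "t < length B" for t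
  proof -
    have "B ! t = W K ! (P + t)" using WB that by (simp add: nth_append P_def)
    also have "\<dots> = q (P + t)" unfolding W_def using that len by (subst nth_map) (auto simp: W_def)
    finally show ?thesis .
  qed
  have si: "s = q i" using nth[of "length u"] usc by (simp add: i_def)
  have c: "c = map q [Suc i..<Suc i + length c]"
  proof (rule nth_equalityI)
    fix t assume "t < length c"
    then show "c ! t = map q [Suc i..<Suc i + length c] ! t"
      using nth[of "Suc (length u + t)"] usc(1) by (simp add: i_def nth_append add.assoc del: upt_Suc)
  qed (simp del: upt_Suc)
  have u: "u = map q [P..<i]"
  proof (rule nth_equalityI)
    fix t assume "t < length u"
    then show "u ! t = map q [P..<i] ! t" using nth[of t] usc(1) by (simp add: i_def nth_append)
  qed (simp add: i_def)
  define b where "b = map q [Suc i..<i + N]"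
  \<comment> \<open>Besides the seed the block has at least \<open>2 * N\<close> letters, hence
    \<open>N\<close> of them on one side.\<close>
  have "length c \<ge> N \<or> length u \<ge> N" using B usc by auto
  then have loop: "reach p s (b @ [s]) s \<and> reach (opp p) s (rev b @ [s]) s"
  proof
    assume lc: "length c \<ge> N"
    have "c = map q [Suc i..<i + N] @ map q [i + N..<Suc (i + N)] @ map q [Suc (i + N)..<Suc i + length c]"
      by (subst c, subst map_upt_split[of "Suc i" "i + N"], use lc N in simp, use lc N in simp,
          subst map_upt_split[of "i + N" "Suc (i + N)"], use lc N in simp_all)
    then have "c = (b @ [s]) @ map q [Suc (i + N)..<Suc i + length c]"
      using si per[of i] by (simp add: b_def)
    then have "live p s (b @ [s])" using usc(2) live_appendD by metis
    then show ?thesis using loop_turn[OF fin] by blast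
  next
    assume lu: "length u \<ge> N"
    have iN: "i \<ge> P + N" using lu by (simp add: i_def)
    have "u = map q [P..<i - N] @ map q [i - N..<Suc (i - N)] @ map q [Suc (i - N)..<i]"
      by (subst u, subst map_upt_split[of P "i - N"], use iN N in simp, use iN N in simp,
          subst map_upt_split[of "i - N" "Suc (i - N)"], use iN N in simp_all)
    moreover have "map q [Suc (i - N)..<i] = b"
      unfolding b_def using map_upt_shift[of q N "Suc (i - N)" i, OF per] iN by simp
    moreover have "q (i - N) = s" using per[of "i - N"] iN si by simp
    ultimately have "u = map q [P..<i - N] @ s # b" by simp
    then have "rev u = (rev b @ [s]) @ rev (map q [P..<i - N])" by simp
    then have "live (opp p) s (rev b @ [s])" using usc(3) d.live_appendD by metis
    then show ?thesis using d.loop_turn[unfolded idem_dual opp_opp rev_rev_ident, OF fin] by (metis rev_rev_ident)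
  qed
  \<comment> \<open>By periodicity the same letter stands at position \<open>r\<close> in the first
    period, and the loop around it is the same.\<close>
  define r where "r = i mod N"
  have rN: "r < N" using N by (simp add: r_def)
  have i_r: "i = r + (i div N) * N" by (simp add: r_def)
  have b_r: "b = map q [Suc r..<r + N]"
    unfolding b_def using map_upt_shift_mult[of q N "Suc r" "i div N" "r + N", OF per] i_r
    by (metis add.assoc add.commute add_Suc)
  have s_r: "s = q r" unfolding si q_def r_def by simp
  have wvw: "map q [0..<N + length w] = w @ v @ w"
    using WS[of 0] qw by (simp add: W_def)
  have split: "w @ v @ w = map q [0..<r] @ s # map q [Suc r..<N + length w]"
    unfolding wvw[symmetric] s_r
    by (subst map_upt_split[of 0 r], use rN N in simp, use rN N in simp, subst (2) upt_conv_Cons, use rN N in simp_all)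
  \<comment> \<open>To the right of position \<open>r\<close> the word w v w has fewer than
    \<open>2 * N\<close> letters, so two turns of the loop cover them.\<close>
  have "live p s (b @ [s] @ b @ [s])"
    using loop unfolding live_def append_assoc[symmetric, of b "[s]" "b @ [s]"] reach_append[of s "b @ [s]"] by blast
  moreover have "b @ [s] @ b @ [s] = map q [Suc r..<N + length w] @ map q [N + length w..<Suc r + 2 * N]"
  proof -
    have "map q [Suc r + N..<r + N + N] = b" unfolding b_r using map_upt_shift[of q N "Suc r" "r + N", OF per] by simp
    moreover have "map q [Suc r..<Suc r + 2 * N] = map q [Suc r..<r + N] @ map q [r + N..<Suc r + N]
       @ map q [Suc r + N..<r + N + N] @ map q [r + N + N..<Suc r + 2 * N]"
      by (subst map_upt_split[of "Suc r" "r + N"], use N in simp, use N in simp,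
        subst map_upt_split[of "r + N" "Suc r + N"], use N in simp, use N in simp,
        subst map_upt_split[of "Suc r + N" "r + N + N"], use N in simp_all)
    moreover have "map q [r + N + N..<Suc r + 2 * N] = [s]"
      using per[of r] per[of "r + N"] s_r by (simp add: mult_2 add.assoc)
    moreover have "map q [r + N..<Suc r + N] = [s]" using per[of r] s_r by simp
    ultimately have "b @ [s] @ b @ [s] = map q [Suc r..<Suc r + 2 * N]" using b_r by simp
    also have "\<dots> = map q [Suc r..<N + length w] @ map q [N + length w..<Suc r + 2 * N]"
      by (rule map_upt_split) (use rN N in auto)
    finally show ?thesis .
  qed
  ultimately have right: "live p s (map q [Suc r..<N + length w])" using live_appendD by metis
  \<comment> \<open>To the left there are only \<open>r < N\<close> letters, a part of one reversed
    turn.\<close>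
  have "b = map q [Suc r..<N] @ map q [0 + N..<r + N]"
    unfolding b_r by (subst map_upt_split[of "Suc r" N]) (use rN in auto)
  then have "rev b @ [s] = rev (map q [0..<r]) @ rev (map q [Suc r..<N]) @ [s]"
    using map_upt_shift[of q N 0 r, OF per] by simp
  moreover have "live (opp p) s (rev b @ [s])" using loop unfolding live_def by blast
  ultimately have "live (opp p) s (rev (map q [0..<r]))" using d.live_appendD by metis
  then have "seeded p (w @ v @ w)" unfolding seeded_def using split right by blast
  then show ?thesis using seeded_rel[OF eq] by blast
qed

text \<open>Translates the action into Green's relations of the free semigroup: e w is R-related to
  e through \<open>x\<close> and L-related to g through \<open>y\<close>. For one letter, e f = e k
  f = e h, and \<open>k\<close> leads back because h k = k and e k = e.\<close>

lemma ig_reach: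
  "reach p e w g \<Longrightarrow> \<exists>x y. set x \<subseteq> E \<and> set y \<subseteq> E \<and>
     ig_eq p (e # w @ x) [e] \<and> ig_eq p (y @ e # w) [g] \<and> ig_eq p (e # w @ [g]) (e # w)"
proof (induction w arbitrary: e)
  case Nil
  then have "e \<in> E" "g \<in> E" "p e g = Some e" "p g e = Some g" using Lr_iff[of e g] Lr_def[of p e g] by auto
  then show ?case
    using ig_eq_pair[of p e g e "[]" "[]"] ig_eq_pair[of p g e g "[]" "[]"]
    by (intro exI[of _ "[]"] exI[of _ "[g]"]) (auto intro: presentation_eq.refl)
next
  case (Cons f w)
  obtain h k where h: "Lr p e k" "p f k = Some k" "p k f = Some h" "reach p h w g"
    using Cons.prems by (auto simp: stp_def)
  have kE: "k \<in> E" "h \<in> E" "h = k \<cdot> f" "f \<in> E" "f \<cdot> k = k" using h p_E[OF h(3)] by (auto simp: p_iff)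
  have hk: "p h k = Some k" "p k h = Some h" unfolding p_iff using kE by (auto simp: assoc)
  have ek: "p e k = Some e" "p k e = Some k" using h(1) by (auto simp: Lr_def)
  obtain x y where xy: "set x \<subseteq> E" "set y \<subseteq> E" "ig_eq p (h # w @ x) [h]" "ig_eq p (y @ h # w) [g]"
    "ig_eq p (h # w @ [g]) (h # w)" using Cons.IH[OF h(4)] by blast
  have ef: "ig_eq p (a @ e # f # t) (a @ e # h # t)" for a t
  proof -
    have "ig_eq p (a @ e # f # t) (a @ e # k # f # t)" using ig_eq_pair[of p, OF ek(1)] presentation_eq.sym by blast
    also have "ig_eq p \<dots> (a @ e # h # t)" using ig_eq_pair[of p, OF h(3), of "a @ [e]" t] by simp
    finally show ?thesis .
  qed
  have "ig_eq p (e # (f # w) @ (x @ [k])) [e]"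
  proof -
    have "ig_eq p (e # (f # w) @ (x @ [k])) (e # h # w @ x @ [k])" using ef[of "[]" "w @ x @ [k]"] by simp
    also have "ig_eq p \<dots> ([e] @ [h] @ [k])" using presentation_eq_append[OF xy(3), of "[e]" "[k]"] by simp
    also have "ig_eq p \<dots> [e, k]" using ig_eq_pair[of p, OF hk(1), of "[e]" "[]"] by simp
    also have "ig_eq p \<dots> [e]" using ig_eq_pair[of p, OF ek(1), of "[]" "[]"] by simp
    finally show ?thesis .
  qed
  moreover have "ig_eq p ((y @ [k]) @ e # f # w) [g]"
  proof -
    have "ig_eq p ((y @ [k]) @ e # f # w) ((y @ [k]) @ e # h # w)" using ef by blast
    also have "ig_eq p \<dots> (y @ k # h # w)" using ig_eq_pair[of p, OF ek(2), of y "h # w"] by simp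
    also have "ig_eq p \<dots> (y @ h # w)" using ig_eq_pair[of p, OF hk(2), of y w] by simp
    also have "ig_eq p \<dots> [g]" by (rule xy(4))
    finally show ?thesis .
  qed
  moreover have "ig_eq p (e # (f # w) @ [g]) (e # f # w)"
  proof -
    have "ig_eq p (e # (f # w) @ [g]) (e # h # w @ [g])" using ef[of "[]" "w @ [g]"] by simp
    also have "ig_eq p \<dots> (e # h # w)" using presentation_eq_appendL[OF xy(5), of "[e]"] by simp
    also have "ig_eq p \<dots> (e # f # w)" using ef[of "[]" w] presentation_eq.sym by fastforce
    finally show ?thesis .
  qed
  ultimately show ?case using xy kE by (intro exI[of _ "x @ [k]"] exI[of _ "y @ [k]"]) simp
qed

text \<open>Equal words act on the L-class of \<open>e\<close> with the same result. The letter
  \<open>e\<close> stays in place, while whatever a last letter \<open>f\<close> leads to lies below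
  \<open>f\<close>. So the order of idempotents can be read off from equations in the free
  semigroup.\<close>

lemma ig_le:
  assumes "e \<in> E" "ig_eq p [e, f] [e]" shows "e \<cdot> f = e"
proof -
  have "reach p e [e] e" using Lr_refl[OF assms(1)] stpI[of e e e] assms(1) by auto
  then have "reach p e [e, f] e" using reach_rel[OF assms(2)] by blast
  then obtain h x where "stp p h f x" "Lr p x e" by auto
  then have "x \<in> E" "f \<in> E" "x \<cdot> f = x" "e \<cdot> x = e" using stp_le[of h f x] by (auto simp: Lr_iff elim: stpE)
  then show ?thesis using Le_trans[of e x f] assms(1) by blast
qed

lemma ig_ge:
  assumes "e \<in> E" "ig_eq p [f, e] [e]" shows "f \<cdot> e = e"
proof -
  interpret d: biord S "\<lambda>x y. y \<cdot> x" "opp p" by (rule dual)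
  show ?thesis using d.ig_le[of e f] assms ig_eq_opp[of p "[e, f]" "[e]"] by (simp add: idem_dual)
qed

text \<open>The pseudo-inverse undoes both sides of the seed: \<open>x\<close> inverts
  \<open>c\<close> to the right of \<open>s\<close>, and \<open>rev y\<close> inverts
  \<open>u\<close> to the left of it.\<close>

lemma seeded_regular:
  assumes "seeded p w" "set w \<subseteq> E"
  shows "\<exists>v. v \<noteq> [] \<and> set v \<subseteq> E \<and> ig_eq p (w @ v @ w) w"
proof -
  interpret d: biord S "\<lambda>x y. y \<cdot> x" "opp p" by (rule dual)
  obtain u s c where w: "w = u @ s # c" "live p s c" "live (opp p) s (rev u)"
    using assms(1) unfolding seeded_def by blast
  obtain x where x: "set x \<subseteq> E" "ig_eq p (s # c @ x) [s]" using w(2) ig_reach unfolding live_def by blast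
  obtain y where y: "set y \<subseteq> E" "ig_eq (opp p) (s # rev u @ y) [s]"
    using w(3) d.ig_reach[unfolded idem_dual] unfolding live_def by blast
  have y2: "ig_eq p (rev y @ u @ [s]) [s]" using y(2) unfolding ig_eq_opp by simp
  have "s \<in> E" using assms w by simp
  then have ss: "p s s = Some s" by (simp add: p_iff)
  have "ig_eq p (w @ (x @ [s] @ rev y) @ w) (u @ [s] @ [s] @ rev y @ u @ s # c)"
    using presentation_eq_append[OF x(2), of u "[s] @ rev y @ u @ s # c"] w(1) by simp
  also have "ig_eq p \<dots> (u @ [s] @ [s] @ [s] @ c)"
    using presentation_eq_append[OF y2, of "u @ [s] @ [s]" c] by simp
  also have "ig_eq p \<dots> (u @ [s] @ [s] @ c)" using ig_eq_pair[of p, OF ss, of u "s # c"] by simp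
  also have "ig_eq p \<dots> w" using ig_eq_pair[of p, OF ss, of u "c"] w(1) by simp
  finally show ?thesis using x y \<open>s \<in> E\<close> by (intro exI[of _ "x @ [s] @ rev y"]) simp
qed

lemma heads_props:
  assumes "heads p e w" shows "e \<in> E" "ig_eq p (e # w) w" "live p e w"
proof -
  interpret d: biord S "\<lambda>x y. y \<cdot> x" "opp p" by (rule dual)
  obtain u s c where w: "w = u @ s # c" "live p s c" "reach (opp p) s (rev u) e"
    using assms unfolding heads_def by blast
  show "e \<in> E" using d.reach_E[unfolded idem_dual, OF w(3)] by blast
  have "ig_eq (opp p) (s # rev u @ [e]) (s # rev u)" using d.ig_reach[OF w(3)] by blast
  then have "ig_eq p (e # u @ [s]) (u @ [s])" unfolding ig_eq_opp by simp
  then show "ig_eq p (e # w) w" using presentation_eq_appendR[of _ "e # u @ [s]" "u @ [s]" c] w by simp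
  \<comment> \<open>Turning the left path round shows that \<open>u\<close> leads from
    \<open>e\<close> to an idempotent \<open>j\<close> R-related to the seed; on it \<open>s\<close>
    acts with result \<open>s\<close>.\<close>
  obtain j where j: "Lr (opp p) j s" "reach p e u j" using d.reach_turn[OF w(3)] by auto
  then have "stp p j s s" using stpI[of j s j] by (simp add: Rr_iff)
  then show "live p e w" using j w(1,2) unfolding live_def w(1) reach_append by auto
qed

text \<open>Heads of equal words are R-related: e = v x and f v = v in the free semigroup give f e =
  e there, and \<open>ig_ge\<close> brings this back to E. The same holds with the roles
  exchanged.\<close>

lemma heads_eq:
  assumes u: "heads p e u" and eq: "ig_eq p u v" and v: "seeded p v"
  shows "heads p e v"
proof -
  interpret d: biord S "\<lambda>x y. y \<cdot> x" "opp p" by (rule dual)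
  obtain e' where e': "heads p e' v" using v seeded_heads by metis
  have le: "f \<cdot> e = e" if hh: "heads p e u" "heads p f v" "ig_eq p u v" for e f u v
  proof -
    obtain x where x: "ig_eq p (e # u @ x) [e]"
      using ig_reach heads_props(3)[OF hh(1)] unfolding live_def by blast
    have ev: "ig_eq p (v @ x) [e]"
    proof -
      have "ig_eq p (v @ x) (u @ x)" using hh(3) presentation_eq_appendR presentation_eq.sym by blast
      also have "ig_eq p \<dots> ((e # u) @ x)"
        using heads_props(2)[OF hh(1)] presentation_eq_appendR presentation_eq.sym by blast
      also have "ig_eq p \<dots> [e]" using x by simp
      finally show ?thesis .
    qed
    have "ig_eq p [f, e] ([f] @ v @ x)" using presentation_eq_appendL[OF presentation_eq.sym[OF ev], of "[f]"] by simp
    also have "ig_eq p \<dots> (v @ x)" using presentation_eq_appendR[OF heads_props(2)[OF hh(2)], of x] by simp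
    also have "ig_eq p \<dots> [e]" by (rule ev)
    finally show ?thesis using ig_ge heads_props(1)[OF hh(1)] by blast
  qed
  have "Lr (opp p) e' e"
    unfolding Rr_iff using le[OF u e' eq] le[OF e' u presentation_eq.sym[OF eq]] heads_props(1)[OF u] heads_props(1)[OF e'] by blast
  then show ?thesis using e' d.reach_L2 unfolding heads_def by blast
qed

text \<open>\<open>g\<close> and \<open>e\<close> are both L-related to e w in the free semigroup,
  hence to each other in E by \<open>ig_le\<close>. This is applied to the elements of the group of
  \<open>e\<close>.\<close>

lemma reach_loop_if_L:
  assumes r: "reach p e w g" and a: "ig_eq p (a @ e # w) [e]" and ee: "ig_eq p (e # w @ [e]) (e # w)"
  shows "reach p e w e"
proof -
  have E: "e \<in> E" "g \<in> E" using reach_E[OF r] by auto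
  obtain y where y: "ig_eq p (y @ e # w) [g]" "ig_eq p (e # w @ [g]) (e # w)" using ig_reach[OF r] by blast
  have "ig_eq p [e, g] ((a @ e # w) @ [g])" using presentation_eq_appendR[OF presentation_eq.sym[OF a], of "[g]"] by simp
  also have "ig_eq p \<dots> (a @ e # w)" using presentation_eq_appendL[OF y(2), of a] by simp
  also have "ig_eq p \<dots> [e]" by (rule a)
  finally have 1: "e \<cdot> g = e" using ig_le E by blast
  have "ig_eq p [g, e] ((y @ e # w) @ [e])" using presentation_eq_appendR[OF presentation_eq.sym[OF y(1)], of "[e]"] by simp
  also have "ig_eq p \<dots> (y @ e # w)" using presentation_eq_appendL[OF ee, of y] by simp
  also have "ig_eq p \<dots> [g]" by (rule y(1))
  finally have "g \<cdot> e = g" using ig_le E by blast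
  then show ?thesis using 1 E r reach_L2 by (simp add: Lr_iff)
qed

end

section \<open>A presentation of the maximal subgroups\<close>

text \<open>An L-class is represented by its least letter; \<^term>\<open>n\<close> is the dead state, standing for an undefined action.\<close>

definition lrep :: "nat \<Rightarrow> nat pop \<Rightarrow> nat \<Rightarrow> nat" where
  "lrep n p a = hd (filter (Lr p a) [0..<n] @ [n])"

definition lact :: "nat \<Rightarrow> nat pop \<Rightarrow> nat \<Rightarrow> nat \<Rightarrow> nat" where
  "lact n p a f =
     hd (map (\<lambda>k. lrep n p (the (p k f))) (filter (\<lambda>k. Lr p a k \<and> p f k = Some k) [0..<n]) @ [n])"

fun path_word :: "nat \<Rightarrow> nat pop \<Rightarrow> nat \<Rightarrow> nat list \<Rightarrow> group_word" where
  "path_word n p a [] = []"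
| "path_word n p a (f # w) = (a * n + f, True) # path_word n p (lact n p a f) w"

lemma path_word_append:
  "path_word n p a (u @ v) = path_word n p a u @ path_word n p (foldl (lact n p) a u) v"
  by (induction u arbitrary: a) auto

section \<open>Words over group presentations\<close>

definition word_inv :: "group_word \<Rightarrow> group_word" where
  "word_inv w = rev (map (\<lambda>(i, b). (i, \<not> b)) w)"

definition group_rels :: "group_presentation \<Rightarrow> (group_word \<times> group_word) set" where
  "group_rels P = {([(i, b), (i, \<not> b)], []) | i b. i < fst P} \<union> {(r, []) | r. r \<in> set (snd P)}"

abbreviation g_eq :: "group_presentation \<Rightarrow> group_word \<Rightarrow> group_word \<Rightarrow> bool" where
  "g_eq P \<equiv> presentation_eq (group_rels P)"

lemma group_cong_iff:
  "(u, v) \<in> group_cong P \<longleftrightarrow> u \<in> group_words (fst P) \<and> v \<in> group_words (fst P) \<and> g_eq P u v"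
  by (auto simp: group_cong_def word_cong_def group_rels_def)

lemma g_eq_cancel_pair: "i < fst P \<Longrightarrow> g_eq P [(i, b), (i, \<not> b)] []"
  by (rule presentation_eq_base) (auto simp: group_rels_def)

lemma g_eq_relator: "r \<in> set (snd P) \<Longrightarrow> g_eq P r []"
  by (rule presentation_eq_base) (auto simp: group_rels_def)

lemma group_words_append [simp]: "u @ v \<in> group_words k \<longleftrightarrow> u \<in> group_words k \<and> v \<in> group_words k"
  by (auto simp: group_words_def)

lemma group_words_Nil [simp]: "[] \<in> group_words k" by (simp add: group_words_def)

lemma group_words_Cons [simp]: "(i, b) # w \<in> group_words k \<longleftrightarrow> i < k \<and> w \<in> group_words k"
  by (auto simp: group_words_def)

lemma word_inv_words [simp]: "w \<in> group_words k \<Longrightarrow> word_inv w \<in> group_words k"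
  by (auto simp: group_words_def word_inv_def)

lemma word_inv_right: "w \<in> group_words (fst P) \<Longrightarrow> g_eq P (w @ word_inv w) []"
proof (induction w)
  case (Cons x w)
  obtain i b where x: "x = (i, b)" by (cases x)
  have "g_eq P ([x] @ (w @ word_inv w) @ [(i, \<not> b)]) ([x] @ [] @ [(i, \<not> b)])"
    using Cons x by (intro presentation_eq_append) simp
  also have "g_eq P \<dots> []" using g_eq_cancel_pair[of i P b] Cons.prems x by simp
  finally show ?case by (simp add: word_inv_def x)
qed (simp add: word_inv_def presentation_eq.refl)

lemma word_inv_inv [simp]: "word_inv (word_inv w) = w"
  by (auto simp: word_inv_def rev_map[symmetric] o_def case_prod_beta intro!: map_idI)

lemma word_inv_left: "w \<in> group_words (fst P) \<Longrightarrow> g_eq P (word_inv w @ w) []"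
  using word_inv_right[of "word_inv w" P] by simp

lemma g_eq_cancelL:
  assumes w: "w \<in> group_words (fst P)" and eq: "g_eq P (w @ u) (w @ v)"
  shows "g_eq P u v"
proof -
  have *: "g_eq P (word_inv w @ w @ u) u" for u
    using presentation_eq_appendR[OF word_inv_left[OF w], of u] by simp
  have "g_eq P u (word_inv w @ w @ u)" using * presentation_eq.sym by blast
  also have "g_eq P \<dots> (word_inv w @ w @ v)" using eq by (rule presentation_eq_appendL)
  also have "g_eq P \<dots> v" by (rule *)
  finally show ?thesis .
qed

lemma g_eq_iff_quotient:
  assumes w: "w \<in> group_words (fst P)"
  shows "g_eq P u w \<longleftrightarrow> g_eq P (u @ word_inv w) []"
proof
  assume "g_eq P u w"
  then have "g_eq P (u @ word_inv w) (w @ word_inv w)" by (rule presentation_eq_appendR)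
  also have "g_eq P \<dots> []" by (rule word_inv_right[OF w])
  finally show "g_eq P (u @ word_inv w) []" .
next
  assume 1: "g_eq P (u @ word_inv w) []"
  have "g_eq P u (u @ word_inv w @ w)"
    using presentation_eq_appendL[OF word_inv_left[OF w], of u] presentation_eq.sym by simp
  also have "g_eq P \<dots> w" using presentation_eq_appendR[OF 1, of w] by simp
  finally show "g_eq P u w" .
qed

lemma gen_less: "a < n \<Longrightarrow> f < n \<Longrightarrow> a * n + f < n * (n::nat)"
  by (metis add.commute add_less_cancel_left less_le_trans mult_Suc mult_le_mono1 Suc_leI)

section \<open>The action on L-classes as a finite automaton\<close>

locale nat_biord = biord S m p for S :: "nat set" and m (infixl "\<cdot>" 70) and p :: "nat pop" +
  fixes n :: nat
  assumes E_eq: "idempotents S m = {..<n}"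
begin

abbreviation "d \<equiv> lact n p"
abbreviation "rep \<equiv> lrep n p"
abbreviation "pw \<equiv> path_word n p"

lemma E_iff: "x \<in> E \<longleftrightarrow> x < n" by (simp add: E_eq)

lemma fin: "finite E" by (simp add: E_eq)

lemma rep_L: "a < n \<Longrightarrow> Lr p a (rep a)" and rep_less: "a < n \<Longrightarrow> rep a < n"
proof -
  assume "a < n"
  then have "a \<in> set (filter (Lr p a) [0..<n])" using Lr_refl E_iff by simp
  then have "rep a \<in> set (filter (Lr p a) [0..<n])"
    unfolding lrep_def by (metis hd_append2 hd_in_set list.set_cases list.discI)
  then show "Lr p a (rep a)" "rep a < n" by auto
qed

lemma rep_cong: "Lr p a b \<Longrightarrow> rep a = rep b"
proof -
  assume "Lr p a b"
  then have "Lr p a = Lr p b" using Lr_trans Lr_sym by blast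
  then show ?thesis by (simp add: lrep_def)
qed

lemma rep_eq_iff: "a < n \<Longrightarrow> b < n \<Longrightarrow> rep a = rep b \<longleftrightarrow> Lr p a b"
  using rep_cong rep_L Lr_trans Lr_sym by metis

lemma rep_rep: "a < n \<Longrightarrow> rep (rep a) = rep a"
  using rep_cong rep_L by metis

lemma d_cases:
  obtains g where "stp p a f g" "d a f = rep g" "d a f < n"
  | "\<nexists>g. stp p a f g" "d a f = n"
proof (cases "filter (\<lambda>k. Lr p a k \<and> p f k = Some k) [0..<n]")
  case Nil
  then have "d a f = n" by (simp add: lact_def)
  moreover have "\<nexists>g. stp p a f g"
  proof
    assume "\<exists>g. stp p a f g"
    then obtain k where "Lr p a k" "p f k = Some k" unfolding stp_def by blast
    moreover then have "k < n" by (simp add: Lr_iff E_iff)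
    ultimately have "k \<in> set (filter (\<lambda>k. Lr p a k \<and> p f k = Some k) [0..<n])" by simp
    then show False using Nil by simp
  qed
  ultimately show ?thesis using that by blast
next
  case (Cons k ks)
  then have "k \<in> set (filter (\<lambda>k. Lr p a k \<and> p f k = Some k) [0..<n])" by simp
  then have k: "Lr p a k" "p f k = Some k" by auto
  \<comment> \<open>\<open>f \<cdot> k = k\<close> makes the pair (k, f) basic as well, so this
    product is defined.\<close>
  then have "p k f = Some (k \<cdot> f)" using p_iff[of f k k] p_iff[of k f "k \<cdot> f"] by metis
  then have "stp p a f (k \<cdot> f)" using k unfolding stp_def by blast
  moreover have "d a f = rep (k \<cdot> f)" using \<open>p k f = _\<close> by (simp add: lact_def Cons)
  moreover then have "d a f < n" using rep_less calculation(1) stp_E E_iff by simp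
  ultimately show ?thesis using that by blast
qed

lemma d_stp: "stp p a f g \<Longrightarrow> d a f = rep g"
  using d_cases[of a f] stp_det rep_cong by metis

lemma d_dead: "foldl d n w = n"
proof (induction w)
  case (Cons f w)
  have "\<nexists>g. stp p n f g" using E_iff by (auto elim: stpE)
  then have "d n f = n" by (cases rule: d_cases[of n f]) auto
  then show ?case using Cons by simp
qed simp

lemma run_reach: "reach p a w g \<Longrightarrow> foldl d (rep a) w = rep g \<and> rep g < n"
proof (induction w arbitrary: a)
  case Nil then show ?case using rep_cong rep_less by (auto simp: Lr_iff E_iff)
next
  case (Cons f w)
  then obtain h where h: "stp p a f h" "reach p h w g" by auto
  have "a < n" using h(1) E_iff by (auto elim: stpE)
  then have "stp p (rep a) f h" using stp_L rep_L h(1) by blast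
  then show ?case using d_stp Cons.IH[OF h(2)] by simp
qed

lemma run_less: "a < n \<Longrightarrow> foldl d (rep a) w < n \<Longrightarrow> \<exists>g. reach p a w g"
proof (induction w arbitrary: a)
  case Nil then show ?case using Lr_refl E_iff by (intro exI[of _ a]) simp
next
  case (Cons f w)
  show ?case
  proof (cases rule: d_cases[of "rep a" f])
    case (1 g)
    then have g: "stp p a f g" using stp_L Lr_sym rep_L Cons.prems by blast
    then have "g < n" using stp_E E_iff by blast
    then show ?thesis using Cons.IH[of g] Cons.prems 1 g by auto
  next
    case 2 then show ?thesis using Cons.prems d_dead by simp
  qed
qed

lemma run_less_iff: "a < n \<Longrightarrow> foldl d (rep a) w < n \<longleftrightarrow> live p a w"
  unfolding live_def using run_less run_reach by metis

lemma run_le: "a < n \<Longrightarrow> foldl d (rep a) w \<le> n"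
proof (induction w rule: rev_induct)
  case Nil then show ?case using less_imp_le[OF rep_less] by simp
next
  case (snoc f w) then show ?case by (cases rule: d_cases[of "foldl d (rep a) w" f]) auto
qed

lemma run_eq_iff: "a < n \<Longrightarrow> g < n \<Longrightarrow> foldl d (rep a) w = rep g \<longleftrightarrow> reach p a w g"
proof
  assume a: "a < n" "g < n" and eq: "foldl d (rep a) w = rep g"
  then obtain h where h: "reach p a w h" using run_less rep_less by metis
  then have "rep h = rep g" using run_reach eq by simp
  then show "reach p a w g" using rep_eq_iff a h reach_L2 reach_E E_iff by blast
qed (use run_reach in auto)

lemma run_rel:
  assumes "ig_eq p u v" "a < n" shows "foldl d (rep a) u = foldl d (rep a) v"
proof (cases "live p a u")
  case True
  then obtain g where "reach p a u g" unfolding live_def by blast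
  moreover then have "reach p a v g" using reach_rel[OF assms(1)] by blast
  ultimately show ?thesis using run_reach by metis
next
  case False
  then have "\<not> live p a v" using live_rel[OF assms(1)] by blast
  then show ?thesis using False run_less_iff run_le assms(2) by (metis le_neq_implies_less)
qed

end

text \<open>Generators are numbered by all pairs of a number below \<open>n\<close> and a letter,
  whether or not the pair is an edge; the first family of relators removes the non-edges. The chosen
  paths are arbitrary, without prefix closure. Killing them as whole words is correct because the
  loops assigned to the edges of \<open>t a\<close> telescope to \<open>t a\<close> followed by its
  return, where the empty path at the root enters.\<close>

locale pi1 = nat_biord +
  fixes e :: nat and t :: "nat \<Rightarrow> nat list" and P :: group_presentation
  assumes e: "e < n"
    and t_root: "t (rep e) = []"
    and t_path: "\<And>w. foldl d (rep e) w < n \<Longrightarrow> foldl d (rep e) (t (foldl d (rep e) w)) = foldl d (rep e) w"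
    and gens: "fst P = n * n"
    and rels: "set (snd P) =
      {[(a * n + f, True)] | a f. a < n \<and> f < n \<and> \<not> ((\<exists>w. foldl d (rep e) w = a) \<and> d a f < n)} \<union>
      {[(a * n + f, True), (d a f * n + g, True), (a * n + k, False)] | a f g k.
         a < n \<and> (\<exists>w. foldl d (rep e) w = a) \<and> p f g = Some k \<and> d a k < n} \<union>
      {pw (rep e) (t a) | a. a < n \<and> (\<exists>w. foldl d (rep e) w = a)}"
begin

section \<open>Path words and the edge-path group\<close>

abbreviation "v0 \<equiv> rep e"
definition "reachable a \<longleftrightarrow> a < n \<and> (\<exists>w. foldl d v0 w = a)"

lemma reachable_root: "reachable v0"
  unfolding reachable_def using rep_less[OF e] by (auto intro: exI[of _ "[]"])

lemma reachable_rep: "reachable a \<Longrightarrow> rep a = a"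
proof -
  assume "reachable a"
  then obtain w where w: "a < n" "foldl d v0 w = a" unfolding reachable_def by blast
  then obtain g where g: "reach p e w g" using run_less e by metis
  then have "a = rep g" "g < n" using run_reach w reach_E E_iff by auto
  then show ?thesis using rep_rep by simp
qed

lemma reachable_run: "reachable a \<Longrightarrow> foldl d a w < n \<Longrightarrow> reachable (foldl d a w)"
  unfolding reachable_def by (metis foldl_append)

lemma reachable_step: "reachable a \<Longrightarrow> d a f < n \<Longrightarrow> reachable (d a f)"
  using reachable_run[of a "[f]"] by simp

lemma run_prefix: "foldl d a (u @ v) < n \<Longrightarrow> reachable a \<Longrightarrow> foldl d a u < n"
proof -
  assume 1: "foldl d a (u @ v) < n" and "reachable a"
  then have "a < n" "rep a = a" using reachable_rep reachable_def by auto
  then have "foldl d a u \<le> n" using run_le[of a u] by simp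
  then show ?thesis using 1 d_dead by (cases "foldl d a u = n") auto
qed

lemma t_run: "reachable a \<Longrightarrow> foldl d v0 (t a) = a"
  using t_path unfolding reachable_def by blast

lemma run_E: "foldl d v0 w < n \<Longrightarrow> set w \<subseteq> E"
  using run_less[OF e] reach_E by blast

lemma d_E: "reachable a \<Longrightarrow> d a f < n \<Longrightarrow> f < n"
proof -
  assume "reachable a" "d a f < n"
  then have "foldl d v0 (t a @ [f]) < n" using t_run by simp
  then show "f < n" using run_E E_iff by fastforce
qed

lemma pw_words: "reachable a \<Longrightarrow> foldl d a w < n \<Longrightarrow> pw a w \<in> group_words (fst P)"
proof (induction w arbitrary: a)
  case (Cons f w)
  then have "d a f < n" using run_prefix[of a "[f]" w] by simp
  then show ?case using Cons d_E[of a f] reachable_step gen_less unfolding gens by (simp add: reachable_def)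
qed simp

lemma g_eq_tree: "reachable a \<Longrightarrow> g_eq P (pw v0 (t a)) []"
  by (rule g_eq_relator) (auto simp: rels reachable_def)

lemma g_eq_tri:
  assumes "reachable a" "p f g = Some k" "d a k < n"
  shows "g_eq P [(a * n + f, True), (d a f * n + g, True)] [(a * n + k, True)]"
proof -
  have k: "k < n" using d_E assms by blast
  have "[(a * n + f, True), (d a f * n + g, True), (a * n + k, False)] \<in> set (snd P)"
    unfolding rels using assms unfolding reachable_def by blast
  then have 1: "g_eq P [(a * n + f, True), (d a f * n + g, True), (a * n + k, False)] []"
    by (rule g_eq_relator)
  have w: "[(a * n + k, True)] \<in> group_words (fst P)"
    using gen_less[of a n k] k assms(1) by (simp add: gens reachable_def)
  show ?thesis using 1 by (subst g_eq_iff_quotient[OF w]) (simp add: word_inv_def)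
qed

text \<open>Each application of a basic pair along a live path starts at a reachable vertex, where
  it is the boundary of a 2-cell.\<close>

lemma pw_rel:
  "ig_eq p u v \<Longrightarrow> reachable a \<Longrightarrow> foldl d a u < n \<Longrightarrow> g_eq P (pw a u) (pw a v)"
proof (induction rule: presentation_eq.induct)
  case (rel u v x y)
  then obtain f g k where k: "u = [f, g]" "v = [k]" "p f g = Some k" unfolding IG_rels_def by blast
  define b where "b = foldl d a x"
  have b: "reachable b" using run_prefix[OF rel(3) rel(2)] reachable_run rel(2) by (simp add: b_def)
  have uv: "foldl d b u = foldl d b v"
    using run_rel[OF presentation_eq_base, of u v b] reachable_rep[OF b] rel(1) b by (simp add: reachable_def)
  have "foldl d b (u @ y) < n" using rel(3) by (simp add: b_def)
  then have "foldl d b u < n" using run_prefix b by blast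
  then have "g_eq P (pw b u) (pw b v)" using g_eq_tri[OF b k(3)] uv by (simp add: k)
  then have "g_eq P (pw a x @ pw b u @ pw (foldl d b u) y) (pw a x @ pw b v @ pw (foldl d b v) y)"
    unfolding uv by (rule presentation_eq_append)
  then show ?case by (simp add: path_word_append b_def)
next
  case (sym u v)
  then have "foldl d a u = foldl d a v" using run_rel[of u v a] reachable_rep by (simp add: reachable_def)
  then show ?case using sym presentation_eq.sym by metis
next
  case (trans u v w)
  then have "foldl d a u = foldl d a v" using run_rel[of u v a] reachable_rep by (simp add: reachable_def)
  then show ?case using trans presentation_eq.trans by metis
qed (rule presentation_eq.refl)

text \<open>Green's lemma in words: e u and e v are L-related to the same letter \<open>g\<close>,
  so left multiplication by \<open>e # v @ q\<close> carries e u x to e v x for every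
  \<open>x\<close>.\<close>

lemma ig_transfer:
  assumes uv: "foldl d v0 u = foldl d v0 v" "foldl d v0 u < n" and eq: "ig_eq p (e # u @ x) (e # u @ y)"
  shows "ig_eq p (e # v @ x) (e # v @ y)"
proof -
  obtain g where g: "reach p e u g" using run_less uv e by blast
  then have "reach p e v g" using run_reach run_eq_iff uv e reach_E E_iff by metis
  then obtain z where z: "ig_eq p (e # v @ [g]) (e # v)" using ig_reach by blast
  obtain q where q: "ig_eq p (q @ e # u) [g]" using ig_reach[OF g] by blast
  have *: "ig_eq p (e # v @ x) ((e # v @ q) @ e # u @ x)" for x
  proof -
    have "ig_eq p ((e # v) @ x) ((e # v @ [g]) @ x)"
      using z presentation_eq.sym presentation_eq_appendR by blast
    also have "ig_eq p \<dots> ((e # v) @ (q @ e # u) @ x)"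
      using presentation_eq_append[OF presentation_eq.sym[OF q], of "e # v" x] by simp
    finally show ?thesis by simp
  qed
  have "ig_eq p (e # v @ x) ((e # v @ q) @ e # u @ x)" by (rule *)
  also have "ig_eq p \<dots> ((e # v @ q) @ e # u @ y)" using eq by (rule presentation_eq_appendL)
  also have "ig_eq p \<dots> (e # v @ y)" using * presentation_eq.sym by blast
  finally show ?thesis .
qed

section \<open>Return paths and the loops of generators\<close>

lemma ex_return: "foldl d v0 w < n \<Longrightarrow> \<exists>x. set x \<subseteq> E \<and> ig_eq p (e # w @ x) [e]"
  using run_less[OF e] ig_reach by blast

text \<open>This choice is not effective and stays inside the proof; the relators are computed from
  the paths \<open>t\<close> alone.\<close>

definition "ret w = (SOME x. set x \<subseteq> E \<and> ig_eq p (e # w @ x) [e])"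

lemma ret: "foldl d v0 w < n \<Longrightarrow> set (ret w) \<subseteq> E" "foldl d v0 w < n \<Longrightarrow> ig_eq p (e # w @ ret w) [e]"
  using someI_ex[OF ex_return] unfolding ret_def by blast+

lemma d_root: "d v0 e = v0"
proof -
  have "reach p e [e] e" using Lr_refl[of e] stpI[of e e e] e E_iff by auto
  then show ?thesis using run_reach by fastforce
qed

lemma ret_run: "foldl d v0 w < n \<Longrightarrow> foldl d v0 (w @ ret w) = v0"
  using run_rel[OF ret(2) e] d_root by simp

text \<open>A generator is sent to the loop that goes along the tree to its source, through its edge, and back.\<close>

definition loop_of :: "nat \<times> bool \<Rightarrow> nat list" where
  "loop_of = (\<lambda>(i, b). let a = i div n; f = i mod n in
     if reachable a \<and> d a f < n
     then (if b then t a @ f # ret (t (d a f)) else t (d a f) @ ret (t a @ [f])) else [])"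

definition loops :: "group_word \<Rightarrow> nat list" where
  "loops W = concat (map loop_of W)"

lemma loops_simps [simp]: "loops [] = []" "loops (x # W) = loop_of x @ loops W" "loops (U @ W) = loops U @ loops W"
  by (simp_all add: loops_def)

lemma loop_of_gen: "reachable a \<Longrightarrow> d a f < n \<Longrightarrow> loop_of (a * n + f, True) = t a @ f # ret (t (d a f))"
  "reachable a \<Longrightarrow> d a f < n \<Longrightarrow> loop_of (a * n + f, False) = t (d a f) @ ret (t a @ [f])"
  using d_E[of a f] by (auto simp: loop_of_def)

lemma loop_of_run: "foldl d v0 (loop_of l) = v0"
proof -
  obtain i b where l: "l = (i, b)" by (cases l)
  define a f where "a = i div n" and "f = i mod n"
  show ?thesis
  proof (cases "reachable a \<and> d a f < n")
    case True
    then have c: "reachable (d a f)" using reachable_step by blast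
    have "foldl d v0 (t (d a f) @ ret (t (d a f))) = v0"
      by (rule ret_run) (use t_run[OF c] True in simp)
    then have 1: "foldl d (d a f) (ret (t (d a f))) = v0" using t_run[OF c] by simp
    have "foldl d v0 ((t a @ [f]) @ ret (t a @ [f])) = v0"
      using ret_run[of "t a @ [f]"] True t_run by simp
    then have "foldl d (d a f) (ret (t a @ [f])) = v0" using t_run True by simp
    then show ?thesis using 1 True t_run[OF c] t_run[of a]
      by (auto simp: loop_of_def l a_def[symmetric] f_def[symmetric] Let_def)
  qed (auto simp: loop_of_def l a_def f_def)
qed

lemma loops_run: "foldl d v0 (loops W) = v0"
  by (induction W) (auto simp: loop_of_run)

lemma loops_E: "set (loops W) \<subseteq> E"
  using run_E loops_run rep_less[OF e] by simp

lemma ig_context: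
  assumes w: "foldl d v0 w = a" "reachable a" and eq: "ig_eq p (e # t a @ x) (e # t a @ y)"
  shows "ig_eq p (e # w @ x) (e # w @ y)"
  by (rule ig_transfer[OF _ _ eq]) (use w t_run in \<open>auto simp: reachable_def\<close>)

text \<open>A return followed by the way out to the same vertex cancels directly after
  \<open>t a\<close>; \<open>ig_context\<close> carries this over to every path ending at that
  vertex.\<close>

lemma ig_turn:
  assumes w: "foldl d v0 w = a" "reachable a"
  shows "ig_eq p (e # w @ ret (t a) @ t a @ x) (e # w @ x)"
proof (rule ig_context[OF w])
  have "ig_eq p ((e # t a @ ret (t a)) @ t a @ x) ([e] @ t a @ x)"
    using ret(2)[of "t a"] t_run[OF w(2)] w(2) by (intro presentation_eq_appendR) (simp add: reachable_def)
  then show "ig_eq p (e # t a @ ret (t a) @ t a @ x) (e # t a @ x)" by simp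
qed

text \<open>The loops of successive edges telescope: each return to the root is followed by the
  chosen path out to the same vertex.\<close>

lemma loops_path:
  "foldl d v0 w < n \<Longrightarrow> ig_eq p (e # loops (pw v0 w)) (e # w @ ret (t (foldl d v0 w)))"
proof (induction w rule: rev_induct)
  case Nil
  then show ?case using ret(2)[of "[]"] t_root presentation_eq.sym by fastforce
next
  case (snoc f w)
  define a where "a = foldl d v0 w"
  have an: "a < n" using run_prefix[OF snoc.prems reachable_root] by (simp add: a_def)
  then have a: "reachable a" unfolding reachable_def a_def by blast
  have df: "d a f < n" using snoc.prems by (simp add: a_def)
  have "ig_eq p ((e # loops (pw v0 w)) @ t a @ f # ret (t (d a f)))
     ((e # w @ ret (t a)) @ t a @ f # ret (t (d a f)))"
    using snoc.IH an unfolding a_def[symmetric] by (intro presentation_eq_appendR)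
  also have "ig_eq p \<dots> (e # w @ f # ret (t (d a f)))" using ig_turn[OF a_def[symmetric] a] by simp
  finally show ?case by (simp add: path_word_append a_def[symmetric] loop_of_gen[OF a df])
qed

text \<open>A non-edge has the empty loop by the default in \<open>loop_of\<close>. The loops of a
  2-cell telescope until the basic pair can be contracted, and those of a chosen path telescope to
  the path and its return.\<close>

lemma loops_relator:
  assumes "r \<in> set (snd P)" shows "ig_eq p (e # loops r) [e]"
proof -
  from assms consider
    (1) a f where "r = [(a * n + f, True)]" "f < n" "\<not> (reachable a \<and> d a f < n)"
    | (2) a f g k where "r = [(a * n + f, True), (d a f * n + g, True), (a * n + k, False)]"
        "reachable a" "p f g = Some k" "d a k < n"
    | (3) a where "r = pw v0 (t a)" "reachable a"
    unfolding rels reachable_def by blast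
  then show ?thesis
  proof cases
    case 1
    then show ?thesis by (auto simp: loop_of_def presentation_eq.refl)
  next
    case (2 a f g k)
    have fgk: "ig_eq p [f, g] [k]" using ig_eq_pair[of p f g k "[]" "[]"] 2 by simp
    have dd: "d (d a f) g = d a k"
      using run_rel[OF fgk, of a] 2 reachable_rep by (simp add: reachable_def)
    have df: "d a f < n" using run_prefix[of a "[f]" "[g]"] 2 dd by simp
    define b c where "b = d a f" and "c = d a k"
    have b: "reachable b" and c: "reachable c" using reachable_step 2 df by (auto simp: b_def c_def)
    have tb: "foldl d v0 (t a @ [f]) = b" using t_run 2 b_def by simp
    have tc: "foldl d v0 (t a @ [f, g]) = c" using t_run 2 c_def dd by simp
    have "ig_eq p (e # loops r) (e # (t a @ [f]) @ ret (t b) @ t b @ g # ret (t c) @ t c @ ret (t a @ [k]))"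
      using 2 df dd b c by (simp add: loop_of_gen b_def c_def presentation_eq.refl)
    also have "ig_eq p \<dots> (e # (t a @ [f]) @ g # ret (t c) @ t c @ ret (t a @ [k]))"
      by (rule ig_turn[OF tb b])
    also have "\<dots> = e # (t a @ [f, g]) @ ret (t c) @ t c @ ret (t a @ [k])" by simp
    also have "ig_eq p \<dots> (e # (t a @ [f, g]) @ ret (t a @ [k]))"
      by (rule ig_turn[OF tc c])
    also have "ig_eq p \<dots> (e # (t a @ [k]) @ ret (t a @ [k]))"
      using presentation_eq_append[OF fgk, of "e # t a" "ret (t a @ [k])"] by simp
    also have "ig_eq p \<dots> [e]" using ret(2)[of "t a @ [k]"] 2 t_run by simp
    finally show ?thesis .
  next
    case (3 a)
    have "ig_eq p (e # loops r) (e # t a @ ret (t a))"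
      using loops_path[of "t a"] 3 t_run by (simp add: reachable_def)
    also have "ig_eq p \<dots> [e]" using ret(2)[of "t a"] 3 t_run by (simp add: reachable_def)
    finally show ?thesis .
  qed
qed

lemma loops_inverse_pair: "ig_eq p (e # loops [(i, b), (i, \<not> b)]) [e]"
proof -
  define a f where "a = i div n" and "f = i mod n"
  show ?thesis
  proof (cases "reachable a \<and> d a f < n")
    case True
    define c where "c = d a f"
    have i: "i = a * n + f" by (simp add: a_def f_def)
    have c: "reachable c" using reachable_step True c_def by blast
    have tf: "foldl d v0 (t a @ [f]) = c" using True t_run c_def by simp
    have rf: "ig_eq p (e # (t a @ [f]) @ ret (t a @ [f])) [e]"
      using ret(2)[of "t a @ [f]"] tf c by (simp add: reachable_def)
    show ?thesis
    proof (cases b)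
      case True
      have "ig_eq p (e # (t a @ [f]) @ ret (t c) @ t c @ ret (t a @ [f])) (e # (t a @ [f]) @ ret (t a @ [f]))"
        by (rule ig_turn[OF tf c])
      also have "ig_eq p \<dots> [e]" by (rule rf)
      finally show ?thesis using True \<open>reachable a \<and> d a f < n\<close> by (simp add: i loop_of_gen c_def)
    next
      case False
      \<comment> \<open>With the inverse letter first, the cancellation is visible only after the
        path t a f; it is then transferred to \<open>t c\<close>, which ends at the same
        vertex.\<close>
      have "ig_eq p ((e # (t a @ [f]) @ ret (t a @ [f])) @ t a @ f # ret (t c)) ([e] @ t a @ f # ret (t c))"
        by (rule presentation_eq_appendR[OF rf])
      then have 1: "ig_eq p (e # (t a @ [f]) @ ret (t a @ [f]) @ t a @ f # ret (t c)) (e # (t a @ [f]) @ ret (t c))"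
        by simp
      have "ig_eq p (e # t c @ ret (t a @ [f]) @ t a @ f # ret (t c)) (e # t c @ ret (t c))"
        by (rule ig_transfer[OF _ _ 1]) (use tf t_run[OF c] c in \<open>auto simp: reachable_def\<close>)
      also have "ig_eq p \<dots> [e]" using ret(2)[of "t c"] t_run[OF c] c by (simp add: reachable_def)
      finally show ?thesis using False \<open>reachable a \<and> d a f < n\<close> by (simp add: i loop_of_gen c_def)
    qed
  qed (auto simp: loop_of_def a_def f_def presentation_eq.refl)
qed

lemma loops_rel: "g_eq P U W \<Longrightarrow> ig_eq p (e # loops U) (e # loops W)"
proof (induction rule: presentation_eq.induct)
  case (rel u v x y)
  then have v: "v = []" and u: "ig_eq p (e # loops u) [e]"
    using loops_inverse_pair loops_relator unfolding group_rels_def by auto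
  have "ig_eq p (e # [] @ loops u) (e # [] @ [])" using u by simp
  then have "ig_eq p (e # loops x @ loops u) (e # loops x @ [])"
    by (rule ig_transfer[rotated 2]) (use loops_run rep_less[OF e] in auto)
  then have "ig_eq p ((e # loops x @ loops u) @ loops y) ((e # loops x @ []) @ loops y)"
    by (rule presentation_eq_appendR)
  then show ?case by (simp add: v)
qed (auto intro: presentation_eq.intros)

text \<open>The path words of both sides of e w x = e start with the generator of the loop edge from
  \<open>v0\<close> with letter \<open>e\<close>. Cancelling it in the group leaves a relation
  between \<open>w\<close> and \<open>x\<close>.\<close>

lemma pw_return:
  assumes "foldl d v0 w = a" "reachable a" "ig_eq p (e # w @ x) [e]" "g_eq P (pw v0 w) W"
  shows "g_eq P (W @ pw a x) []"
proof -
  have fe: "foldl d v0 (e # w @ x) = v0" using run_rel[OF assms(3) e] d_root by simp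
  have "g_eq P (pw v0 (e # w @ x)) (pw v0 [e])"
    by (rule pw_rel[OF assms(3) reachable_root]) (use fe rep_less[OF e] in simp)
  then have "g_eq P ([(v0 * n + e, True)] @ pw v0 w @ pw a x) ([(v0 * n + e, True)] @ [])"
    using assms(1) by (simp add: d_root path_word_append)
  then have 1: "g_eq P (pw v0 w @ pw a x) []"
    by (rule g_eq_cancelL[rotated]) (use gen_less rep_less e in \<open>simp add: gens\<close>)
  have "g_eq P (W @ pw a x) (pw v0 w @ pw a x)"
    using assms(4) presentation_eq.sym presentation_eq_appendR by blast
  also have "g_eq P \<dots> []" by (rule 1)
  finally show ?thesis .
qed

text \<open>Modulo the killed paths, whose returns are trivial by \<open>pw_return\<close>, only the
  edge remains. For the inverse letter the return of t a f is the inverse of the edge by the same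
  lemma. Generators of non-edges are trivial on both sides.\<close>

lemma pw_loop_of:
  assumes "i < n * n" shows "g_eq P (pw v0 (loop_of (i, b))) [(i, b)]"
proof -
  define a f where "a = i div n" and "f = i mod n"
  have i: "i = a * n + f" by (simp add: a_def f_def)
  have n0: "n > 0" using e by simp
  have af: "a < n" "f < n" using assms n0 by (auto simp: a_def f_def less_mult_imp_div_less)
  have pair: "g_eq P [(i, True), (i, False)] []" using g_eq_cancel_pair[of i P True] assms gens by simp
  show ?thesis
  proof (cases "reachable a \<and> d a f < n")
    case False
    then have T: "g_eq P [(i, True)] []"
      by (intro g_eq_relator) (use af in \<open>auto simp: rels reachable_def i\<close>)
    have "g_eq P ([(i, True)] @ [(i, False)]) ([] @ [(i, False)])" by (rule presentation_eq_appendR[OF T])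
    then have "g_eq P [(i, False)] []" using pair presentation_eq.sym presentation_eq.trans
      by (metis append_Cons append_Nil)
    then have "g_eq P [(i, b)] []" using T by (cases b) auto
    moreover have "loop_of (i, b) = []" using False by (auto simp: loop_of_def a_def f_def)
    ultimately show ?thesis using presentation_eq.sym by fastforce
  next
    case True
    define c where "c = d a f"
    have c: "reachable c" using reachable_step True c_def by blast
    have ta: "g_eq P (pw v0 (t a)) []" using g_eq_tree True by blast
    have tf: "foldl d v0 (t a @ [f]) = c" using True t_run c_def by simp
    show ?thesis
    proof (cases b)
      case bT: True
      have r: "g_eq P ([] @ pw c (ret (t c))) []"
        by (rule pw_return[OF t_run[OF c] c _ g_eq_tree[OF c]])
          (use ret(2)[of "t c"] t_run[OF c] c in \<open>simp add: reachable_def\<close>)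
      have "g_eq P (pw v0 (t a) @ [(i, True)] @ pw c (ret (t c))) ([] @ [(i, True)] @ [])"
        using presentation_eq_append2[OF ta presentation_eq_appendL[OF r, of "[(i, True)]"]] by simp
      then show ?thesis using True bT t_run[of a]
        by (simp add: i loop_of_gen c_def path_word_append)
    next
      case bF: False
      have "g_eq P (pw v0 (t a @ [f])) ([] @ [(i, True)])"
        using presentation_eq_appendR[OF ta, of "[(i, True)]"] True t_run[of a]
        by (simp add: path_word_append i)
      then have "g_eq P (([] @ [(i, True)]) @ pw c (ret (t a @ [f]))) []"
        by (rule pw_return[OF tf c, rotated])
          (use ret(2)[of "t a @ [f]"] tf c in \<open>simp add: reachable_def\<close>)
      then have "g_eq P ([(i, True)] @ pw c (ret (t a @ [f]))) ([(i, True)] @ [(i, False)])"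
        using pair presentation_eq.sym presentation_eq.trans by (metis append_Cons append_Nil)
      then have "g_eq P (pw c (ret (t a @ [f]))) [(i, False)]"
        by (rule g_eq_cancelL[rotated]) (use assms gens in simp)
      then have "g_eq P (pw v0 (t c) @ pw c (ret (t a @ [f]))) ([] @ [(i, False)])"
        by (rule presentation_eq_append2[OF g_eq_tree[OF c]])
      then show ?thesis using True bF t_run[OF c]
        by (simp add: i loop_of_gen c_def path_word_append)
    qed
  qed
qed

lemma pw_loops: "W \<in> group_words (fst P) \<Longrightarrow> g_eq P (pw v0 (loops W)) W"
proof (induction W)
  case (Cons x W)
  obtain i b where x: "x = (i, b)" by (cases x)
  have "g_eq P (pw v0 (loop_of x) @ pw v0 (loops W)) ([x] @ W)"
    using Cons x gens pw_loop_of by (intro presentation_eq_append2) auto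
  then show ?case by (simp add: path_word_append loop_of_run)
qed (simp add: presentation_eq.refl)

lemma loops_inj:
  assumes "U \<in> group_words (fst P)" "W \<in> group_words (fst P)" "ig_eq p (e # loops U) (e # loops W)"
  shows "g_eq P U W"
proof -
  have run: "foldl d v0 (e # loops U) < n" using d_root loops_run rep_less[OF e] by simp
  have "g_eq P ([(v0 * n + e, True)] @ pw v0 (loops U)) ([(v0 * n + e, True)] @ pw v0 (loops W))"
    using pw_rel[OF assms(3) reachable_root run] d_root by simp
  then have "g_eq P (pw v0 (loops U)) (pw v0 (loops W))"
    by (rule g_eq_cancelL[rotated]) (use gen_less rep_less e in \<open>simp add: gens\<close>)
  then show ?thesis using pw_loops assms(1,2) presentation_eq.sym presentation_eq.trans by meson
qed

lemma ig_loop_e: "reach p e w e \<Longrightarrow> ig_eq p (e # w @ [e]) (e # w)"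
  using ig_reach by blast

lemma loops_path_loop:
  assumes "reach p e w e" shows "ig_eq p (e # loops (pw v0 w)) (e # w)"
proof -
  have v: "foldl d v0 w = v0" "v0 < n" using run_reach[OF assms] by auto
  have "ig_eq p (e # loops (pw v0 w)) (e # w @ ret [])" using loops_path[of w] v t_root by simp
  also have "ig_eq p \<dots> ((e # w @ [e]) @ ret [])"
    using presentation_eq_appendR[OF presentation_eq.sym[OF ig_loop_e[OF assms]], of "ret []"] by simp
  also have "ig_eq p \<dots> ((e # w) @ [e])"
    using presentation_eq_appendL[OF ret(2)[of "[]"], of "e # w"] v by simp
  also have "ig_eq p \<dots> (e # w)" using ig_loop_e[OF assms] by simp
  finally show ?thesis .
qed

text \<open>Equality of path words is compared on loops: both paths are closed by the same return
  from their common end, and the chosen path after that return restores the words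
  themselves.\<close>

lemma heads_eq_iff:
  assumes "heads p e u" "heads p e v" "foldl d v0 u = foldl d v0 v"
  shows "ig_eq p u v \<longleftrightarrow> g_eq P (pw v0 u) (pw v0 v)"
proof
  have live: "foldl d v0 u < n" using heads_props(3)[OF assms(1)] run_less_iff e by blast
  assume "ig_eq p u v"
  then show "g_eq P (pw v0 u) (pw v0 v)" using pw_rel reachable_root live by blast
next
  assume eq: "g_eq P (pw v0 u) (pw v0 v)"
  define a where "a = foldl d v0 u"
  have live: "a < n" using heads_props(3)[OF assms(1)] run_less_iff e by (simp add: a_def)
  then have a: "reachable a" unfolding reachable_def a_def by blast
  have "ig_eq p (e # u @ ret (t a)) (e # loops (pw v0 u))"
    using loops_path[of u] live presentation_eq.sym by (simp add: a_def)
  also have "ig_eq p \<dots> (e # loops (pw v0 v))" by (rule loops_rel[OF eq])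
  also have "ig_eq p \<dots> (e # v @ ret (t a))"
    using loops_path[of v] live assms(3) by (simp add: a_def)
  finally have "ig_eq p ((e # u @ ret (t a)) @ t a) ((e # v @ ret (t a)) @ t a)" by (rule presentation_eq_appendR)
  then have 1: "ig_eq p (e # u @ ret (t a) @ t a) (e # v @ ret (t a) @ t a)" by simp
  have turn: "ig_eq p (e # w @ ret (t a) @ t a) (e # w)" if "foldl d v0 w = a" for w
    using ig_turn[OF that a, of "[]"] by simp
  have "ig_eq p u (e # u)" using heads_props(2)[OF assms(1)] presentation_eq.sym by blast
  also have "ig_eq p \<dots> (e # u @ ret (t a) @ t a)" using turn[of u] presentation_eq.sym by (simp add: a_def)
  also have "ig_eq p \<dots> (e # v @ ret (t a) @ t a)" by (rule 1)
  also have "ig_eq p \<dots> (e # v)" using turn[of v] assms(3) by (simp add: a_def)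
  also have "ig_eq p \<dots> v" by (rule heads_props(2)[OF assms(2)])
  finally show "ig_eq p u v" .
qed

end

section \<open>From words to congruence classes\<close>

lemma word_cong_equiv: "equiv W (word_cong W R)"
  by (rule equivI) (auto simp: word_cong_def refl_on_def sym_def trans_def intro: presentation_eq.intros)

lemma word_cong_class_eq_iff:
  "u \<in> W \<Longrightarrow> v \<in> W \<Longrightarrow> word_cong W R `` {u} = word_cong W R `` {v} \<longleftrightarrow> presentation_eq R u v"
  using eq_equiv_class_iff[OF word_cong_equiv] by (fastforce simp: word_cong_def)

lemma word_cong_class_mult:
  assumes "u \<in> W" "v \<in> W" and cl: "\<And>x y. x \<in> W \<Longrightarrow> y \<in> W \<Longrightarrow> x @ y \<in> W"
  shows "class_mult (word_cong W R) (word_cong W R `` {u}) (word_cong W R `` {v}) = word_cong W R `` {u @ v}"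
proof -
  have "x \<in> class_mult (word_cong W R) (word_cong W R `` {u}) (word_cong W R `` {v}) \<longleftrightarrow>
      x \<in> word_cong W R `` {u @ v}" for x
  proof
    assume "x \<in> class_mult (word_cong W R) (word_cong W R `` {u}) (word_cong W R `` {v})"
    then obtain u' v' where "x \<in> W" "presentation_eq R u u'" "presentation_eq R v v'" "presentation_eq R (u' @ v') x"
      unfolding class_mult_def word_cong_def by auto
    then show "x \<in> word_cong W R `` {u @ v}"
      using presentation_eq_append2[of R u u' v v'] presentation_eq.trans[of R "u @ v" "u' @ v'" x] assms
      by (simp add: word_cong_def)
  next
    assume "x \<in> word_cong W R `` {u @ v}"
    moreover have "u \<in> word_cong W R `` {u}" "v \<in> word_cong W R `` {v}"
      using assms(1,2) presentation_eq.refl by (simp_all add: word_cong_def)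
    ultimately show "x \<in> class_mult (word_cong W R) (word_cong W R `` {u}) (word_cong W R `` {v})"
      unfolding class_mult_def by blast
  qed
  then show ?thesis by blast
qed

context biord
begin

abbreviation "IGW \<equiv> lists E - {[]}"

lemma IG_cong_eq: "IG_cong E p = word_cong IGW (IG_rels p)"
  by (simp add: IG_cong_def IG_rels_def)

lemma IG_class_eq_iff: "u \<in> IGW \<Longrightarrow> v \<in> IGW \<Longrightarrow> IG_class E p u = IG_class E p v \<longleftrightarrow> ig_eq p u v"
  unfolding IG_class_def IG_cong_eq by (rule word_cong_class_eq_iff)

lemma IG_mult_class: "u \<in> IGW \<Longrightarrow> v \<in> IGW \<Longrightarrow> IG_mult E p (IG_class E p u) (IG_class E p v) = IG_class E p (u @ v)"
  unfolding IG_class_def IG_cong_eq by (rule word_cong_class_mult) auto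

lemma IG_carrier_eq: "IG_carrier E p = IG_class E p ` IGW"
  by (auto simp: IG_carrier_def IG_class_def quotient_def)

lemma bex_IG_carrier: "(\<exists>A\<in>IG_carrier E p. Q A) \<longleftrightarrow> (\<exists>u\<in>IGW. Q (IG_class E p u))"
  unfolding IG_carrier_eq by blast

lemma represents_regular_iff:
  assumes fin: "finite E" and u: "u \<in> lists E"
  shows "represents_regular E p u \<longleftrightarrow> seeded p u"
proof (cases "u = []")
  case False
  then have uW: "u \<in> IGW" using u by simp
  have "represents_regular E p u \<longleftrightarrow> (\<exists>v\<in>IGW. ig_eq p (u @ v @ u) u)"
    unfolding represents_regular_def regular_in_def bex_IG_carrier
    using False uW by (auto simp: IG_mult_class IG_class_eq_iff)
  also have "\<dots> \<longleftrightarrow> seeded p u"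
  proof
    assume "\<exists>v\<in>IGW. ig_eq p (u @ v @ u) u"
    then show "seeded p u" using regular_seeded[OF fin] u False by blast
  next
    assume "seeded p u"
    moreover have "set u \<subseteq> E" using u by auto
    ultimately obtain v where "v \<noteq> []" "set v \<subseteq> E" "ig_eq p (u @ v @ u) u"
      using seeded_regular by blast
    then show "\<exists>v\<in>IGW. ig_eq p (u @ v @ u) u" by (intro bexI[of _ v]) auto
  qed
  finally show ?thesis .
qed (simp add: represents_regular_def seeded_ne)

section \<open>Green's relation H in the free semigroup\<close>

lemma right_ideal_class:
  assumes "x \<in> IGW" "y \<in> IGW"
  shows "IG_class E p x \<in> right_ideal (IG_carrier E p) (IG_mult E p) (IG_class E p y) \<longleftrightarrow>
    (\<exists>a\<in>lists E. ig_eq p (y @ a) x)"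
proof -
  have "IG_class E p x \<in> right_ideal (IG_carrier E p) (IG_mult E p) (IG_class E p y) \<longleftrightarrow>
     ig_eq p x y \<or> (\<exists>a\<in>IGW. IG_class E p x = IG_mult E p (IG_class E p y) (IG_class E p a))"
    unfolding right_ideal_def IG_carrier_eq using assms by (auto simp: IG_class_eq_iff)
  also have "\<dots> \<longleftrightarrow> ig_eq p x y \<or> (\<exists>a\<in>IGW. ig_eq p x (y @ a))"
    using assms by (auto simp: IG_mult_class IG_class_eq_iff)
  also have "\<dots> \<longleftrightarrow> (\<exists>a\<in>lists E. ig_eq p x (y @ a))"
    using assms by (metis Diff_iff append_Nil2 insert_iff lists.Nil empty_iff)
  finally show ?thesis using presentation_eq.sym by blast
qed

lemma left_ideal_class:
  assumes "x \<in> IGW" "y \<in> IGW"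
  shows "IG_class E p x \<in> left_ideal (IG_carrier E p) (IG_mult E p) (IG_class E p y) \<longleftrightarrow>
    (\<exists>a\<in>lists E. ig_eq p (a @ y) x)"
proof -
  have "IG_class E p x \<in> left_ideal (IG_carrier E p) (IG_mult E p) (IG_class E p y) \<longleftrightarrow>
     ig_eq p x y \<or> (\<exists>a\<in>IGW. IG_class E p x = IG_mult E p (IG_class E p a) (IG_class E p y))"
    unfolding left_ideal_def IG_carrier_eq using assms by (auto simp: IG_class_eq_iff)
  also have "\<dots> \<longleftrightarrow> ig_eq p x y \<or> (\<exists>a\<in>IGW. ig_eq p x (a @ y))"
    using assms by (auto simp: IG_mult_class IG_class_eq_iff)
  also have "\<dots> \<longleftrightarrow> (\<exists>a\<in>lists E. ig_eq p x (a @ y))"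
    using assms by (metis Diff_iff append_Nil insert_iff lists.Nil empty_iff)
  finally show ?thesis using presentation_eq.sym by blast
qed

lemma right_ideal_elem:
  assumes "x \<in> IGW" "A \<in> right_ideal (IG_carrier E p) (IG_mult E p) (IG_class E p x)"
  shows "\<exists>z\<in>IGW. A = IG_class E p z"
proof -
  consider "A = IG_class E p x" | b where "b \<in> IGW" "A = IG_mult E p (IG_class E p x) (IG_class E p b)"
    using assms(2) unfolding right_ideal_def IG_carrier_eq by blast
  then show ?thesis
  proof cases
    case 2
    then show ?thesis using IG_mult_class[OF assms(1), of b] assms(1) by (intro bexI[of _ "x @ b"]) auto
  qed (use assms in blast)
qed

lemma left_ideal_elem:
  assumes "x \<in> IGW" "A \<in> left_ideal (IG_carrier E p) (IG_mult E p) (IG_class E p x)"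
  shows "\<exists>z\<in>IGW. A = IG_class E p z"
proof -
  consider "A = IG_class E p x" | b where "b \<in> IGW" "A = IG_mult E p (IG_class E p b) (IG_class E p x)"
    using assms(2) unfolding left_ideal_def IG_carrier_eq by blast
  then show ?thesis
  proof cases
    case 2
    then show ?thesis using IG_mult_class[OF _ assms(1), of b] assms(1) by (intro bexI[of _ "b @ x"]) auto
  qed (use assms in blast)
qed

lemma right_ideal_sub:
  assumes "x \<in> IGW" "y \<in> IGW" "a \<in> lists E" "ig_eq p (y @ a) x"
  shows "right_ideal (IG_carrier E p) (IG_mult E p) (IG_class E p x) \<subseteq>
    right_ideal (IG_carrier E p) (IG_mult E p) (IG_class E p y)"
proof
  fix A assume A: "A \<in> right_ideal (IG_carrier E p) (IG_mult E p) (IG_class E p x)"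
  then obtain z where z: "A = IG_class E p z" "z \<in> IGW"
    using right_ideal_elem[OF assms(1)] by blast
  then obtain b where b: "b \<in> lists E" "ig_eq p (x @ b) z" using A right_ideal_class assms(1) by blast
  have "ig_eq p (y @ a @ b) z"
    using presentation_eq_appendR[OF assms(4), of b] b(2) presentation_eq.trans by fastforce
  then show "A \<in> right_ideal (IG_carrier E p) (IG_mult E p) (IG_class E p y)"
    unfolding z(1) right_ideal_class[OF z(2) assms(2)] using b assms(3) by (intro bexI[of _ "a @ b"]) auto
qed

lemma left_ideal_sub:
  assumes "x \<in> IGW" "y \<in> IGW" "a \<in> lists E" "ig_eq p (a @ y) x"
  shows "left_ideal (IG_carrier E p) (IG_mult E p) (IG_class E p x) \<subseteq>
    left_ideal (IG_carrier E p) (IG_mult E p) (IG_class E p y)"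
proof
  fix A assume A: "A \<in> left_ideal (IG_carrier E p) (IG_mult E p) (IG_class E p x)"
  then obtain z where z: "A = IG_class E p z" "z \<in> IGW"
    using left_ideal_elem[OF assms(1)] by blast
  then obtain b where b: "b \<in> lists E" "ig_eq p (b @ x) z" using A left_ideal_class assms(1) by blast
  have "ig_eq p ((b @ a) @ y) z"
    using presentation_eq_appendL[OF assms(4), of b] b(2) presentation_eq.trans by fastforce
  then show "A \<in> left_ideal (IG_carrier E p) (IG_mult E p) (IG_class E p y)"
    unfolding z(1) left_ideal_class[OF z(2) assms(2)] using b assms(3) by (intro bexI[of _ "b @ a"]) auto
qed

lemma H_class_iff:
  assumes "x \<in> IGW" "y \<in> IGW"
  shows "IG_class E p x \<in> H_class (IG_carrier E p) (IG_mult E p) (IG_class E p y) \<longleftrightarrow>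
    (\<exists>a\<in>lists E. ig_eq p (y @ a) x) \<and> (\<exists>a\<in>lists E. ig_eq p (x @ a) y) \<and>
    (\<exists>a\<in>lists E. ig_eq p (a @ y) x) \<and> (\<exists>a\<in>lists E. ig_eq p (a @ x) y)" (is "?L = ?R")
proof
  have self: "IG_class E p z \<in> right_ideal (IG_carrier E p) (IG_mult E p) (IG_class E p z)"
    "IG_class E p z \<in> left_ideal (IG_carrier E p) (IG_mult E p) (IG_class E p z)" for z
    by (auto simp: right_ideal_def left_ideal_def)
  assume ?L
  then show ?R unfolding H_class_def
    using self right_ideal_class[OF assms] right_ideal_class[OF assms(2,1)]
      left_ideal_class[OF assms] left_ideal_class[OF assms(2,1)] by blast
next
  assume R: ?R
  have "IG_class E p x \<in> IG_carrier E p" unfolding IG_carrier_eq using assms by blast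
  moreover obtain a b c d where "a \<in> lists E" "ig_eq p (y @ a) x" "b \<in> lists E" "ig_eq p (x @ b) y"
    "c \<in> lists E" "ig_eq p (c @ y) x" "d \<in> lists E" "ig_eq p (d @ x) y" using R by blast
  then have "right_ideal (IG_carrier E p) (IG_mult E p) (IG_class E p x) = right_ideal (IG_carrier E p) (IG_mult E p) (IG_class E p y)"
    "left_ideal (IG_carrier E p) (IG_mult E p) (IG_class E p x) = left_ideal (IG_carrier E p) (IG_mult E p) (IG_class E p y)"
    using right_ideal_sub[OF assms] right_ideal_sub[OF assms(2,1)]
      left_ideal_sub[OF assms] left_ideal_sub[OF assms(2,1)] by (intro subset_antisym; simp)+
  ultimately show ?L unfolding H_class_def by simp
qed

end

context pi1
begin

section \<open>The isomorphism onto the maximal subgroup\<close>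

lemma loops_IGW: "e # loops W \<in> IGW"
  using loops_E e E_iff by auto

lemma loops_reach: "reach p e (loops W) e"
  using loops_run run_eq_iff[OF e e] by blast

lemma IG_e: "[e] \<in> IGW" using e E_iff by simp

lemma loops_H: "IG_class E p (e # loops W) \<in> H_class (IG_carrier E p) (IG_mult E p) (IG_class E p [e])"
proof -
  obtain x y where xy: "set x \<subseteq> E" "set y \<subseteq> E" "ig_eq p (e # loops W @ x) [e]"
    "ig_eq p (y @ e # loops W) [e]" "ig_eq p (e # loops W @ [e]) (e # loops W)"
    using ig_reach[OF loops_reach] by blast
  have "loops W \<in> lists E" "e # loops W \<in> lists E" using loops_IGW by auto
  moreover have "x \<in> lists E" "y \<in> lists E" using xy by auto
  ultimately have "\<exists>a\<in>lists E. ig_eq p ([e] @ a) (e # loops W)" "\<exists>a\<in>lists E. ig_eq p ((e # loops W) @ a) [e]"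
    "\<exists>a\<in>lists E. ig_eq p (a @ [e]) (e # loops W)" "\<exists>a\<in>lists E. ig_eq p (a @ e # loops W) [e]"
    using xy presentation_eq.refl[of "IG_rels p" "e # loops W"]
      bexI[of "\<lambda>a. ig_eq p ([e] @ a) (e # loops W)" "loops W"] bexI[of "\<lambda>a. ig_eq p ((e # loops W) @ a) [e]" x]
      bexI[of "\<lambda>a. ig_eq p (a @ [e]) (e # loops W)" "e # loops W"] bexI[of "\<lambda>a. ig_eq p (a @ e # loops W) [e]" y]
    by auto
  then show ?thesis unfolding H_class_iff[OF loops_IGW IG_e] by blast
qed

text \<open>An element of the group has the form e w with e w e = e w and some left multiple equal
  to e. By \<open>reach_loop_if_L\<close> the word \<open>w\<close> returns to the class of
  \<open>e\<close>, and its path word is a preimage.\<close>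

lemma H_loops:
  assumes "A \<in> H_class (IG_carrier E p) (IG_mult E p) (IG_class E p [e])"
  shows "\<exists>W\<in>group_words (fst P). A = IG_class E p (e # loops W)"
proof -
  obtain x where x: "x \<in> IGW" "A = IG_class E p x"
    using assms unfolding H_class_def IG_carrier_eq by blast
  obtain w a b c where H: "w \<in> lists E" "ig_eq p ([e] @ w) x" "ig_eq p (x @ a) [e]"
    "ig_eq p (b @ [e]) x" "ig_eq p (c @ x) [e]"
    using assms unfolding x(2) H_class_iff[OF x(1) IG_e] by blast
  have "p e e = Some e" using e E_iff by (simp add: p_iff)
  then have ee: "ig_eq p [e, e] [e]" using ig_eq_pair[of p e e e "[]" "[]"] by simp
  have "ig_eq p ((e # w) @ [e]) (x @ [e])" using H(2) presentation_eq_appendR by fastforce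
  also have "ig_eq p \<dots> ((b @ [e]) @ [e])" using H(4) presentation_eq.sym presentation_eq_appendR by blast
  also have "ig_eq p \<dots> (b @ [e])" using presentation_eq_appendL[OF ee, of b] by simp
  also have "ig_eq p \<dots> x" by (rule H(4))
  also have "ig_eq p x (e # w)" using H(2) presentation_eq.sym by simp
  finally have ewe: "ig_eq p (e # w @ [e]) (e # w)" by simp
  have ce: "ig_eq p (c @ e # w) [e]"
    using presentation_eq_appendL[OF H(2), of c] H(5) presentation_eq.trans by fastforce
  have "ig_eq p (e # w @ a) [e]"
    using presentation_eq_appendR[OF H(2), of a] H(3) presentation_eq.trans by fastforce
  from run_rel[OF this e] have "foldl d v0 (e # w @ a) = v0" by (simp add: d_root)
  then have "foldl d v0 (w @ a) < n" using d_root rep_less[OF e] by simp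
  then have "foldl d v0 w < n" using run_prefix reachable_root by blast
  then obtain g where "reach p e w g" using run_less e by blast
  then have r: "reach p e w e" using reach_loop_if_L ce ewe by blast
  have "e # w \<in> IGW" using H(1) e E_iff by simp
  then have "A = IG_class E p (e # w)" using x IG_class_eq_iff H(2) presentation_eq.sym by simp
  also have "\<dots> = IG_class E p (e # loops (pw v0 w))"
    using IG_class_eq_iff[OF \<open>e # w \<in> IGW\<close> loops_IGW] loops_path_loop[OF r] presentation_eq.sym by blast
  finally have "A = IG_class E p (e # loops (pw v0 w))" .
  moreover have "pw v0 w \<in> group_words (fst P)"
    using pw_words[OF reachable_root] \<open>foldl d v0 w < n\<close> by blast
  ultimately show ?thesis by blast
qed

abbreviation "gcls W \<equiv> group_cong P `` {W}"

lemma group_cong_eq: "group_cong P = word_cong (group_words (fst P)) (group_rels P)"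
  by (simp add: group_cong_def group_rels_def)

lemma gcls_eq_iff: "U \<in> group_words (fst P) \<Longrightarrow> W \<in> group_words (fst P) \<Longrightarrow> gcls U = gcls W \<longleftrightarrow> g_eq P U W"
  unfolding group_cong_eq by (rule word_cong_class_eq_iff)

lemma presented_group_iso: "presented_group P \<cong> IG_max_subgroup E p e"
proof -
  let ?G = "group_words (fst P)"
  define h where "h A = IG_class E p (e # loops (SOME W. W \<in> ?G \<and> gcls W = A))" for A
  have h: "h (gcls W) = IG_class E p (e # loops W)" if W: "W \<in> ?G" for W
  proof -
    define U where "U = (SOME U. U \<in> ?G \<and> gcls U = gcls W)"
    have "U \<in> ?G \<and> gcls U = gcls W" unfolding U_def by (rule someI[of _ W]) (simp add: W)
    then have "g_eq P U W" using gcls_eq_iff W by blast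
    then show ?thesis unfolding h_def U_def[symmetric] IG_class_eq_iff[OF loops_IGW loops_IGW] by (rule loops_rel)
  qed
  have carr: "carrier (presented_group P) = gcls ` ?G"
    by (auto simp: presented_group_def quotient_def)
  have mult: "gcls U \<otimes>\<^bsub>presented_group P\<^esub> gcls W = gcls (U @ W)" if "U \<in> ?G" "W \<in> ?G" for U W
    unfolding presented_group_def group_cong_eq using word_cong_class_mult[OF that] by simp
  have "h \<in> iso (presented_group P) (IG_max_subgroup E p e)"
  proof (rule isoI)
    show "h \<in> hom (presented_group P) (IG_max_subgroup E p e)"
    proof (rule homI)
      fix A assume "A \<in> carrier (presented_group P)"
      then show "h A \<in> carrier (IG_max_subgroup E p e)"
        unfolding carr using h loops_H by (auto simp: IG_max_subgroup_def)
    next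
      fix A B assume "A \<in> carrier (presented_group P)" "B \<in> carrier (presented_group P)"
      then obtain U W where UW: "U \<in> ?G" "A = gcls U" "W \<in> ?G" "B = gcls W" unfolding carr by blast
      \<comment> \<open>The inner \<open>e\<close> is absorbed because \<open>loops U\<close> ends
        in the L-class of \<open>e\<close>.\<close>
      have "ig_eq p ((e # loops U) @ e # loops W) ((e # loops U) @ loops W)"
        using presentation_eq_appendR[OF ig_loop_e[OF loops_reach], of U "loops W"] by simp
      then have "IG_class E p (e # loops (U @ W)) = IG_class E p ((e # loops U) @ e # loops W)"
        using loops_IGW[of U] loops_IGW[of W]
        by (subst IG_class_eq_iff) (auto intro: presentation_eq.sym)
      also have "\<dots> = IG_mult E p (IG_class E p (e # loops U)) (IG_class E p (e # loops W))"
        using IG_mult_class[OF loops_IGW loops_IGW] by metis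
      finally show "h (A \<otimes>\<^bsub>presented_group P\<^esub> B) = h A \<otimes>\<^bsub>IG_max_subgroup E p e\<^esub> h B"
        using UW mult h by (simp add: IG_max_subgroup_def)
    qed
    show "bij_betw h (carrier (presented_group P)) (carrier (IG_max_subgroup E p e))"
      unfolding bij_betw_def
    proof
      show "inj_on h (carrier (presented_group P))"
      proof (rule inj_onI)
        fix A B assume "A \<in> carrier (presented_group P)" "B \<in> carrier (presented_group P)" and eq: "h A = h B"
        then obtain U W where UW: "U \<in> ?G" "A = gcls U" "W \<in> ?G" "B = gcls W" unfolding carr by blast
        then have "ig_eq p (e # loops U) (e # loops W)" using eq h IG_class_eq_iff[OF loops_IGW loops_IGW] by metis
        then show "A = B" using UW loops_inj gcls_eq_iff by blast
      qed
      show "h ` carrier (presented_group P) = carrier (IG_max_subgroup E p e)"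
      proof -
        have "h ` gcls ` ?G = (\<lambda>W. IG_class E p (e # loops W)) ` ?G"
          unfolding image_image using h by (intro image_cong) auto
        also have "\<dots> = H_class (IG_carrier E p) (IG_mult E p) (IG_class E p [e])"
          using loops_H H_loops by blast
        finally show ?thesis unfolding carr by (simp add: IG_max_subgroup_def)
      qed
    qed
  qed
  then show ?thesis unfolding is_iso_def by blast
qed

end

section \<open>Computable functions\<close>

lemma rec_eval_Comp1: "rec_eval g xs a \<Longrightarrow> rec_eval f [a] z \<Longrightarrow> rec_eval (Comp f [g]) xs z"
  by (rule rec_eval.comp[of _ _ "[a]"]) auto

lemma rec_eval_Comp2:
  "rec_eval g xs a \<Longrightarrow> rec_eval h xs b \<Longrightarrow> rec_eval f [a, b] z \<Longrightarrow> rec_eval (Comp f [g, h]) xs z"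
  by (rule rec_eval.comp[of _ _ "[a, b]"]) auto

lemma rec_eval_Proj: "i < length xs \<Longrightarrow> y = xs ! i \<Longrightarrow> rec_eval (Proj i) xs y"
  using rec_eval.proj by simp

lemma rec_eval_Prec:
  assumes "rec_eval g xs (F 0)" "\<And>n. n < k \<Longrightarrow> rec_eval h (n # F n # xs) (F (Suc n))"
  shows "rec_eval (Prec g h) (k # xs) (F k)"
  using assms
proof (induction k)
  case 0 then show ?case by (auto intro: rec_eval.prec_0)
next
  case (Suc k) then show ?case by (auto intro: rec_eval.prec_Suc)
qed

section \<open>Arithmetic and the pairing function\<close>

fun const_rec :: "nat \<Rightarrow> recf" where
  "const_rec 0 = Zero"
| "const_rec (Suc n) = Comp Succ [const_rec n]"

lemma const_rec: "rec_eval (const_rec n) xs n"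
  by (induction n) (auto intro: rec_eval.zero rec_eval_Comp1 rec_eval.succ)

definition "add_rec = Prec (Proj 0) (Comp Succ [Proj 1])"
definition "pred_rec = Prec Zero (Proj 0)"
text \<open>\<open>Prec\<close> recurses on the first argument, so this program subtracts its first
  argument from its second.\<close>

definition "monus_rec = Prec (Proj 0) (Comp pred_rec [Proj 1])"
definition "mult_rec = Prec Zero (Comp add_rec [Proj 1, Proj 2])"
definition "triangle_rec = Prec Zero (Comp add_rec [Proj 1, Comp Succ [Proj 0]])"
definition "pair_rec = Comp add_rec [Comp triangle_rec [add_rec], Proj 0]"
text \<open>The code of (a, b) is triangle (a + b) + a. The search stops at the least s for which
  triangle (s + 1) exceeds the code, and this is a + b.\<close>

definition "psum_rec = Mu (Comp monus_rec [Comp triangle_rec [Comp Succ [Proj 0]], Comp Succ [Proj 1]])"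
definition "fst_rec = Comp monus_rec [Comp triangle_rec [psum_rec], Proj 0]"
definition "snd_rec = Comp monus_rec [fst_rec, psum_rec]"

lemma add_rec: "rec_eval add_rec [a, b] (a + b)"
  unfolding add_rec_def
  by (rule rec_eval_Prec[where F = "\<lambda>n. n + b"])
    (auto intro!: rec_eval_Proj rec_eval_Comp1 rec_eval.succ)

lemma pred_rec: "rec_eval pred_rec [a] (a - 1)"
  unfolding pred_rec_def
  by (rule rec_eval_Prec[where F = "\<lambda>n. n - 1"]) (auto intro!: rec_eval_Proj rec_eval.zero)

lemma monus_rec: "rec_eval monus_rec [a, b] (b - a)"
  unfolding monus_rec_def
proof (rule rec_eval_Prec[where F = "\<lambda>n. b - n"])
  fix n
  have "rec_eval (Comp pred_rec [Proj 1]) [n, b - n, b] (b - n - 1)"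
    by (rule rec_eval_Comp1[OF rec_eval_Proj pred_rec]) auto
  then show "rec_eval (Comp pred_rec [Proj 1]) [n, b - n, b] (b - Suc n)" by simp
qed (auto intro!: rec_eval_Proj)

lemma mult_rec: "rec_eval mult_rec [a, b] (a * b)"
  unfolding mult_rec_def
proof (rule rec_eval_Prec[where F = "\<lambda>n. n * b"])
  fix n
  have "rec_eval (Comp add_rec [Proj 1, Proj 2]) [n, n * b, b] (n * b + b)"
    by (rule rec_eval_Comp2[OF rec_eval_Proj rec_eval_Proj add_rec]) auto
  then show "rec_eval (Comp add_rec [Proj 1, Proj 2]) [n, n * b, b] (Suc n * b)" by (simp add: add.commute)
qed (auto intro!: rec_eval.zero)

lemma triangle_rec: "rec_eval triangle_rec [a] (triangle a)"
  unfolding triangle_rec_def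
proof (rule rec_eval_Prec[where F = triangle])
  fix n
  have "rec_eval (Comp add_rec [Proj 1, Comp Succ [Proj 0]]) [n, triangle n] (triangle n + Suc n)"
    by (rule rec_eval_Comp2[OF rec_eval_Proj rec_eval_Comp1[OF rec_eval_Proj rec_eval.succ] add_rec]) auto
  then show "rec_eval (Comp add_rec [Proj 1, Comp Succ [Proj 0]]) [n, triangle n] (triangle (Suc n))" by simp
qed (auto intro!: rec_eval.zero)

lemma pair_rec: "rec_eval pair_rec [a, b] (prod_encode (a, b))"
  unfolding pair_rec_def prod_encode_def prod.case
  by (rule rec_eval_Comp2[OF rec_eval_Comp1[OF add_rec triangle_rec] rec_eval_Proj add_rec]) auto

lemma triangle_mono: "a \<le> b \<Longrightarrow> triangle a \<le> triangle b"
  by (induction b) (auto simp: le_Suc_eq)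

lemma psum_rec: "rec_eval psum_rec [prod_encode (a, b)] (a + b)"
  unfolding psum_rec_def
proof (rule rec_eval.mu)
  let ?z = "prod_encode (a, b)"
  let ?f = "Comp monus_rec [Comp triangle_rec [Comp Succ [Proj 0]], Comp Succ [Proj 1]]"
  have *: "rec_eval ?f [s, ?z] (Suc ?z - triangle (Suc s))" for s
    by (rule rec_eval_Comp2[OF rec_eval_Comp1[OF rec_eval_Comp1[OF rec_eval_Proj rec_eval.succ] triangle_rec]
      rec_eval_Comp1[OF rec_eval_Proj rec_eval.succ] monus_rec]) auto
  show "rec_eval ?f [a + b, ?z] 0"
    using *[of "a + b"] by (simp add: prod_encode_def)
  show "\<forall>k<a + b. \<exists>y>0. rec_eval ?f [k, ?z] y"
  proof (intro allI impI)
    fix k assume "k < a + b"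
    then have "triangle (Suc k) \<le> triangle (a + b)" by (intro triangle_mono) simp
    then have "Suc ?z - triangle (Suc k) > 0" by (simp add: prod_encode_def)
    then show "\<exists>y>0. rec_eval ?f [k, ?z] y" using * by blast
  qed
qed

lemma fst_rec: "rec_eval fst_rec [prod_encode (a, b)] a"
proof -
  have "rec_eval fst_rec [prod_encode (a, b)] (prod_encode (a, b) - triangle (a + b))"
    unfolding fst_rec_def
    by (rule rec_eval_Comp2[OF rec_eval_Comp1[OF psum_rec triangle_rec] rec_eval_Proj monus_rec]) auto
  then show ?thesis by (simp add: prod_encode_def)
qed

lemma snd_rec: "rec_eval snd_rec [prod_encode (a, b)] b"
proof -
  have "rec_eval snd_rec [prod_encode (a, b)] (a + b - a)"
    unfolding snd_rec_def by (rule rec_eval_Comp2[OF fst_rec psum_rec monus_rec])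
  then show ?thesis by simp
qed

text \<open>The second branch of the conditional is evaluated only if the condition, a truth value, is 1;
  it may diverge otherwise.\<close>

definition if_rec :: "recf \<Rightarrow> recf \<Rightarrow> recf \<Rightarrow> recf" where
  "if_rec c f g = Comp (Prec g (Comp f [Proj 2])) [c, Proj 0]"

lemma if_rec:
  assumes "rec_eval c [x] (of_bool b)" "b \<Longrightarrow> rec_eval f [x] y" "rec_eval g [x] z"
  shows "rec_eval (if_rec c f g) [x] (if b then y else z)"
  unfolding if_rec_def
proof (rule rec_eval_Comp2[OF assms(1) rec_eval_Proj])
  show "rec_eval (Prec g (Comp f [Proj 2])) [of_bool b, x] (if b then y else z)"
  proof (cases b)
    case True
    have "rec_eval (Comp f [Proj 2]) [0, z, x] y"
      by (rule rec_eval_Comp1[OF rec_eval_Proj assms(2)]) (simp_all add: True)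
    then show ?thesis using rec_eval.prec_Suc[OF rec_eval.prec_0[OF assms(3)]] True by simp
  qed (simp add: assms(3) rec_eval.prec_0)
qed auto

section \<open>Computability of functions between coded types\<close>

class enc = fixes enc :: "'a \<Rightarrow> nat"

instantiation nat :: enc begin
definition enc_nat :: "nat \<Rightarrow> nat" where "enc_nat n = n"
instance ..
end

instantiation bool :: enc begin
definition enc_bool :: "bool \<Rightarrow> nat" where "enc_bool b = of_bool b"
instance ..
end

instantiation prod :: (enc, enc) enc begin
definition enc_prod :: "'a \<times> 'b \<Rightarrow> nat" where "enc_prod x = prod_encode (enc (fst x), enc (snd x))"
instance ..
end

instantiation list :: (enc) enc begin
definition enc_list :: "'a list \<Rightarrow> nat" where "enc_list xs = list_encode (map enc xs)"
instance ..
end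

text \<open>A program acts on the code of one argument, the environment of all variables, packed
  into nested pairs. Rules for binders pair the bound variables onto the environment, which explains
  the projections in their premises.\<close>

definition computable :: "('a::enc \<Rightarrow> 'b::enc) \<Rightarrow> bool" where
  "computable f \<longleftrightarrow> (\<exists>r. \<forall>x. rec_eval r [enc x] (enc (f x)))"

named_theorems computable_intros

lemma computableI: "(\<And>x. rec_eval r [enc x] (enc (f x))) \<Longrightarrow> computable f"
  unfolding computable_def by blast

lemma computableE:
  assumes "computable f" obtains r where "\<And>x. rec_eval r [enc x] (enc (f x))"
  using assms unfolding computable_def by blast

lemma computable_id [computable_intros]: "computable (\<lambda>x. x)"
  by (rule computableI[of "Proj 0"]) (auto intro: rec_eval_Proj)

lemma computable_const [computable_intros]: "computable (\<lambda>x. c)"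
  by (rule computableI[of "const_rec (enc c)"]) (rule const_rec)

lemma computable_comp: "computable g \<Longrightarrow> computable f \<Longrightarrow> computable (\<lambda>x. g (f x))"
  by (elim computableE, rule computableI) (rule rec_eval_Comp1, assumption+)

lemma computable_Pair [computable_intros]:
  assumes "computable f" "computable g" shows "computable (\<lambda>x. (f x, g x))"
proof -
  obtain r s where "\<And>x. rec_eval r [enc x] (enc (f x))" "\<And>x. rec_eval s [enc x] (enc (g x))"
    using assms by (elim computableE) blast
  then show ?thesis
    by (intro computableI[of "Comp pair_rec [r, s]"]) (auto simp: enc_prod_def intro: rec_eval_Comp2 pair_rec)
qed

lemma computable_fst [computable_intros]: "computable f \<Longrightarrow> computable (\<lambda>x. fst (f x))"
  by (rule computable_comp, rule computableI[of fst_rec]) (auto simp: enc_prod_def fst_rec)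

lemma computable_snd [computable_intros]: "computable f \<Longrightarrow> computable (\<lambda>x. snd (f x))"
  by (rule computable_comp, rule computableI[of snd_rec]) (auto simp: enc_prod_def snd_rec)

lemma computable_2:
  assumes "computable (\<lambda>p. F (fst p) (snd p))" "computable f" "computable g"
  shows "computable (\<lambda>x. F (f x) (g x))"
  using computable_comp[OF assms(1) computable_Pair[OF assms(2,3)]] by simp

lemma computable_nat2:
  assumes "\<And>a b. rec_eval r [a, b] (F a b)" "computable f" "computable g"
  shows "computable (\<lambda>x. F (f x) (g x :: nat) :: nat)"
proof -
  obtain s t where "\<And>x. rec_eval s [enc x] (f x)" "\<And>x. rec_eval t [enc x] (g x)"
    using assms(2,3) unfolding computable_def enc_nat_def by blast
  then show ?thesis
    by (intro computableI[of "Comp r [s, t]"]) (auto simp: enc_nat_def intro: rec_eval_Comp2 assms(1))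
qed

lemma computable_plus [computable_intros]: "computable f \<Longrightarrow> computable g \<Longrightarrow> computable (\<lambda>x. f x + g x :: nat)"
  by (rule computable_nat2[OF add_rec])

lemma computable_times [computable_intros]: "computable f \<Longrightarrow> computable g \<Longrightarrow> computable (\<lambda>x. f x * g x :: nat)"
  by (rule computable_nat2[OF mult_rec])

lemma computable_minus [computable_intros]: "computable f \<Longrightarrow> computable g \<Longrightarrow> computable (\<lambda>x. f x - g x :: nat)"
  by (rule computable_nat2[OF monus_rec, of g f])

lemma computable_Suc [computable_intros]: "computable f \<Longrightarrow> computable (\<lambda>x. Suc (f x))"
  using computable_plus[OF _ computable_const[of 1], of f] by simp

lemma computable_if [computable_intros]:
  assumes "computable b" "computable f" "computable g" shows "computable (\<lambda>x. if b x then f x else g x)"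
proof -
  obtain c r s where c: "\<And>x. rec_eval c [enc x] (enc (b x))" and r: "\<And>x. rec_eval r [enc x] (enc (f x))"
    and s: "\<And>x. rec_eval s [enc x] (enc (g x))"
    using assms by (elim computableE) blast
  have "rec_eval (if_rec c r s) [enc x] (if b x then enc (f x) else enc (g x))" for x
    by (rule if_rec) (use c r s in \<open>auto simp: enc_bool_def\<close>)
  then show ?thesis by (intro computableI[of "if_rec c r s"]) (metis (full_types))
qed

lemma computable_le [computable_intros]:
  assumes "computable f" "computable g" shows "computable (\<lambda>x. f x \<le> (g x :: nat))"
proof -
  have "computable (\<lambda>x. 1 - (f x - g x))" by (intro computable_intros assms)
  then obtain r where r: "\<And>x. rec_eval r [enc x] (enc (1 - (f x - g x)))" by (elim computableE) blast
  have "enc (f x \<le> g x) = enc (1 - (f x - g x))" for x by (auto simp: enc_bool_def enc_nat_def)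
  then show ?thesis using r by (intro computableI[of r]) simp
qed

lemma computable_less [computable_intros]:
  "computable f \<Longrightarrow> computable g \<Longrightarrow> computable (\<lambda>x. f x < (g x :: nat))"
  using computable_le[OF computable_Suc, of f g] by (simp add: Suc_le_eq)

lemma computable_conj [computable_intros]:
  "computable b \<Longrightarrow> computable c \<Longrightarrow> computable (\<lambda>x. b x \<and> c x)"
proof -
  assume "computable b" "computable c"
  then have "computable (\<lambda>x. if b x then c x else False)" by (intro computable_if computable_const)
  moreover have "(\<lambda>x. if b x then c x else False) = (\<lambda>x. b x \<and> c x)" by auto
  ultimately show ?thesis by simp
qed

lemma computable_not [computable_intros]: "computable b \<Longrightarrow> computable (\<lambda>x. \<not> b x)"
proof -
  assume "computable b"
  then have "computable (\<lambda>x. if b x then False else True)" by (intro computable_if computable_const)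
  moreover have "(\<lambda>x. if b x then False else True) = (\<lambda>x. \<not> b x)" by auto
  ultimately show ?thesis by simp
qed

lemma computable_disj [computable_intros]:
  "computable b \<Longrightarrow> computable c \<Longrightarrow> computable (\<lambda>x. b x \<or> c x)"
  using computable_not[OF computable_conj[OF computable_not computable_not], of b c] by simp

lemma computable_eq [computable_intros]:
  "computable f \<Longrightarrow> computable g \<Longrightarrow> computable (\<lambda>x. f x = (g x :: nat))"
  using computable_conj[OF computable_le computable_le, of f g g f] by (simp add: eq_iff)

text \<open>The bound is fixed outside the program, and the \<open>b e\<close> may have unrelated
  programs. This is how the word problem programs of finitely many groups are combined without
  uniformity in \<open>e\<close>.\<close>

lemma computable_ex_less:
  "(\<And>e. e < (k::nat) \<Longrightarrow> computable (b e)) \<Longrightarrow> computable (\<lambda>x. \<exists>e<k. b e x)"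
proof (induction k)
  case (Suc k)
  then have "computable (\<lambda>x. (\<exists>e<k. b e x) \<or> b k x)" by (intro computable_disj) auto
  moreover have "(\<lambda>x. (\<exists>e<k. b e x) \<or> b k x) = (\<lambda>x. \<exists>e<Suc k. b e x)" by (auto simp: less_Suc_eq)
  ultimately show ?case by simp
qed (auto intro: computable_const)

lemma computable_rec_nat [computable_intros]:
  assumes z: "computable z" and h: "computable (\<lambda>q. h (fst (fst q)) (snd (fst q)) (snd q))" and k: "computable k"
  shows "computable (\<lambda>x. rec_nat (z x) (\<lambda>n y. h x n y) (k x))"
proof -
  obtain rz where rz: "\<And>x. rec_eval rz [enc x] (enc (z x))" using z by (elim computableE) blast
  obtain rk where rk: "\<And>x. rec_eval rk [enc x] (k x)" using k unfolding computable_def enc_nat_def by blast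
  obtain rh where rh: "\<And>q. rec_eval rh [enc q] (enc (h (fst (fst q)) (snd (fst q)) (snd q)))"
    using h by (elim computableE) blast
  \<comment> \<open>\<open>Prec\<close> passes the counter, the previous value and the environment
    in this order; they are repacked as ((x, n), y).\<close>
  let ?H = "Comp rh [Comp pair_rec [Comp pair_rec [Proj 2, Proj 0], Proj 1]]"
  have H: "rec_eval ?H [n, enc y, enc x] (enc (h x n y))" for n y x
  proof (rule rec_eval_Comp1)
    show "rec_eval (Comp pair_rec [Comp pair_rec [Proj 2, Proj 0], Proj 1]) [n, enc y, enc x] (enc ((x, n), y))"
      unfolding enc_prod_def fst_conv snd_conv enc_nat_def
      by (rule rec_eval_Comp2[OF rec_eval_Comp2[OF rec_eval_Proj rec_eval_Proj pair_rec] rec_eval_Proj pair_rec]) auto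
    show "rec_eval rh [enc ((x, n), y)] (enc (h x n y))" using rh[of "((x, n), y)"] by simp
  qed
  show ?thesis
  proof (rule computableI[of "Comp (Prec rz ?H) [rk, Proj 0]"])
    fix x
    have "rec_eval (Prec rz ?H) [k x, enc x] (enc (rec_nat (z x) (h x) (k x)))"
      by (rule rec_eval_Prec[where F = "\<lambda>n. enc (rec_nat (z x) (h x) n)"]) (use rz H in auto)
    then show "rec_eval (Comp (Prec rz ?H) [rk, Proj 0]) [enc x] (enc (rec_nat (z x) (h x) (k x)))"
      using rk by (intro rec_eval_Comp2[OF _ rec_eval_Proj]) auto
  qed
qed

section \<open>List functions\<close>

lemma enc_Cons: "enc (x # xs) = Suc (prod_encode (enc x, enc xs))"
  by (simp add: enc_list_def)

lemma enc_Nil: "enc [] = 0"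
  by (simp add: enc_list_def)

lemma computable_Cons [computable_intros]:
  assumes "computable f" "computable g" shows "computable (\<lambda>x. f x # g x)"
proof -
  obtain r s where "\<And>x. rec_eval r [enc x] (enc (f x))" "\<And>x. rec_eval s [enc x] (enc (g x))"
    using assms by (elim computableE) blast
  then show ?thesis
    by (intro computableI[of "Comp Succ [Comp pair_rec [r, s]]"])
      (auto simp: enc_Cons intro!: rec_eval_Comp1[OF _ rec_eval.succ] rec_eval_Comp2[OF _ _ pair_rec])
qed

lemma computable_case_list [computable_intros]:
  assumes l: "computable l" and c: "computable c"
    and g: "computable (\<lambda>q. g (fst q) (fst (snd q)) (snd (snd q)))"
  shows "computable (\<lambda>x. case l x of [] \<Rightarrow> c x | a # as \<Rightarrow> g x a as)"
proof -
  obtain rl where rl: "\<And>x. rec_eval rl [enc x] (enc (l x))" using l by (elim computableE) blast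
  obtain rc where rc: "\<And>x. rec_eval rc [enc x] (enc (c x))" using c by (elim computableE) blast
  obtain rg where rg: "\<And>q. rec_eval rg [enc q] (enc (g (fst q) (fst (snd q)) (snd (snd q))))"
    using g by (elim computableE) blast
  \<comment> \<open>The code of a list is 0 only for the empty list; subtracting from 1 twice makes
    a truth value of it.\<close>
  let ?b = "Comp monus_rec [Comp monus_rec [rl, const_rec 1], const_rec 1]"
  \<comment> \<open>The predecessor of the code of a nonempty list is already the code of the pair
    of its head and tail.\<close>
  let ?t = "Comp rg [Comp pair_rec [Proj 0, Comp pred_rec [rl]]]"
  have b: "rec_eval ?b [enc x] (of_bool (l x \<noteq> []))" for x
  proof -
    have "rec_eval ?b [enc x] (1 - (1 - enc (l x)))"
      by (rule rec_eval_Comp2[OF rec_eval_Comp2[OF rl const_rec monus_rec] const_rec monus_rec])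
    then show ?thesis by (cases "l x") (auto simp: enc_Nil enc_Cons)
  qed
  show ?thesis
  proof (rule computableI[of "if_rec ?b ?t rc"])
    fix x
    have "rec_eval (if_rec ?b ?t rc) [enc x]
       (if l x \<noteq> [] then enc (g x (hd (l x)) (tl (l x))) else enc (c x))"
    proof (rule if_rec[OF b _ rc])
      assume "l x \<noteq> []"
      then obtain a as where la: "l x = a # as" by (cases "l x") auto
      have "rec_eval (Comp pred_rec [rl]) [enc x] (enc (l x) - 1)"
        by (rule rec_eval_Comp1[OF rl pred_rec])
      then have "rec_eval (Comp pair_rec [Proj 0, Comp pred_rec [rl]]) [enc x] (enc (x, a, as))"
        unfolding la enc_prod_def fst_conv snd_conv
        by (intro rec_eval_Comp2[OF rec_eval_Proj _ pair_rec]) (auto simp: enc_Cons)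
      then show "rec_eval ?t [enc x] (enc (g x (hd (l x)) (tl (l x))))"
        using rg[of "(x, a, as)"] la by (auto intro: rec_eval_Comp1)
    qed
    then show "rec_eval (if_rec ?b ?t rc) [enc x] (enc (case l x of [] \<Rightarrow> c x | a # as \<Rightarrow> g x a as))"
      by (cases "l x") auto
  qed
qed

lemma length_le_enc: "length xs \<le> enc xs"
proof (induction xs)
  case (Cons a xs)
  have "enc xs \<le> prod_encode (enc a, enc xs)" by (rule le_prod_encode_2)
  then show ?case using Cons by (simp add: enc_Cons)
qed simp

text \<open>Idle on the empty list, so that surplus iterations do no harm: the code of a list bounds
  its length and serves as the number of iterations.\<close>

definition foldl_step :: "('b \<Rightarrow> 'a \<Rightarrow> 'b) \<Rightarrow> 'b \<times> 'a list \<Rightarrow> 'b \<times> 'a list" where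
  "foldl_step h q = (case snd q of [] \<Rightarrow> q | a # as \<Rightarrow> (h (fst q) a, as))"

lemma foldl_step_iter:
  "length xs \<le> k \<Longrightarrow> rec_nat (s, xs) (\<lambda>_. foldl_step h) k = (foldl h s xs, [])"
proof -
  have *: "rec_nat (s, xs) (\<lambda>_. foldl_step h) k = (foldl h s (take k xs), drop k xs)" for k
  proof (induction k)
    case (Suc k)
    then show ?case
    proof (cases "drop k xs")
      case (Cons a as)
      then have "k < length xs" by (metis drop_eq_Nil leI list.discI)
      then have "take (Suc k) xs = take k xs @ [a]" using Cons by (simp add: take_Suc_conv_app_nth nth_via_drop)
      moreover have "drop (Suc k) xs = as" using Cons by (metis drop_Suc list.sel(3) tl_drop)
      ultimately show ?thesis using Suc Cons by (simp add: foldl_step_def)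
    qed (auto simp: foldl_step_def)
  qed simp
  then show "length xs \<le> k \<Longrightarrow> ?thesis" by simp
qed

lemma computable_enc [computable_intros]: "computable f \<Longrightarrow> computable (\<lambda>x. enc (f x))"
  by (rule computable_comp[of enc], rule computableI[of "Proj 0"]) (auto simp: enc_nat_def intro: rec_eval_Proj)

lemma computable_foldl [computable_intros]:
  assumes h: "computable (\<lambda>q. h (fst (fst q)) (snd (fst q)) (snd q))" and s: "computable s" and l: "computable l"
  shows "computable (\<lambda>x. foldl (\<lambda>acc a. h x acc a) (s x) (l x))"
proof -
  have h': "computable (\<lambda>x. h (f x) (g x) (k x))" if "computable f" "computable g" "computable k" for f g k
    using computable_comp[OF h computable_Pair[OF computable_Pair[OF that(1,2)] that(3)]] by simp
  have "computable (\<lambda>x. fst (rec_nat (s x, l x) (\<lambda>_. foldl_step (h x)) (enc (l x))))"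
    unfolding foldl_step_def by (intro computable_intros s l h')
  then show ?thesis by (simp add: foldl_step_iter length_le_enc)
qed

lemma foldl_Cons_rev: "foldl (\<lambda>acc a. a # acc) ys xs = rev xs @ ys"
  by (induction xs arbitrary: ys) auto

lemma computable_rev [computable_intros]: "computable l \<Longrightarrow> computable (\<lambda>x. rev (l x))"
  using computable_foldl[of "\<lambda>x acc a. a # acc" "\<lambda>x. []" l]
  by (simp add: foldl_Cons_rev computable_intros)

lemma computable_append [computable_intros]:
  "computable f \<Longrightarrow> computable g \<Longrightarrow> computable (\<lambda>x. f x @ g x)"
  using computable_foldl[of "\<lambda>x acc a. a # acc" g "\<lambda>x. rev (f x)"]
  by (simp add: foldl_Cons_rev computable_intros)

lemma foldl_append_concat: "foldl (\<lambda>acc a. acc @ k a) ys xs = ys @ concat (map k xs)"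
  by (induction xs arbitrary: ys) auto

lemma computable_concat_map:
  assumes h: "computable (\<lambda>q. h (fst q) (snd q))" and l: "computable l"
  shows "computable (\<lambda>x. concat (map (\<lambda>a. h x a) (l x)))"
proof -
  have "computable (\<lambda>x. foldl (\<lambda>acc a. acc @ h x a) [] (l x))"
    by (intro computable_intros computable_2[OF h] l)
  then show ?thesis by (simp add: foldl_append_concat)
qed

lemma computable_map [computable_intros]:
  assumes h: "computable (\<lambda>q. h (fst q) (snd q))" and l: "computable l"
  shows "computable (\<lambda>x. map (\<lambda>a. h x a) (l x))"
proof -
  have "computable (\<lambda>x. concat (map (\<lambda>a. [h x a]) (l x)))"
    by (intro computable_concat_map computable_intros h l)
  then show ?thesis by (simp add: concat_map_singleton)
qed

lemma computable_concat [computable_intros]: "computable l \<Longrightarrow> computable (\<lambda>x. concat (l x))"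
  using computable_concat_map[of "\<lambda>x a. a" l] by (simp add: computable_intros)

lemma concat_map_if: "concat (map (\<lambda>a. if k a then [a] else []) xs) = filter k xs"
  by (induction xs) auto

lemma computable_filter [computable_intros]:
  assumes h: "computable (\<lambda>q. h (fst q) (snd q))" and l: "computable l"
  shows "computable (\<lambda>x. filter (\<lambda>a. h x a) (l x))"
proof -
  have "computable (\<lambda>x. concat (map (\<lambda>a. if h x a then [a] else []) (l x)))"
    by (intro computable_concat_map computable_intros h l)
  then show ?thesis by (simp add: concat_map_if)
qed

lemma foldl_Suc: "foldl (\<lambda>acc a. Suc acc) k xs = k + length xs"
  by (induction xs arbitrary: k) auto

lemma computable_length [computable_intros]: "computable l \<Longrightarrow> computable (\<lambda>x. length (l x))"
  using computable_foldl[of "\<lambda>x acc a. Suc acc" "\<lambda>x. 0" l] by (simp add: foldl_Suc computable_intros)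

lemma computable_upt [computable_intros]: "computable k \<Longrightarrow> computable (\<lambda>x. [0..<k x])"
proof -
  assume k: "computable k"
  have *: "rec_nat [] (\<lambda>n y. y @ [n]) k = [0..<k]" for k by (induction k) auto
  have "computable (\<lambda>x. rec_nat [] (\<lambda>n y. y @ [n]) (k x))" by (intro computable_intros k)
  then show ?thesis by (simp add: *)
qed

lemma rec_nat_drop: "rec_nat l (\<lambda>n y. case y of [] \<Rightarrow> [] | a # as \<Rightarrow> as) k = drop k l"
  by (induction k) (simp_all add: drop_Suc tl_drop[symmetric] split: list.split)

lemma computable_drop [computable_intros]:
  assumes "computable k" "computable l" shows "computable (\<lambda>x. drop (k x) (l x))"
proof -
  have "computable (\<lambda>x. rec_nat (l x) (\<lambda>n y. case y of [] \<Rightarrow> [] | a # as \<Rightarrow> as) (k x))"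
    by (intro computable_intros assms)
  then show ?thesis by (simp add: rec_nat_drop)
qed

lemma take_eq_rev_drop: "take k l = rev (drop (length l - k) (rev l))"
  by (cases "k \<le> length l") (simp_all add: rev_drop)

lemma computable_take [computable_intros]:
  assumes "computable k" "computable l" shows "computable (\<lambda>x. take (k x) (l x))"
  unfolding take_eq_rev_drop by (intro computable_intros assms)

lemma computable_eq_Nil [computable_intros]: "computable l \<Longrightarrow> computable (\<lambda>x. l x = [])"
proof -
  assume l: "computable l"
  have *: "(l x = []) = (case l x of [] \<Rightarrow> True | _ \<Rightarrow> False)" for x by (simp split: list.split)
  show ?thesis unfolding * by (intro computable_intros l)
qed

lemma computable_hd_append [computable_intros]:
  assumes "computable l" "computable c" shows "computable (\<lambda>x. hd (l x @ [c x]))"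
proof -
  have *: "hd (l x @ [c x]) = (case l x of [] \<Rightarrow> c x | a # as \<Rightarrow> a)" for x by (simp split: list.split)
  show ?thesis unfolding * by (intro computable_intros assms)
qed

section \<open>The algorithms\<close>

text \<open>Out of range the default 0 applies, which is also the entry of an undefined
  product.\<close>

definition look :: "nat list list \<Rightarrow> nat \<Rightarrow> nat \<Rightarrow> nat" where
  "look T i j = hd (drop j (hd (drop i T @ [[]])) @ [0])"

definition table :: "nat \<Rightarrow> nat pop \<Rightarrow> nat list list" where
  "table n p = map (\<lambda>i. map (\<lambda>j. case p i j of None \<Rightarrow> 0 | Some k \<Rightarrow> Suc k) [0..<n]) [0..<n]"

definition LrT :: "nat list list \<Rightarrow> nat \<Rightarrow> nat \<Rightarrow> bool" where
  "LrT T a b \<longleftrightarrow> look T a b = Suc a \<and> look T b a = Suc b"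

definition lrepT :: "nat \<Rightarrow> nat list list \<Rightarrow> nat \<Rightarrow> nat" where
  "lrepT n T a = hd (filter (\<lambda>b. LrT T a b) [0..<n] @ [n])"

definition lactT :: "nat \<Rightarrow> nat list list \<Rightarrow> nat \<Rightarrow> nat \<Rightarrow> nat" where
  "lactT n T a f = hd (map (\<lambda>k. lrepT n T (look T k f - 1))
     (filter (\<lambda>k. LrT T a k \<and> look T f k = Suc k) [0..<n]) @ [n])"

definition lrunT :: "nat \<Rightarrow> nat list list \<Rightarrow> nat \<Rightarrow> nat list \<Rightarrow> nat" where
  "lrunT n T a w = foldl (\<lambda>c f. lactT n T c f) (lrepT n T a) w"

text \<open>The empty word heads the list, which makes the chosen path to the root empty.\<close>

definition short_words :: "nat \<Rightarrow> nat \<Rightarrow> nat list list" where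
  "short_words n k = rec_nat [[]] (\<lambda>i ws. [] # concat (map (\<lambda>f. map (\<lambda>w. f # w) ws) [0..<n])) k"

text \<open>By \<open>short_run\<close> words of length at most \<open>n\<close> suffice, so for
  \<open>a\<close> below \<open>n\<close> this list is empty exactly if the vertex is
  unreachable.\<close>

definition paths :: "nat \<Rightarrow> nat list list \<Rightarrow> nat \<Rightarrow> nat \<Rightarrow> nat list list" where
  "paths n T e a = filter (\<lambda>w. lrunT n T e w = a) (short_words n n)"

definition tree_path :: "nat \<Rightarrow> nat list list \<Rightarrow> nat \<Rightarrow> nat \<Rightarrow> nat list" where
  "tree_path n T e a = hd (paths n T e a @ [[]])"

text \<open>Inverts the letter code in \<open>group_word_code\<close>: odd codes are generators,
  even codes their inverses.\<close>

definition letter_of :: "nat \<Rightarrow> nat \<times> bool" where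
  "letter_of c = (c div 2, odd c)"

definition path_code :: "nat \<Rightarrow> nat list list \<Rightarrow> nat \<Rightarrow> nat list \<Rightarrow> nat list" where
  "path_code n T a w =
     snd (foldl (\<lambda>q f. (lactT n T (fst q) f, snd q @ [2 * (fst q * n + f) + 1])) (a, []) w)"

definition relators :: "nat \<Rightarrow> nat list list \<Rightarrow> nat \<Rightarrow> nat list list" where
  "relators n T e =
     concat (map (\<lambda>a. concat (map (\<lambda>f.
       if paths n T e a = [] \<or> \<not> lactT n T a f < n then [[2 * (a * n + f) + 1]] else []) [0..<n])) [0..<n]) @
     concat (map (\<lambda>a. concat (map (\<lambda>f. concat (map (\<lambda>g.
       if paths n T e a \<noteq> [] \<and> look T f g \<noteq> 0 \<and> lactT n T a (look T f g - 1) < n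
       then [[2 * (a * n + f) + 1, 2 * (lactT n T a f * n + g) + 1, 2 * (a * n + (look T f g - 1))]]
       else []) [0..<n])) [0..<n])) [0..<n]) @
     map (\<lambda>a. path_code n T (lrepT n T e) (tree_path n T e a)) (filter (\<lambda>a. paths n T e a \<noteq> []) [0..<n])"

definition presentations :: "nat list list \<Rightarrow> (nat \<times> nat list list) list" where
  "presentations T = map (\<lambda>e. (length T * length T, relators (length T) T e)) [0..<length T]"

section \<open>Computability of the algorithms\<close>

lemma computable_look [computable_intros]:
  assumes "computable T" "computable i" "computable j"
  shows "computable (\<lambda>x. look (T x) (i x) (j x))"
  unfolding look_def by (intro computable_intros assms assms[THEN computable_comp])

lemma computable_LrT [computable_intros]:
  assumes "computable T" "computable a" "computable b"
  shows "computable (\<lambda>x. LrT (T x) (a x) (b x))"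
  unfolding LrT_def by (intro computable_intros assms assms[THEN computable_comp])

lemma computable_lrepT [computable_intros]:
  assumes "computable n" "computable T" "computable a"
  shows "computable (\<lambda>x. lrepT (n x) (T x) (a x))"
  unfolding lrepT_def by (intro computable_intros assms assms[THEN computable_comp])

lemma computable_lactT [computable_intros]:
  assumes "computable n" "computable T" "computable a" "computable f"
  shows "computable (\<lambda>x. lactT (n x) (T x) (a x) (f x))"
  unfolding lactT_def by (intro computable_intros assms assms[THEN computable_comp])

lemma computable_lrunT [computable_intros]:
  assumes "computable n" "computable T" "computable a" "computable w"
  shows "computable (\<lambda>x. lrunT (n x) (T x) (a x) (w x))"
  unfolding lrunT_def by (intro computable_intros assms assms[THEN computable_comp])

lemma computable_short_words [computable_intros]:
  assumes "computable n" "computable k"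
  shows "computable (\<lambda>x. short_words (n x) (k x))"
  unfolding short_words_def by (intro computable_intros assms assms[THEN computable_comp])

lemma computable_paths [computable_intros]:
  assumes "computable n" "computable T" "computable e" "computable a"
  shows "computable (\<lambda>x. paths (n x) (T x) (e x) (a x))"
  unfolding paths_def by (intro computable_intros assms assms[THEN computable_comp])

lemma computable_tree_path [computable_intros]:
  assumes "computable n" "computable T" "computable e" "computable a"
  shows "computable (\<lambda>x. tree_path (n x) (T x) (e x) (a x))"
  unfolding tree_path_def by (intro computable_intros assms assms[THEN computable_comp])

lemma computable_path_code [computable_intros]:
  assumes "computable n" "computable T" "computable a" "computable w"
  shows "computable (\<lambda>x. path_code (n x) (T x) (a x) (w x))"
  unfolding path_code_def by (intro computable_intros assms assms[THEN computable_comp])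

lemma computable_relators [computable_intros]:
  assumes "computable n" "computable T" "computable e"
  shows "computable (\<lambda>x. relators (n x) (T x) (e x))"
  unfolding relators_def by (intro computable_intros assms assms[THEN computable_comp])

lemma computable_presentations: "computable presentations"
  unfolding presentations_def by (intro computable_intros)

section \<open>Correctness of the algorithms on codes\<close>

lemma enc_nat_list: "(enc :: nat list \<Rightarrow> nat) = list_encode"
proof
  fix xs :: "nat list"
  have "map enc xs = xs" by (rule map_idI) (simp add: enc_nat_def)
  then show "enc xs = list_encode xs" by (simp add: enc_list_def)
qed

lemma letter_of_True [simp]: "letter_of (Suc (2 * i)) = (i, True)"
  and letter_of_False [simp]: "letter_of (2 * i) = (i, False)"
  by (auto simp: letter_of_def)

lemma group_word_code_letters: "group_word_code (map letter_of w) = list_encode w"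
proof -
  have "map ((\<lambda>(i, b). 2 * i + of_bool b) \<circ> letter_of) w = w"
    by (rule map_idI) (auto simp: letter_of_def)
  then show ?thesis by (simp add: group_word_code_def)
qed

lemma set_short_words: "set (short_words n k) = {w. set w \<subseteq> {..<n} \<and> length w \<le> k}"
proof (induction k)
  case (Suc k)
  have "set (short_words n (Suc k)) = insert [] {f # w | f w. f < n \<and> w \<in> set (short_words n k)}"
    by (auto simp: short_words_def)
  also have "\<dots> = {w. set w \<subseteq> {..<n} \<and> length w \<le> Suc k}"
    unfolding Suc by (auto, metis length_Suc_conv Suc_le_length_iff le_Suc_eq list.set_intros list.exhaust list.size(4) Suc_le_mono lessThan_iff insert_subset list.simps(15))
  finally show ?case .
qed (auto simp: short_words_def)

lemma short_words_Nil: "\<exists>ws. short_words n k = [] # ws"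
  by (cases k) (auto simp: short_words_def)

lemma look_table:
  assumes "\<And>k. p i j = Some k \<Longrightarrow> i < n \<and> j < n"
  shows "look (table n p) i j = (case p i j of None \<Rightarrow> 0 | Some k \<Rightarrow> Suc k)"
proof -
  have hd_drop: "hd (drop i xs @ [c]) = (if i < length xs then xs ! i else c)" for i xs and c :: 'c
    by (simp add: hd_append hd_drop_conv_nth)
  show ?thesis
    using assms by (cases "p i j") (auto simp: look_def table_def hd_drop)
qed

context nat_biord
begin

lemma p_less: "p i j = Some k \<Longrightarrow> i < n \<and> j < n \<and> k < n"
  using p_E E_iff p_iff by blast

abbreviation "T \<equiv> table n p"

lemma lookT: "look T i j = (case p i j of None \<Rightarrow> 0 | Some k \<Rightarrow> Suc k)"
  by (rule look_table) (use p_less in blast)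

lemma lookT_Suc: "look T i j = Suc k \<longleftrightarrow> p i j = Some k"
  by (simp add: lookT split: option.split)

lemma LrT: "LrT T a b \<longleftrightarrow> Lr p a b"
  by (simp add: LrT_def Lr_def lookT_Suc)

lemma lrepT: "lrepT n T = rep"
  by (rule ext) (simp add: lrepT_def lrep_def LrT)

lemma lactT: "lactT n T = d"
proof (intro ext)
  fix a f
  have "map (\<lambda>k. rep (look T k f - 1)) (filter (\<lambda>k. Lr p a k \<and> p f k = Some k) [0..<n]) =
    map (\<lambda>k. rep (the (p k f))) (filter (\<lambda>k. Lr p a k \<and> p f k = Some k) [0..<n])"
  proof (rule map_cong[OF HOL.refl])
    fix k assume "k \<in> set (filter (\<lambda>k. Lr p a k \<and> p f k = Some k) [0..<n])"
    then have "p f k = Some k" by simp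
    then have "p k f = Some (k \<cdot> f)" using p_iff[of f k k] p_iff[of k f "k \<cdot> f"] by metis
    then show "rep (look T k f - 1) = rep (the (p k f))" by (simp add: lookT)
  qed
  then show "lactT n T a f = d a f" by (simp only: lactT_def lact_def lrepT LrT lookT_Suc)
qed

lemma lrunT: "lrunT n T a w = foldl d (rep a) w"
  by (simp add: lrunT_def lactT lrepT)

lemma path_code: "map letter_of (path_code n T a w) = pw a w"
proof -
  have "map letter_of (snd (foldl (\<lambda>q f. (d (fst q) f, snd q @ [2 * (fst q * n + f) + 1])) (a, xs) w)) =
    map letter_of xs @ pw a w" for xs
    by (induction w arbitrary: a xs) (auto simp del: distrib_left_numeral)
  then show ?thesis by (simp add: path_code_def lactT del: distrib_left_numeral)
qed

text \<open>Only \<open>n\<close> states are live, so a live run of more than \<open>n\<close>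
  letters visits one of them twice, and the letters in between can be cut out.\<close>

lemma short_run:
  assumes "e < n" "foldl d (rep e) w < n"
  shows "\<exists>w'. length w' \<le> n \<and> foldl d (rep e) w' = foldl d (rep e) w"
  using assms(2)
proof (induction "length w" arbitrary: w rule: less_induct)
  case less
  show ?case
  proof (cases "length w \<le> n")
    case False
    define s where "s i = foldl d (rep e) (take i w)" for i
    have s: "s i < n" for i
    proof -
      have "foldl d (s i) (drop i w) < n" using less.prems unfolding s_def foldl_append[symmetric] by simp
      moreover have "s i \<le> n" using run_le[OF assms(1)] by (simp add: s_def)
      ultimately show ?thesis using d_dead by (cases "s i = n") auto
    qed
    have "\<not> inj_on s {..n}"
    proof
      assume "inj_on s {..n}"
      then have "card {..n} \<le> card {..<n}" by (rule card_inj_on_le) (use s in auto)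
      then show False by simp
    qed
    then obtain i j where ij: "i < j" "j \<le> n" "s i = s j" unfolding inj_on_def by (metis atMost_iff linorder_neqE_nat)
    define w' where "w' = take i w @ drop j w"
    have "foldl d (rep e) w' = foldl d (s j) (drop j w)" by (simp add: w'_def s_def[symmetric] ij(3))
    also have "\<dots> = foldl d (rep e) w" unfolding s_def foldl_append[symmetric] by simp
    finally have eq: "foldl d (rep e) w' = foldl d (rep e) w" .
    have "length w' < length w" using ij False by (simp add: w'_def)
    then show ?thesis using less.hyps[of w'] eq less.prems by metis
  qed blast
qed

lemma paths_nonempty_iff:
  assumes "e < n" "a < n" shows "paths n T e a \<noteq> [] \<longleftrightarrow> (\<exists>w. foldl d (rep e) w = a)"
proof
  assume "paths n T e a \<noteq> []"
  then obtain w where "w \<in> set (paths n T e a)" by (meson last_in_set)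
  then show "\<exists>w. foldl d (rep e) w = a" by (auto simp: paths_def lrunT)
next
  assume "\<exists>w. foldl d (rep e) w = a"
  then obtain w where w: "length w \<le> n" "foldl d (rep e) w = a" using short_run assms by metis
  then have "set w \<subseteq> {..<n}" using run_less[OF assms(1)] assms(2) reach_E E_eq by blast
  then have "w \<in> set (paths n T e a)" using w by (simp add: paths_def lrunT set_short_words)
  then show "paths n T e a \<noteq> []" by auto
qed

lemma tree_path:
  assumes "e < n" "foldl d (rep e) w = a" "a < n"
  shows "foldl d (rep e) (tree_path n T e a) = a"
proof -
  have "paths n T e a \<noteq> []" using paths_nonempty_iff assms by blast
  then have "tree_path n T e a \<in> set (paths n T e a)" by (simp add: tree_path_def)
  then show ?thesis by (simp add: paths_def lrunT)
qed

lemma tree_path_root: "tree_path n T e (rep e) = []"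
proof -
  obtain ws where "short_words n n = [] # ws" using short_words_Nil by blast
  then show ?thesis by (simp add: tree_path_def paths_def lrunT)
qed

definition pres :: "nat \<Rightarrow> group_presentation" where
  "pres e = (n * n, map (map letter_of) (relators n T e))"

lemma relators_set:
  assumes e: "e < n"
  shows "set (map (map letter_of) (relators n T e)) =
      {[(a * n + f, True)] | a f. a < n \<and> f < n \<and> \<not> ((\<exists>w. foldl d (rep e) w = a) \<and> d a f < n)} \<union>
      {[(a * n + f, True), (d a f * n + g, True), (a * n + k, False)] | a f g k.
         a < n \<and> (\<exists>w. foldl d (rep e) w = a) \<and> p f g = Some k \<and> d a k < n} \<union>
      {pw (rep e) (tree_path n T e a) | a. a < n \<and> (\<exists>w. foldl d (rep e) w = a)}"
proof -
  let ?R1 = "concat (map (\<lambda>a. concat (map (\<lambda>f.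
       if paths n T e a = [] \<or> \<not> lactT n T a f < n then [[2 * (a * n + f) + 1]] else []) [0..<n])) [0..<n])"
  let ?R2 = "concat (map (\<lambda>a. concat (map (\<lambda>f. concat (map (\<lambda>g.
       if paths n T e a \<noteq> [] \<and> look T f g \<noteq> 0 \<and> lactT n T a (look T f g - 1) < n
       then [[2 * (a * n + f) + 1, 2 * (lactT n T a f * n + g) + 1, 2 * (a * n + (look T f g - 1))]]
       else []) [0..<n])) [0..<n])) [0..<n])"
  let ?R3 = "map (\<lambda>a. path_code n T (lrepT n T e) (tree_path n T e a)) (filter (\<lambda>a. paths n T e a \<noteq> []) [0..<n])"
  let ?f = "map letter_of"
  have P: "a < n \<Longrightarrow> paths n T e a = [] \<longleftrightarrow> \<not> (\<exists>w. foldl d (rep e) w = a)" for a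
    using paths_nonempty_iff[OF e] by blast
  have mem: "x \<in> set (concat (map F [0..<n])) \<longleftrightarrow> (\<exists>a<n. x \<in> set (F a))"
    for F :: "nat \<Rightarrow> nat list list" and x by auto
  have single: "x \<in> set (if c then [y] else []) \<longleftrightarrow> c \<and> x = y" for c and x y :: "nat list" by auto
  have 1: "?f ` set ?R1 =
      {[(a * n + f, True)] | a f. a < n \<and> f < n \<and> \<not> ((\<exists>w. foldl d (rep e) w = a) \<and> d a f < n)}"
  proof -
    have "set ?R1 = {[2 * (a * n + f) + 1] | a f. a < n \<and> f < n \<and> \<not> (paths n T e a \<noteq> [] \<and> d a f < n)}"
      unfolding set_eq_iff mem single mem_Collect_eq lactT by blast
    also have "\<dots> = {[2 * (a * n + f) + 1] | a f. a < n \<and> f < n \<and> \<not> ((\<exists>w. foldl d (rep e) w = a) \<and> d a f < n)}"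
      using P by blast
    finally have R1: "set ?R1 = \<dots>" .
    have "?f ` {[2 * (a * n + f) + 1] | a f. Q a f} = {?f [2 * (a * n + f) + 1] | a f. Q a f}" for Q
      by blast
    then show ?thesis unfolding R1 by (simp del: distrib_left_numeral)
  qed
  have 2: "?f ` set ?R2 =
      {[(a * n + f, True), (d a f * n + g, True), (a * n + k, False)] | a f g k.
         a < n \<and> (\<exists>w. foldl d (rep e) w = a) \<and> p f g = Some k \<and> d a k < n}"
  proof -
    have "set ?R2 = {[2 * (a * n + f) + 1, 2 * (d a f * n + g) + 1, 2 * (a * n + (look T f g - 1))] | a f g.
       a < n \<and> f < n \<and> g < n \<and> paths n T e a \<noteq> [] \<and> look T f g \<noteq> 0 \<and> d a (look T f g - 1) < n}"
      unfolding set_eq_iff mem single mem_Collect_eq lactT by blast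
    also have "\<dots> = {[2 * (a * n + f) + 1, 2 * (d a f * n + g) + 1, 2 * (a * n + k)] | a f g k.
       a < n \<and> paths n T e a \<noteq> [] \<and> p f g = Some k \<and> d a k < n}"
    proof -
      have key: "f < n \<and> g < n \<and> look T f g \<noteq> 0 \<and> Q (look T f g - 1) \<longleftrightarrow> (\<exists>k. p f g = Some k \<and> Q k)" for f g Q
        using p_less[of f g] by (auto simp: lookT split: option.splits)
      have "x = [2 * (a * n + f) + 1, 2 * (d a f * n + g) + 1, 2 * (a * n + (look T f g - 1))] \<and>
          a < n \<and> f < n \<and> g < n \<and> paths n T e a \<noteq> [] \<and> look T f g \<noteq> 0 \<and> d a (look T f g - 1) < n \<longleftrightarrow>
          (\<exists>k. x = [2 * (a * n + f) + 1, 2 * (d a f * n + g) + 1, 2 * (a * n + k)] \<and>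
          a < n \<and> paths n T e a \<noteq> [] \<and> p f g = Some k \<and> d a k < n)" for a f g x
        using key[of f g "\<lambda>k. d a k < n \<and> x = [2 * (a * n + f) + 1, 2 * (d a f * n + g) + 1, 2 * (a * n + k)]"] by blast
      then show ?thesis by (simp only:)
    qed
    also have "\<dots> = {[2 * (a * n + f) + 1, 2 * (d a f * n + g) + 1, 2 * (a * n + k)] | a f g k.
       a < n \<and> (\<exists>w. foldl d (rep e) w = a) \<and> p f g = Some k \<and> d a k < n}" using P by blast
    finally have R2: "set ?R2 = \<dots>" .
    show ?thesis unfolding R2
    proof (intro subset_antisym subsetI)
      fix x assume "x \<in> ?f ` {[2 * (a * n + f) + 1, 2 * (d a f * n + g) + 1, 2 * (a * n + k)] | a f g k.
         a < n \<and> (\<exists>w. foldl d (rep e) w = a) \<and> p f g = Some k \<and> d a k < n}"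
      then obtain a f g k where "x = ?f [2 * (a * n + f) + 1, 2 * (d a f * n + g) + 1, 2 * (a * n + k)]"
        "a < n" "\<exists>w. foldl d (rep e) w = a" "p f g = Some k" "d a k < n" by blast
      then show "x \<in> {[(a * n + f, True), (d a f * n + g, True), (a * n + k, False)] | a f g k.
         a < n \<and> (\<exists>w. foldl d (rep e) w = a) \<and> p f g = Some k \<and> d a k < n}"
        unfolding mem_Collect_eq by (intro exI[of _ a] exI[of _ f] exI[of _ g] exI[of _ k]) (simp del: distrib_left_numeral)
    next
      fix x assume "x \<in> {[(a * n + f, True), (d a f * n + g, True), (a * n + k, False)] | a f g k.
         a < n \<and> (\<exists>w. foldl d (rep e) w = a) \<and> p f g = Some k \<and> d a k < n}"
      then obtain a f g k where "x = [(a * n + f, True), (d a f * n + g, True), (a * n + k, False)]"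
        and *: "a < n" "\<exists>w. foldl d (rep e) w = a" "p f g = Some k" "d a k < n" by blast
      then have "x = ?f [2 * (a * n + f) + 1, 2 * (d a f * n + g) + 1, 2 * (a * n + k)]"
        by (simp del: distrib_left_numeral)
      then show "x \<in> ?f ` {[2 * (a * n + f) + 1, 2 * (d a f * n + g) + 1, 2 * (a * n + k)] | a f g k.
         a < n \<and> (\<exists>w. foldl d (rep e) w = a) \<and> p f g = Some k \<and> d a k < n}"
        by (rule image_eqI) (use * in blast)
    qed
  qed
  have 3: "?f ` set ?R3 = {pw (rep e) (tree_path n T e a) | a. a < n \<and> (\<exists>w. foldl d (rep e) w = a)}"
  proof -
    have "set (filter (\<lambda>a. paths n T e a \<noteq> []) [0..<n]) = {a. a < n \<and> (\<exists>w. foldl d (rep e) w = a)}"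
      using P by auto
    then show ?thesis unfolding set_map image_image path_code lrepT by blast
  qed
  have "set (map ?f (relators n T e)) = ?f ` set ?R1 \<union> (?f ` set ?R2 \<union> ?f ` set ?R3)"
    unfolding relators_def by (simp only: set_map set_append image_Un)
  then show ?thesis unfolding 1 2 3 by (simp only: Un_assoc)
qed

lemma pi1_pres: "e < n \<Longrightarrow> pi1 S m p n e (tree_path n T e) (pres e)"
proof (unfold_locales)
  assume e: "e < n"
  then show "e < n" .
  show "tree_path n T e (rep e) = []" by (rule tree_path_root)
  show "foldl d (rep e) (tree_path n T e (foldl d (rep e) w)) = foldl d (rep e) w" if "foldl d (rep e) w < n" for w
    using tree_path[OF e HOL.refl that] .
  show "fst (pres e) = n * n" by (simp add: pres_def)
  show "set (snd (pres e)) =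
      {[(a * n + f, True)] | a f. a < n \<and> f < n \<and> \<not> ((\<exists>w. foldl d (rep e) w = a) \<and> d a f < n)} \<union>
      {[(a * n + f, True), (d a f * n + g, True), (a * n + k, False)] | a f g k.
         a < n \<and> (\<exists>w. foldl d (rep e) w = a) \<and> p f g = Some k \<and> d a k < n} \<union>
      {pw (rep e) (tree_path n T e a) | a. a < n \<and> (\<exists>w. foldl d (rep e) w = a)}"
    using relators_set[OF e] by (simp add: pres_def)
qed

lemma presentations_code:
  "enc (presentations T) = list_encode (map presentation_code (map pres [0..<n]))"
proof -
  have len: "length T = n" by (simp add: table_def)
  have c: "list_encode (map group_word_code (map (map letter_of) rs)) = enc rs" for rs
    by (simp add: enc_list_def enc_nat_list o_def group_word_code_letters)
  show ?thesis
    by (simp add: presentations_def len enc_list_def[of "map _ [0..<_]"] enc_prod_def o_def presentation_code_def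
      pres_def c[unfolded map_map o_def] enc_nat_def)
qed

lemma table_code: "enc T = table_code n p"
  by (simp add: table_code_def table_def enc_list_def[of "map _ _"] enc_nat_list o_def)

lemma presentation_iso:
  assumes e: "e < n"
  shows "valid_presentation (pres e)" "presented_group (pres e) \<cong> IG_max_subgroup {..<n} p e"
proof -
  interpret pi1 S m p n e "tree_path n T e" "pres e" by (rule pi1_pres[OF e])
  show "presented_group (pres e) \<cong> IG_max_subgroup {..<n} p e"
    using presented_group_iso by (simp add: E_eq)
  have "r \<in> group_words (fst (pres e))" if "r \<in> set (snd (pres e))" for r
  proof -
    from that consider
      (1) a f where "r = [(a * n + f, True)]" "a < n" "f < n"
      | (2) a f g k where "r = [(a * n + f, True), (d a f * n + g, True), (a * n + k, False)]"
          "reachable a" "p f g = Some k" "d a k < n"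
      | (3) a where "r = pw v0 (tree_path n T e a)" "reachable a"
      unfolding rels reachable_def by blast
    then show ?thesis
    proof cases
      case 1
      then show ?thesis using gen_less by (simp add: gens)
    next
      case (2 a f g k)
      have a: "a < n" "rep a = a" using 2 reachable_rep by (auto simp: reachable_def)
      have "ig_eq p [f, g] [k]" using ig_eq_pair[of p f g k "[]" "[]"] 2 by simp
      from run_rel[OF this a(1)] have "foldl d a ([f] @ [g]) < n" using a 2 by simp
      then have "foldl d a [f] < n" using run_prefix 2 by blast
      then show ?thesis using gen_less a 2 p_less[OF 2(3)] by (simp add: gens)
    next
      case 3
      then show ?thesis using pw_words[OF reachable_root] t_run by (simp add: reachable_def)
    qed
  qed
  then show "valid_presentation (pres e)" unfolding valid_presentation_def by blast
qed

end

text \<open>\<open>T'\<close> stands for the table of \<open>opp p\<close>, in which the reversed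
  beginning of the word is run as a left action. The index \<open>i\<close> is the position of the
  seed.\<close>

definition headsT :: "nat \<Rightarrow> nat list list \<Rightarrow> nat list list \<Rightarrow> nat \<Rightarrow> nat list \<Rightarrow> bool" where
  "headsT n T T' e u \<longleftrightarrow> filter (\<lambda>i.
     lrunT n T' (hd (drop i u @ [0])) (rev (take i u)) = lrepT n T' e \<and>
     lrunT n T (hd (drop i u @ [0])) (drop (Suc i) u) < n) [0..<length u] \<noteq> []"

text \<open>The given word problem program is only known to halt on words over the generators, which
  the path word of a dead run may leave; the empty word replaces it. Decrementing a code inverts the
  letter, since path words consist of positive letters.\<close>

definition quotient_code :: "nat \<Rightarrow> nat list list \<Rightarrow> nat \<Rightarrow> nat list \<Rightarrow> nat list \<Rightarrow> nat list" where
  "quotient_code n T e u v =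
     (if lrunT n T e u < n \<and> lrunT n T e v < n
      then path_code n T (lrepT n T e) u @ rev (map (\<lambda>c. c - 1) (path_code n T (lrepT n T e) v))
      else [])"

section \<open>The comparison of regular words\<close>

lemma computable_headsT [computable_intros]:
  assumes "computable n" "computable T" "computable T'" "computable e" "computable u"
  shows "computable (\<lambda>x. headsT (n x) (T x) (T' x) (e x) (u x))"
  unfolding headsT_def by (intro computable_intros assms assms[THEN computable_comp])

lemma computable_quotient_code [computable_intros]:
  assumes "computable n" "computable T" "computable e" "computable u" "computable v"
  shows "computable (\<lambda>x. quotient_code (n x) (T x) (e x) (u x) (v x))"
  unfolding quotient_code_def by (intro computable_intros assms assms[THEN computable_comp])

lemma rec_eval_of_computable2:
  fixes f :: "nat list \<times> nat list \<Rightarrow> nat"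
  assumes "computable f"
  obtains B where "\<And>u v. rec_eval B [list_encode u, list_encode v] (f (u, v))"
proof -
  obtain r where r: "\<And>x. rec_eval r [enc x] (enc (f x))" using assms by (elim computableE) blast
  have "rec_eval (Comp r [pair_rec]) [list_encode u, list_encode v] (f (u, v))" for u v
    using r[of "(u, v)"]
    by (intro rec_eval_Comp1[OF pair_rec]) (simp add: enc_prod_def enc_nat_list enc_nat_def)
  then show ?thesis using that by blast
qed

context nat_biord
begin

lemma headsT_iff:
  assumes e: "e < n" and u: "set u \<subseteq> {..<n}"
  shows "headsT n T (table n (opp p)) e u \<longleftrightarrow> heads p e u"
proof -
  interpret dual: nat_biord S "\<lambda>x y. y \<cdot> x" "opp p" n
    using dual E_eq idem_dual by (intro nat_biord.intro nat_biord_axioms.intro) auto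
  let ?ok = "\<lambda>i. lrunT n (table n (opp p)) (hd (drop i u @ [0])) (rev (take i u)) = lrepT n (table n (opp p)) e \<and>
     lrunT n T (hd (drop i u @ [0])) (drop (Suc i) u) < n"
  have ok: "?ok i \<longleftrightarrow> live p (u ! i) (drop (Suc i) u) \<and> reach (opp p) (u ! i) (rev (take i u)) e"
    if i: "i < length u" for i
  proof -
    have s: "hd (drop i u @ [0]) = u ! i" using i by (simp add: hd_append hd_drop_conv_nth)
    have "u ! i < n" using u i nth_mem by blast
    then show ?thesis unfolding s
      using dual.run_eq_iff[of "u ! i" e] run_less_iff[of "u ! i"] e by (auto simp: lrunT dual.lrunT dual.lrepT)
  qed
  have "headsT n T (table n (opp p)) e u \<longleftrightarrow> (\<exists>i<length u. ?ok i)"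
    unfolding headsT_def filter_empty_conv by auto
  also have "\<dots> \<longleftrightarrow> heads p e u"
  proof
    assume "\<exists>i<length u. ?ok i"
    then obtain i where i: "i < length u" "live p (u ! i) (drop (Suc i) u)"
      "reach (opp p) (u ! i) (rev (take i u)) e" using ok by blast
    then show "heads p e u" unfolding heads_def using id_take_nth_drop[OF i(1)] by blast
  next
    assume "heads p e u"
    then obtain a s c where asc: "u = a @ s # c" "live p s c" "reach (opp p) s (rev a) e"
      unfolding heads_def by blast
    then have "?ok (length a)" by (subst ok) simp_all
    then show "\<exists>i<length u. ?ok i" using asc(1) by (intro exI[of _ "length a"]) simp
  qed
  finally show ?thesis .
qed

lemma quotient_code_letters:
  assumes "foldl d (rep e) u < n" "foldl d (rep e) v < n"
  shows "map letter_of (quotient_code n T e u v) = pw (rep e) u @ word_inv (pw (rep e) v)"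
proof -
  have "\<forall>x\<in>set (pw a w). snd x" for a w by (induction w arbitrary: a) auto
  then have "snd (letter_of c)" if "c \<in> set (path_code n T a w)" for a w c
    using path_code[of a w] that by (metis image_eqI list.set_map)
  then have "letter_of (c - 1) = (case letter_of c of (i, b) \<Rightarrow> (i, \<not> b))" if "c \<in> set (path_code n T a w)" for a w c
    using that by (fastforce simp: letter_of_def elim!: oddE)
  then have "map letter_of (map (\<lambda>c. c - 1) (path_code n T a w)) = map (\<lambda>(i, b). (i, \<not> b)) (pw a w)" for a w
    unfolding path_code[symmetric] by simp
  then show ?thesis using assms unfolding quotient_code_def lrunT lrepT word_inv_def
    by (simp add: path_code rev_map[symmetric] del: map_map)
qed

text \<open>All letters are tried as a common head. Equal regular words share their heads by
  \<open>heads_eq\<close>, and for a common head and the same end vertex \<open>heads_eq_iff\<close>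
  reduces equality to the word problem for one quotient.\<close>

lemma comparison_algorithm:
  assumes wp: "\<And>e. e < n \<Longrightarrow> solvable_word_problem (pres e)"
  shows "\<exists>B. \<forall>u\<in>lists {..<n}. \<forall>v\<in>lists {..<n}. rec_eval B [list_encode u, list_encode v]
     (if represents_regular {..<n} p u \<and> represents_regular {..<n} p v
      then (if IG_class {..<n} p u = IG_class {..<n} p v then 2 else 1) else 0)"
proof -
  define H where "H e u = headsT n T (table n (opp p)) e u" for e u
  define q where "q e x = quotient_code n T e (fst x) (snd x)" for e and x :: "nat list \<times> nat list"
  define wpv where "wpv e x \<longleftrightarrow> (map letter_of (q e x), []) \<in> group_cong (pres e)" for e x
  have words: "pw (rep e) u \<in> group_words (fst (pres e))" if "e < n" "foldl d (rep e) u < n" for e u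
  proof -
    interpret pi1 S m p n e "tree_path n T e" "pres e" by (rule pi1_pres[OF that(1)])
    show ?thesis using pw_words[OF reachable_root that(2)] .
  qed
  \<comment> \<open>The query lies in the domain of the word problem program for every pair of
    words, so that \<open>wpv e\<close> is computable as a total function.\<close>
  have q_words: "map letter_of (q e x) \<in> group_words (fst (pres e))" if "e < n" for e x
  proof (cases "foldl d (rep e) (fst x) < n \<and> foldl d (rep e) (snd x) < n")
    case True
    then show ?thesis using words[OF that] quotient_code_letters by (simp add: q_def)
  qed (auto simp: q_def quotient_code_def lrunT)
  have wpc: "computable (wpv e)" if e: "e < n" for e
  proof -
    obtain f where f: "\<And>w. w \<in> group_words (fst (pres e)) \<Longrightarrow>
        rec_eval f [group_word_code w] (if (w, []) \<in> group_cong (pres e) then 1 else 0)"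
      using wp[OF e] unfolding solvable_word_problem_def by blast
    have "computable (q e)" unfolding q_def by (intro computable_intros)
    then obtain r where r: "\<And>x. rec_eval r [enc x] (enc (q e x))" by (elim computableE) blast
    have "rec_eval (Comp f [r]) [enc x] (enc (wpv e x))" for x
    proof (rule rec_eval_Comp1[OF r])
      show "rec_eval f [enc (q e x)] (enc (wpv e x))"
        using f[OF q_words[OF e]] by (simp add: group_word_code_letters enc_nat_list wpv_def enc_bool_def of_bool_def)
    qed
    then show ?thesis by (rule computableI)
  qed
  define same where "same x \<longleftrightarrow> (\<exists>e<n. H e (fst x) \<and> H e (snd x) \<and>
     lrunT n T e (fst x) = lrunT n T e (snd x) \<and> wpv e x)" for x
  define res :: "nat list \<times> nat list \<Rightarrow> nat" where
    "res x = (if (\<exists>e<n. H e (fst x)) \<and> (\<exists>e<n. H e (snd x)) then (if same x then 2 else 1) else 0)" for x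
  have "computable res"
    unfolding res_def same_def H_def by (intro computable_intros computable_ex_less wpc)
  then obtain B where B: "\<And>u v. rec_eval B [list_encode u, list_encode v] (res (u, v))"
    using rec_eval_of_computable2 by blast
  have res: "res (u, v) = (if represents_regular {..<n} p u \<and> represents_regular {..<n} p v
      then (if IG_class {..<n} p u = IG_class {..<n} p v then 2 else 1) else 0)"
    if u: "u \<in> lists {..<n}" and v: "v \<in> lists {..<n}" for u v
  proof -
    have HH: "H e u \<longleftrightarrow> heads p e u" "H e v \<longleftrightarrow> heads p e v" if "e < n" for e
      unfolding H_def using headsT_iff[OF that] u v by auto
    have reg: "represents_regular {..<n} p w \<longleftrightarrow> (\<exists>e<n. heads p e w)" if "w \<in> lists {..<n}" for w
    proof -
      have "represents_regular {..<n} p w \<longleftrightarrow> seeded p w"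
        using represents_regular_iff[OF fin, of w] that by (simp add: E_eq)
      also have "\<dots> \<longleftrightarrow> (\<exists>e. heads p e w)" by (rule seeded_heads)
      also have "\<dots> \<longleftrightarrow> (\<exists>e<n. heads p e w)"
        using heads_props(1) unfolding E_eq by (auto simp only: lessThan_iff)
      finally show ?thesis .
    qed
    have "IG_class {..<n} p u = IG_class {..<n} p v \<longleftrightarrow> same (u, v)"
      if hu: "\<exists>e<n. heads p e u" and hv: "\<exists>e<n. heads p e v"
    proof -
      have "u \<noteq> []" "v \<noteq> []" using hu hv by (auto simp: heads_def)
      then have "IG_class {..<n} p u = IG_class {..<n} p v \<longleftrightarrow> ig_eq p u v"
        using IG_class_eq_iff[of u v] u v by (simp add: E_eq)
      also have "\<dots> \<longleftrightarrow> same (u, v)"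
      proof -
        have eq: "ig_eq p u v \<longleftrightarrow> wpv e (u, v)"
          if e: "e < n" and h: "heads p e u" "heads p e v" and run: "foldl d (rep e) u = foldl d (rep e) v" for e
        proof -
          interpret pi1 S m p n e "tree_path n T e" "pres e" by (rule pi1_pres[OF e])
          have l: "foldl d (rep e) u < n" "foldl d (rep e) v < n"
            using heads_props(3)[OF h(1)] heads_props(3)[OF h(2)] run_less_iff[OF e, of u] run_less_iff[OF e, of v]
            by blast+
          have w: "pw v0 u \<in> group_words (fst (pres e))" "pw v0 v \<in> group_words (fst (pres e))"
            using words[OF e] l by auto
          have "ig_eq p u v \<longleftrightarrow> g_eq (pres e) (pw v0 u @ word_inv (pw v0 v)) []"
            using heads_eq_iff[OF h run] g_eq_iff_quotient[OF w(2)] by blast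
          also have "\<dots> \<longleftrightarrow> wpv e (u, v)"
            unfolding wpv_def q_def group_cong_iff fst_conv snd_conv quotient_code_letters[OF l] using w by simp
          finally show ?thesis .
        qed
        show ?thesis
        proof
          assume uv: "ig_eq p u v"
          obtain e where e: "e < n" "heads p e u" using hu by blast
          have "heads p e v" using heads_eq[OF e(2) uv] hv seeded_heads by blast
          then show "same (u, v)" unfolding same_def
            using e HH eq[OF e] uv run_rel[OF uv e(1)] by (intro exI[of _ e]) (simp add: lrunT)
        next
          assume "same (u, v)"
          then show "ig_eq p u v" unfolding same_def using HH eq by (auto simp: lrunT)
        qed
      qed
      finally show ?thesis .
    qed
    moreover have "(\<exists>e<n. H e u) \<longleftrightarrow> (\<exists>e<n. heads p e u)" "(\<exists>e<n. H e v) \<longleftrightarrow> (\<exists>e<n. heads p e v)"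
      using HH by blast+
    ultimately show ?thesis unfolding res_def reg[OF u] reg[OF v] by simp
  qed
  show ?thesis
  proof (intro exI[of _ B] ballI)
    fix u v assume "u \<in> lists {..<n}" "v \<in> lists {..<n}"
    from B[of u v, unfolded res[OF this]]
    show "rec_eval B [list_encode u, list_encode v]
     (if represents_regular {..<n} p u \<and> represents_regular {..<n} p v
      then (if IG_class {..<n} p u = IG_class {..<n} p v then 2 else 1) else 0)" .
  qed
qed

end

theorem theorem3p10:
  shows "\<exists>A :: recf. \<forall>(n :: nat) (p :: nat \<Rightarrow> nat \<Rightarrow> nat option). biordered_set {..<n} p \<longrightarrow>
    (\<exists>Ps :: group_presentation list.
       length Ps = n \<and>
       rec_eval A [table_code n p] (list_encode (map presentation_code Ps)) \<and>
       (\<forall>e<n. valid_presentation (Ps ! e) \<and>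
              presented_group (Ps ! e) \<cong> IG_max_subgroup {..<n} p e) \<and>
       ((\<forall>e<n. solvable_word_problem (Ps ! e)) \<longrightarrow>
          (\<exists>B :: recf. \<forall>u \<in> lists {..<n}. \<forall>v \<in> lists {..<n}.
             rec_eval B [list_encode u, list_encode v]
               (if represents_regular {..<n} p u \<and> represents_regular {..<n} p v
                then (if IG_class {..<n} p u = IG_class {..<n} p v then 2 else 1)
                else 0))))"
proof -
  obtain A where A: "\<And>T. rec_eval A [enc T] (enc (presentations T))"
    using computable_presentations by (elim computableE) blast
  show ?thesis
  proof (intro exI[of _ A] allI impI)
    fix n :: nat and p :: "nat \<Rightarrow> nat \<Rightarrow> nat option" assume "biordered_set {..<n} p"
    then obtain S m where S: "semigroup_on S m" "{..<n} = idempotents S m" "p = biorder_op S m"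
      unfolding biordered_set_def by blast
    interpret nat_biord S m p n by unfold_locales (use S in auto)
    let ?Ps = "map pres [0..<n]"
    have "length ?Ps = n" by simp
    moreover have "rec_eval A [table_code n p] (list_encode (map presentation_code ?Ps))"
      using A[of T] unfolding table_code presentations_code .
    moreover have "\<forall>e<n. valid_presentation (?Ps ! e) \<and> presented_group (?Ps ! e) \<cong> IG_max_subgroup {..<n} p e"
      using presentation_iso by simp
    moreover have "(\<forall>e<n. solvable_word_problem (?Ps ! e)) \<longrightarrow>
      (\<exists>B :: recf. \<forall>u \<in> lists {..<n}. \<forall>v \<in> lists {..<n}.
             rec_eval B [list_encode u, list_encode v]
               (if represents_regular {..<n} p u \<and> represents_regular {..<n} p v
                then (if IG_class {..<n} p u = IG_class {..<n} p v then 2 else 1)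
                else 0))"
      using comparison_algorithm by simp
    ultimately show "\<exists>Ps :: group_presentation list.
       length Ps = n \<and>
       rec_eval A [table_code n p] (list_encode (map presentation_code Ps)) \<and>
       (\<forall>e<n. valid_presentation (Ps ! e) \<and>
              presented_group (Ps ! e) \<cong> IG_max_subgroup {..<n} p e) \<and>
       ((\<forall>e<n. solvable_word_problem (Ps ! e)) \<longrightarrow>
          (\<exists>B :: recf. \<forall>u \<in> lists {..<n}. \<forall>v \<in> lists {..<n}.
             rec_eval B [list_encode u, list_encode v]
               (if represents_regular {..<n} p u \<and> represents_regular {..<n} p v
                then (if IG_class {..<n} p u = IG_class {..<n} p v then 2 else 1)
                else 0)))"
      by blast
  qed
qed

end
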